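(* Let $\tau:\mathbb{Z}/3\mathbb{Z}\to\mathcal{C}_3$ be a faithful representation, where $\mathcal{C}_3\subset O(\mathbb{R}^2)$ is the group generated by the rotation by $2\pi/3$ about the origin, let $G$ be a finite simple $\mathbb{Z}/3\mathbb{Z}$-symmetric graph with action $\theta:\mathbb{Z}/3\mathbb{Z}\to\mathrm{Aut}(G)$ free on $V(G)$, and let $(G,p)$ be a $\mathcal{C}_3$-regular framework in $\mathbb{R}^2$ with respect to $\theta$ and $\tau$. Then $$\operatorname{rank}R(G,p)=3\cdot\operatorname{rank}\mathcal{M}_{2,3,1}(H,\psi),$$ where $(H,\psi)$ denotes the quotient gain graph of $G$.
   Context: A framework $(G,p)$ in $\mathbb{R}^2$ is a finite simple graph $G$ with $p:V(G)\to\mathbb{R}^2$ such that $p(u)\ne p(v)$ for all edges $\{u,v\}$. The rigidity matrix $R(G,p)$ is the $|E(G)|\times 2|V(G)|$ matrix whose row for $\{u,v\}$ has $(p(u)-p(v))^\top$ in the columns of $u$, $(p(v)-p(u))^\top$ in the columns of $v$, and $0$ elsewhere. Let $\Gamma=\mathbb{Z}/3\mathbb{Z}$. An action is a homomorphism $\theta:\Gamma\to\mathrm{Aut}(G)$, written $\gamma v=\theta(\gamma)(v)$; free on $V(G)$ means no non-identity element fixes a vertex. $(G,p)$ is $\Gamma$-symmetric with respect to $\theta,\tau$ if $\tau(\gamma)p(v)=p(\gamma v)$ for all $\gamma,v$. It is $\mathcal{C}_3$-regular if it is $\Gamma$-symmetric and $\operatorname{rank}R(G,p)$ is maximal among all $\Gamma$-symmetric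 realizations of $G$ (with respect to the same $\theta,\tau$). Quotient gain graph $(H,\psi)$: choose one representative vertex in each vertex orbit. $V(H)$ is the set of vertex orbits, $E(H)$ the set of edge orbits; an edge orbit joining the orbits of representatives $u,v$ has the form $\{\{\gamma u,\gamma hv\}:\gamma\in\Gamma\}$ and is a directed edge (possibly a loop) from the orbit of $u$ to the orbit of $v$ with gain $\psi=h$ (reversing the direction inverts the gain). Gain-sparsity: a cycle (including loops and pairs of parallel edges) in $H$ is balanced if the product of its edge gains along the cycle (inverted for edges traversed backwards) is the identity. $F\subseteq E(H)$ is balanced if all its cycles are balanced. $V(F)$ is the set of endpoints of edges in $F$. An edge set $E$ is $(2,3,1)$-gain-sparse if $|F|\le 2|V(F)|-3$ for every nonempty balanced $F\subseteq E$ and $|F|\le 2|V(F)|-1$ for every nonempty $F\subseteq E$. The $(2,3,1)$-gain-sparse subsets of $E(H)$ are the independent sets of a matroid $\mathcal{M}_{2,3,1}(H,\psi)$ on $E(H)$; its rank is the maximum size of a $(2,3,1)$-gain-sparse subset of $E(H)$. *)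

theory Defs
  imports
    "HOL-Analysis.Analysis"
    "HOL-Algebra.Elementary_Groups"
    "HOL-Algebra.Group_Action"
    "Graph_Theory.Arc_Walk"
begin

section \<open>Graphs, frameworks and the rigidity matrix\<close>

text \<open>
  A finite simple graph is a set \<open>V\<close> of vertices in a finite type together with a set \<open>E\<close> of
  two-element subsets of \<open>V\<close>. A placement is a total function on the type of which only the values
  on \<open>V\<close> matter.
\<close>

definition simple_graph :: "'v set \<Rightarrow> 'v set set \<Rightarrow> bool" where
  "simple_graph V E \<longleftrightarrow> finite V \<and> (\<forall>e\<in>E. e \<subseteq> V \<and> card e = 2)"

definition framework :: "'v set set \<Rightarrow> ('v \<Rightarrow> real^2) \<Rightarrow> bool" where
  "framework E p \<longleftrightarrow> (\<forall>u v. {u, v} \<in> E \<longrightarrow> p u \<noteq> p v)"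

text \<open>
  Rows are indexed by all vertex sets and columns by all pairs of a vertex and a coordinate. Rows of
  non-edges and columns of elements outside \<open>V\<close> are zero, so the matrix is the usual
  \<open>|E| \<times> 2|V|\<close> matrix padded by zero rows and columns, and has the same rank.
  For an edge \<open>e = {u, v}\<close>, \<open>the_elem (e - {u})\<close> is the other endpoint \<open>v\<close>.
\<close>

definition rigidity_matrix ::
  "'v::finite set set \<Rightarrow> ('v \<Rightarrow> real^2) \<Rightarrow> real ^ ('v \<times> 2) ^ ('v set)" where
  "rigidity_matrix E p =
     (\<chi> e c. if e \<in> E \<and> fst c \<in> e
             then (p (fst c) - p (the_elem (e - {fst c}))) $ snd c
             else 0)"

section \<open>Symmetry\<close>

definition orthogonal_group2 :: "(real^2^2) monoid" where
  "orthogonal_group2 = \<lparr>carrier = {A. orthogonal_matrix A}, mult = (**), one = mat 1\<rparr>"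

definition rotation2 :: "real \<Rightarrow> real^2^2" where
  "rotation2 \<alpha> = vector [vector [cos \<alpha>, - sin \<alpha>], vector [sin \<alpha>, cos \<alpha>]]"

definition C3_group :: "(real^2^2) monoid" where
  "C3_group = subgroup_generated orthogonal_group2 {rotation2 (2 * pi / 3)}"

definition graph_aut_group :: "'v set \<Rightarrow> 'v set set \<Rightarrow> ('v \<Rightarrow> 'v) monoid" where
  "graph_aut_group V E =
     (BijGroup V)\<lparr>carrier := {f \<in> Bij V. \<forall>u\<in>V. \<forall>v\<in>V. {f u, f v} \<in> E \<longleftrightarrow> {u, v} \<in> E}\<rparr>"

definition free_action :: "'g monoid \<Rightarrow> 'v set \<Rightarrow> ('g \<Rightarrow> 'v \<Rightarrow> 'v) \<Rightarrow> bool" where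
  "free_action \<Gamma> V \<theta> \<longleftrightarrow> (\<forall>\<gamma>\<in>carrier \<Gamma>. \<gamma> \<noteq> \<one>\<^bsub>\<Gamma>\<^esub> \<longrightarrow> (\<forall>v\<in>V. \<theta> \<gamma> v \<noteq> v))"

definition symmetric_framework ::
  "'g monoid \<Rightarrow> 'v set \<Rightarrow> 'v set set \<Rightarrow> ('g \<Rightarrow> 'v \<Rightarrow> 'v) \<Rightarrow> ('g \<Rightarrow> real^2^2) \<Rightarrow>
     ('v \<Rightarrow> real^2) \<Rightarrow> bool" where
  "symmetric_framework \<Gamma> V E \<theta> \<tau> p \<longleftrightarrow>
     framework E p \<and> (\<forall>\<gamma>\<in>carrier \<Gamma>. \<forall>v\<in>V. \<tau> \<gamma> *v p v = p (\<theta> \<gamma> v))"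

definition symmetric_regular ::
  "'g monoid \<Rightarrow> 'v::finite set \<Rightarrow> 'v set set \<Rightarrow> ('g \<Rightarrow> 'v \<Rightarrow> 'v) \<Rightarrow> ('g \<Rightarrow> real^2^2) \<Rightarrow>
     ('v \<Rightarrow> real^2) \<Rightarrow> bool" where
  "symmetric_regular \<Gamma> V E \<theta> \<tau> p \<longleftrightarrow>
     symmetric_framework \<Gamma> V E \<theta> \<tau> p \<and>
     (\<forall>q. symmetric_framework \<Gamma> V E \<theta> \<tau> q \<longrightarrow>
          rank (rigidity_matrix E q) \<le> rank (rigidity_matrix E p))"

section \<open>Quotient gain graphs\<close>

text \<open>
  The vertices and arcs of a quotient gain graph are the vertex orbits and the edge orbits
  themselves. The quotient gain graph is determined only up to the choice of a representative
  \<open>rep U\<close> of every vertex orbit \<open>U\<close> and of an orientation of every edge orbit; the predicate holds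
  for every \<open>(H, \<psi>)\<close> arising from such choices.
\<close>

definition quotient_gain_graph ::
  "'g monoid \<Rightarrow> 'v set \<Rightarrow> 'v set set \<Rightarrow> ('g \<Rightarrow> 'v \<Rightarrow> 'v) \<Rightarrow>
     ('v set, 'v set set) pre_digraph \<Rightarrow> ('v set set \<Rightarrow> 'g) \<Rightarrow> bool" where
  "quotient_gain_graph \<Gamma> V E \<theta> H \<psi> \<longleftrightarrow>
     verts H = orbits \<Gamma> V \<theta> \<and>
     arcs H = orbits \<Gamma> E (\<lambda>\<gamma> e. \<theta> \<gamma> ` e) \<and>
     (\<exists>rep. (\<forall>U \<in> verts H. rep U \<in> U) \<and>
        (\<forall>a \<in> arcs H.
           tail H a \<in> verts H \<and> head H a \<in> verts H \<and> \<psi> a \<in> carrier \<Gamma> \<and>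
           a = {{\<theta> \<gamma> (rep (tail H a)), \<theta> (\<gamma> \<otimes>\<^bsub>\<Gamma>\<^esub> \<psi> a) (rep (head H a))} | \<gamma>. \<gamma> \<in> carrier \<Gamma>}))"

section \<open>Gain sparsity\<close>

text \<open>
  Cycles of a gain graph may traverse arcs in both directions. They are directed cycles of the
  graph in which every arc \<open>a \<in> F\<close> is replaced by a forward copy \<open>(a, True)\<close> and a backward copy
  \<open>(a, False)\<close>, subject to the condition that no arc is used twice (otherwise going along an arc
  and straight back would be a cycle). The library's notion of cycle includes loops and pairs of
  parallel arcs.
\<close>

definition bidirect :: "('a, 'b) pre_digraph \<Rightarrow> 'b set \<Rightarrow> ('a, 'b \<times> bool) pre_digraph" where
  "bidirect H F =
     \<lparr>verts = verts H, arcs = F \<times> UNIV,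
      tail = (\<lambda>(a, fwd). if fwd then tail H a else head H a),
      head = (\<lambda>(a, fwd). if fwd then head H a else tail H a)\<rparr>"

definition gain_cycle :: "('a, 'b) pre_digraph \<Rightarrow> 'b set \<Rightarrow> ('b \<times> bool) list \<Rightarrow> bool" where
  "gain_cycle H F c \<longleftrightarrow> pre_digraph.cycle (bidirect H F) c \<and> distinct (map fst c)"

definition walk_gain :: "'g monoid \<Rightarrow> ('b \<Rightarrow> 'g) \<Rightarrow> ('b \<times> bool) list \<Rightarrow> 'g" where
  "walk_gain \<Gamma> \<psi> c =
     foldr (\<lambda>(a, fwd) g. (if fwd then \<psi> a else inv\<^bsub>\<Gamma>\<^esub> \<psi> a) \<otimes>\<^bsub>\<Gamma>\<^esub> g) c \<one>\<^bsub>\<Gamma>\<^esub>"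

definition balanced :: "'g monoid \<Rightarrow> ('a, 'b) pre_digraph \<Rightarrow> ('b \<Rightarrow> 'g) \<Rightarrow> 'b set \<Rightarrow> bool" where
  "balanced \<Gamma> H \<psi> F \<longleftrightarrow> (\<forall>c. gain_cycle H F c \<longrightarrow> walk_gain \<Gamma> \<psi> c = \<one>\<^bsub>\<Gamma>\<^esub>)"

definition endpoints :: "('a, 'b) pre_digraph \<Rightarrow> 'b set \<Rightarrow> 'a set" where
  "endpoints H F = tail H ` F \<union> head H ` F"

definition gain_sparse231 ::
  "'g monoid \<Rightarrow> ('a, 'b) pre_digraph \<Rightarrow> ('b \<Rightarrow> 'g) \<Rightarrow> 'b set \<Rightarrow> bool" where
  "gain_sparse231 \<Gamma> H \<psi> S \<longleftrightarrow>
     (\<forall>F \<subseteq> S. F \<noteq> {} \<longrightarrow>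
        (balanced \<Gamma> H \<psi> F \<longrightarrow> int (card F) \<le> 2 * int (card (endpoints H F)) - 3) \<and>
        int (card F) \<le> 2 * int (card (endpoints H F)) - 1)"

definition gain_matroid_rank231 ::
  "'g monoid \<Rightarrow> ('a, 'b) pre_digraph \<Rightarrow> ('b \<Rightarrow> 'g) \<Rightarrow> nat" where
  "gain_matroid_rank231 \<Gamma> H \<psi> = Max {card S | S. S \<subseteq> arcs H \<and> gain_sparse231 \<Gamma> H \<psi> S}"

end

theory Submission
  imports Defs
begin

text \<open>
  Everything is compared with Laman sparsity of invariant edge sets \<open>D\<close> of \<open>G\<close>: every set \<open>X\<close> of at least
  two vertices spans at most \<open>2|X| - 3\<close> edges of \<open>D\<close>. A set of edge orbits is gain-sparse iff its
  union is Laman-sparse. A balanced set lifts to disjoint copies of itself, one for each choice of a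
  potential. Conversely, of all vertex sets that violate the Laman count, a largest one of minimal
  deficit is by submodularity either invariant or disjoint from its rotation. In the first case its arcs
  violate the count \<open>2|V(F)| - 1\<close>, in the second case they are balanced and violate \<open>2|V(F)| - 3\<close>.

  Since a union of two tight sets with at least two common vertices is tight, adding an edge orbit to an
  invariant sparse set keeps it sparse unless already a single edge of the orbit lies in a tight set.
  Hence a maximal gain-sparse set lifts to a maximal Laman-sparse set of edges, of size three times its
  own. As independent rows of the rigidity matrix are Laman-sparse, this bounds the rank from above.
  For the lower bound, every invariant Laman-sparse edge set has a symmetric placement without nonzero
  equilibrium stress. It is built by symmetric Henneberg moves: an orbit of vertices of degree at most
  two, an orbit that spans a triangle, or an orbit of vertices of degree three that replaces an orbit of
  edges.
\<close>

section \<open>Laman-sparse edge sets and symmetry of order three\<close>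

text \<open>Three times 2|W| - 1 is 2(3|W|) - 3, the Laman count of the 3|W| vertices above W. So
  the gain counts are what Laman sparsity leaves of invariant sets, and the rank can be computed in
  G itself, without splitting the rigidity matrix along the representations of the group.

  The obstacle is that the three edges of an orbit enter together: a priori each could be addable
  alone while the orbit is not. Divisibility resolves this: vertices and edges of an invariant set
  come in triples, so its deficit is a multiple of three, and a deficit of 0, 1 or 2 must be 0. The
  same fact lets the symmetric degree-three move be found by an unsymmetric argument at one vertex.

  For the lower bound no generic coordinates are chosen. Absence of a stress is an open condition,
  so after each move the placement is perturbed to a symmetric one in general position, ready for
  the next move. Stresses are not assumed symmetric; a stress is rotated instead, and its three
  rotations are compared at a single vertex.\<close>

definition induced :: "'v set set \<Rightarrow> 'v set \<Rightarrow> 'v set set" where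
  "induced E X = {e \<in> E. e \<subseteq> X}"

definition laman_sparse :: "'v set set \<Rightarrow> bool" where
  "laman_sparse E \<longleftrightarrow> (\<forall>X. 2 \<le> card X \<longrightarrow> card (induced E X) + 3 \<le> 2 * card X)"

text \<open>Integer-valued on purpose: it is negative on violating sets and -1 on singletons, and
  both values enter the submodularity arguments.\<close>

definition deficit :: "'v set set \<Rightarrow> 'v set \<Rightarrow> int" where
  "deficit E X = 2 * int (card X) - 3 - int (card (induced E X))"

definition tight :: "'v set set \<Rightarrow> 'v set \<Rightarrow> bool" where
  "tight E X \<longleftrightarrow> 2 \<le> card X \<and> deficit E X = 0"

text \<open>Taken over an arbitrary map, so that it serves vertices with \<open>g\<close> and edges
  with the image map of \<open>g\<close>.\<close>

definition orb :: "('v \<Rightarrow> 'v) \<Rightarrow> 'v \<Rightarrow> 'v set" where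
  "orb g x = {x, g x, g (g x)}"

section \<open>Submodularity of the deficit and tight sets\<close>

lemma laman_sparse_iff_deficit: "laman_sparse E \<longleftrightarrow> (\<forall>X. 2 \<le> card X \<longrightarrow> 0 \<le> deficit E X)"
  by (auto simp: laman_sparse_def deficit_def)

lemma laman_sparse_subset:
  fixes E :: "'v::finite set set"
  assumes "laman_sparse E" "F \<subseteq> E"
  shows "laman_sparse F"
proof -
  have "card (induced F X) \<le> card (induced E X)" for X
    using assms(2) by (intro card_mono) (auto simp: induced_def)
  then show ?thesis
    using assms(1) unfolding laman_sparse_def by (meson add_le_mono1 order_trans)
qed

text \<open>Cardinality is modular and the number of spanned edges is supermodular: the union spans
  all edges spanned by either set, and the edges spanned by both are those of the
  intersection.\<close>

lemma deficit_submodular: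
  fixes E :: "'v::finite set set"
  shows "deficit E (X \<union> Y) + deficit E (X \<inter> Y) \<le> deficit E X + deficit E Y"
proof -
  have "card (induced E X) + card (induced E Y)
      = card (induced E X \<union> induced E Y) + card (induced E X \<inter> induced E Y)"
    by (intro card_Un_Int) auto
  moreover have "card (induced E X \<union> induced E Y) \<le> card (induced E (X \<union> Y))"
    by (intro card_mono) (auto simp: induced_def)
  moreover have "induced E X \<inter> induced E Y = induced E (X \<inter> Y)"
    by (auto simp: induced_def)
  moreover have "card X + card Y = card (X \<union> Y) + card (X \<inter> Y)"
    by (intro card_Un_Int) auto
  ultimately show ?thesis
    by (simp add: deficit_def)
qed

text \<open>The edge \<open>e\<close> is spanned by the union but by neither set, which makes
  supermodularity of the edge count strict.\<close>

lemma deficit_submodular_crossing: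
  fixes E :: "'v::finite set set"
  assumes "e \<in> E" "e \<subseteq> X \<union> Y" "\<not> e \<subseteq> X" "\<not> e \<subseteq> Y"
  shows "deficit E (X \<union> Y) + deficit E (X \<inter> Y) < deficit E X + deficit E Y"
proof -
  have "card (induced E X) + card (induced E Y)
      = card (induced E X \<union> induced E Y) + card (induced E X \<inter> induced E Y)"
    by (intro card_Un_Int) auto
  moreover have "card (induced E X \<union> induced E Y) < card (induced E (X \<union> Y))"
    using assms by (intro psubset_card_mono) (auto simp: induced_def)
  moreover have "induced E X \<inter> induced E Y = induced E (X \<inter> Y)"
    by (auto simp: induced_def)
  moreover have "card X + card Y = card (X \<union> Y) + card (X \<inter> Y)"
    by (intro card_Un_Int) auto
  ultimately show ?thesis
    by (simp add: deficit_def)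
qed

lemma two_le_cardI:
  fixes X :: "'v::finite set"
  assumes "e \<subseteq> X" "card e = 2"
  shows "2 \<le> card X"
  using assms by (metis card_mono finite)

lemma deficit_singleton:
  assumes "\<forall>e\<in>E. card e = 2"
  shows "deficit E {x} = -1"
proof -
  have "induced E {x} = {}"
    using assms by (force simp: induced_def subset_singleton_iff)
  then show ?thesis by (simp add: deficit_def)
qed

lemma deficit_edge:
  fixes E :: "'v::finite set set"
  assumes "\<forall>e\<in>E. card e = 2" "card e = 2"
  shows "deficit E e = (if e \<in> E then 0 else 1)"
proof -
  have "induced E e = (if e \<in> E then {e} else {})"
  proof -
    have "f = e" if "f \<in> E" "f \<subseteq> e" for f
      using that assms by (intro card_subset_eq) auto
    then show ?thesis by (auto simp: induced_def)
  qed
  then show ?thesis using assms by (simp add: deficit_def)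
qed

lemma tight_Un:
  fixes E :: "'v::finite set set"
  assumes "laman_sparse E" "tight E X" "tight E Y" "2 \<le> card (X \<inter> Y)"
  shows "tight E (X \<union> Y)"
proof -
  have c: "2 \<le> card (X \<union> Y)"
    using assms(2) card_mono[of "X \<union> Y" X] by (auto simp: tight_def)
  then have "0 \<le> deficit E (X \<union> Y)" "0 \<le> deficit E (X \<inter> Y)"
    using assms by (auto simp: laman_sparse_iff_deficit)
  with c show ?thesis
    using deficit_submodular[of E X Y] assms(2,3) by (auto simp: tight_def)
qed

text \<open>Plays the part of a basis comparison in the rigidity matroid. Two maximal tight sets
  share at most one vertex, so the edges of \<open>S\<close> they span are disjoint. On each of them
  \<open>B\<close> has at most 2|X| - 3 edges, which is exactly the number that \<open>S\<close> has
  there.\<close>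

lemma sparse_card_le:
  fixes S B :: "'v::finite set set"
  assumes S: "laman_sparse S" and B: "laman_sparse B"
    and edges: "\<forall>e\<in>S. card e = 2"
    and cover: "\<forall>e\<in>B. \<exists>X. tight S X \<and> e \<subseteq> X"
  shows "card B \<le> card S"
proof -
  define C where "C = {X. tight S X \<and> (\<forall>Y. tight S Y \<longrightarrow> X \<subseteq> Y \<longrightarrow> X = Y)}"
  have up: "\<exists>Y\<in>C. X \<subseteq> Y" if "tight S X" for X
    using that
  proof (induction "card (UNIV - X)" arbitrary: X rule: less_induct)
    case less
    show ?case
    proof (cases "X \<in> C")
      case False
      then obtain Y where Y: "tight S Y" "X \<subset> Y"
        using less.prems by (auto simp: C_def)
      have "card (UNIV - Y) < card (UNIV - X)"
        using Y(2) by (intro psubset_card_mono) auto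
      from less.hyps[OF this Y(1)] show ?thesis using Y(2) by blast
    qed auto
  qed
  have disj: "induced S X \<inter> induced S Y = {}" if "X \<in> C" "Y \<in> C" "X \<noteq> Y" for X Y
  proof (rule ccontr)
    assume "induced S X \<inter> induced S Y \<noteq> {}"
    then obtain e where e: "e \<in> S" "e \<subseteq> X \<inter> Y" by (auto simp: induced_def)
    then have "2 \<le> card (X \<inter> Y)" using edges two_le_cardI by blast
    moreover have "tight S X" "tight S Y" using that by (simp_all add: C_def)
    ultimately have "tight S (X \<union> Y)" using S by (intro tight_Un)
    then have "X = X \<union> Y" "Y = X \<union> Y" using that(1,2) by (simp_all add: C_def)
    with that(3) show False by simp
  qed
  have "B \<subseteq> (\<Union>X\<in>C. induced B X)"
  proof
    fix e assume e: "e \<in> B"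
    then obtain X where "tight S X" "e \<subseteq> X" using cover by blast
    then obtain Y where "Y \<in> C" "e \<subseteq> Y" using up[of X] by blast
    then show "e \<in> (\<Union>X\<in>C. induced B X)" using e by (auto simp: induced_def)
  qed
  then have "card B \<le> card (\<Union>X\<in>C. induced B X)" by (intro card_mono) auto
  also have "\<dots> \<le> (\<Sum>X\<in>C. card (induced B X))" by (intro card_UN_le) auto
  also have "\<dots> \<le> (\<Sum>X\<in>C. card (induced S X))"
  proof (rule sum_mono)
    fix X assume "X \<in> C"
    then have "2 \<le> card X" "deficit S X = 0" by (auto simp: C_def tight_def)
    then show "card (induced B X) \<le> card (induced S X)"
      using B[unfolded laman_sparse_def, rule_format, of X] by (simp add: deficit_def)
  qed
  also have "\<dots> = card (\<Union>X\<in>C. induced S X)"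
    using disj by (intro card_UN_disjoint[symmetric]) auto
  also have "\<dots> \<le> card S" by (intro card_mono) (auto simp: induced_def)
  finally show ?thesis .
qed

text \<open>The set splits into orbits of exactly three elements, and one orbit is removed at a
  time. The map is constrained only on \<open>Y\<close>, so the lemma applies to vertices and to
  edges.\<close>

lemma three_dvd_card_invariant:
  assumes "finite Y" "\<forall>y\<in>Y. h y \<in> Y \<and> h (h (h y)) = y \<and> h y \<noteq> y"
  shows "3 dvd card Y"
  using assms
proof (induction Y rule: finite_psubset_induct)
  case (psubset Y)
  show ?case
  proof (cases "Y = {}")
    case False
    then obtain y where y: "y \<in> Y" by blast
    have h: "h z \<in> Y" "h (h (h z)) = z" "h z \<noteq> z" if "z \<in> Y" for z
      using psubset.prems that by blast+
    define Z where "Z = Y - orb h y"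
    have o: "orb h y \<subseteq> Y"
      using y h(1)[OF y] h(1)[OF h(1)[OF y]] by (simp add: orb_def)
    have "h (h y) \<noteq> y" using h(2,3)[OF y] by metis
    then have c: "card (orb h y) = 3"
      using h(3)[OF y] h(3)[OF h(1)[OF y]] unfolding orb_def by (metis card_3_iff)
    have "3 dvd card Z"
    proof (rule psubset.IH)
      show "Z \<subset> Y" using y by (auto simp: Z_def orb_def)
      show "\<forall>z\<in>Z. h z \<in> Z \<and> h (h (h z)) = z \<and> h z \<noteq> z"
      proof
        fix z assume z: "z \<in> Z"
        then have zY: "z \<in> Y" and "z \<notin> orb h y" by (auto simp: Z_def)
        moreover have "z \<in> orb h y" if "h z \<in> orb h y"
          using that h(2)[OF zY] h(2)[OF y] unfolding orb_def by (metis insertCI insertE singletonD)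
        ultimately show "h z \<in> Z \<and> h (h (h z)) = z \<and> h z \<noteq> z"
          using h[OF zY] by (auto simp: Z_def)
      qed
    qed
    moreover have "card Y = card Z + 3"
      using o c psubset.hyps card_mono[of Y "orb h y"]
      by (simp add: Z_def card_Diff_subset finite_subset)
    ultimately show ?thesis by simp
  qed auto
qed

section \<open>Edge sets invariant under a map of order three\<close>

locale order_three =
  fixes g :: "'v::finite \<Rightarrow> 'v"
  assumes g3: "g (g (g x)) = x"
begin

text \<open>In the application \<open>g\<close> is the identity off the vertex set, so for a free
  action this is the vertex set.\<close>

definition moved :: "'v set" where "moved = {x. g x \<noteq> x}"

definition free_graph :: "'v set set \<Rightarrow> bool" where
  "free_graph E \<longleftrightarrow> (\<forall>e\<in>E. g ` e \<in> E \<and> e \<subseteq> moved \<and> card e = 2)"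

lemma inj_g: "inj g"
  by (metis g3 injI)

lemma g_eq_iff [simp]: "g x = g y \<longleftrightarrow> x = y"
  by (metis g3)

lemma bij_g: "bij g"
  using inj_g by (simp add: finite_UNIV_inj_surj bij_def)

lemma orb_self: "x \<in> orb g x"
  by (simp add: orb_def)

lemma orb_g: "orb g (g x) = orb g x"
  by (auto simp: orb_def g3)

lemma orb_cases:
  assumes "y \<in> orb g x" obtains "y = x" | "y = g x" | "y = g (g x)"
  using assms by (auto simp: orb_def)

lemma orb_eq: "y \<in> orb g x \<Longrightarrow> orb g y = orb g x"
  by (elim orb_cases) (simp_all add: orb_g)

lemma mem_orb_iff: "y \<in> orb g x \<longleftrightarrow> orb g y = orb g x"
  using orb_eq orb_self by metis

lemma g_orb_iff: "g x \<in> orb g v \<longleftrightarrow> x \<in> orb g v"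
  by (simp add: mem_orb_iff orb_g)

lemma g_moved_iff [simp]: "g x \<in> moved \<longleftrightarrow> x \<in> moved"
  by (simp add: moved_def)

lemma moved_neq:
  assumes "x \<in> moved"
  shows "g x \<noteq> x" "x \<noteq> g x" "g (g x) \<noteq> x" "x \<noteq> g (g x)"
  using assms g3[of x] by (auto simp: moved_def dest: arg_cong[of _ _ g])

lemma image_g3 [simp]: "g ` g ` g ` X = X"
  by (simp add: image_image g3)

lemma image_g_subset_iff [simp]: "g ` X \<subseteq> g ` Y \<longleftrightarrow> X \<subseteq> Y"
  by (simp add: inj_g inj_image_subset_iff)

lemma image_g_moved_iff [simp]: "g ` X \<subseteq> moved \<longleftrightarrow> X \<subseteq> moved"
  by auto

lemma card_image_g [simp]: "card (g ` X) = card X"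
  by (metis card_image inj_g inj_on_subset subset_UNIV)

text \<open>A map fixing the edge as a set but neither of its ends would swap them, which a map of
  order three cannot do.\<close>

lemma image_g_edge_neq:
  assumes "e \<subseteq> moved" "card e = 2"
  shows "g ` e \<noteq> e"
proof
  assume ge: "g ` e = e"
  obtain u v where e: "e = {u, v}" "u \<noteq> v" using assms(2) by (auto simp: card_2_iff)
  then have "g u \<in> {u, v}" "g v \<in> {u, v}" using ge by auto
  then show False using assms(1) e moved_neq[of u] by auto
qed

lemma free_graph_image_iff:
  assumes "free_graph E"
  shows "g ` e \<in> E \<longleftrightarrow> e \<in> E"
  using assms unfolding free_graph_def by (metis image_g3)

lemma deficit_image:
  assumes "free_graph E"
  shows "deficit E (g ` X) = deficit E X"
proof -
  have "induced E (g ` X) = (`) g ` induced E X"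
  proof (intro equalityI subsetI)
    fix e assume e: "e \<in> induced E (g ` X)"
    define f where "f = g ` g ` e"
    have "e = g ` f" by (simp add: f_def)
    then have "f \<in> induced E X"
      using e free_graph_image_iff[OF assms, of f] by (auto simp: induced_def)
    with \<open>e = g ` f\<close> show "e \<in> (`) g ` induced E X" by blast
  next
    fix e assume "e \<in> (`) g ` induced E X"
    then show "e \<in> induced E (g ` X)"
      using assms by (auto simp: induced_def free_graph_def)
  qed
  moreover have "inj ((`) g)" by (simp add: inj_g inj_image_eq_iff inj_on_def)
  ultimately have "card (induced E (g ` X)) = card (induced E X)"
    by (metis card_image inj_on_subset subset_UNIV)
  then show ?thesis by (simp add: deficit_def)
qed

lemma tight_image:
  assumes "free_graph E" "tight E X"
  shows "tight E (g ` X)"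
  using assms by (simp add: tight_def deficit_image)

text \<open>All three terms of the deficit are multiples of three: vertices and spanned edges fall
  into orbits of size three, and the constant is 3.\<close>

lemma three_dvd_deficit:
  assumes "free_graph E" "X \<subseteq> moved" "g ` X = X"
  shows "3 dvd deficit E X"
proof -
  have "3 dvd card X"
    using assms by (intro three_dvd_card_invariant[of _ g]) (auto simp: g3 moved_neq)
  moreover have "3 dvd card (induced E X)"
  proof (rule three_dvd_card_invariant[of _ "(`) g"], simp, rule ballI)
    fix e assume e: "e \<in> induced E X"
    then have "g ` e \<subseteq> X" using assms(3) by (auto simp: induced_def)
    moreover have "g ` e \<noteq> e"
      using e assms(1) by (intro image_g_edge_neq) (auto simp: induced_def free_graph_def)
    ultimately show "g ` e \<in> induced E X \<and> g ` g ` g ` e = e \<and> g ` e \<noteq> e"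
      using e assms(1) by (auto simp: induced_def free_graph_def)
  qed
  ultimately show ?thesis
    by (auto simp: deficit_def elim!: dvdE)
qed

lemma deficit_Int_moved:
  assumes "free_graph E"
  shows "deficit E (X \<inter> moved) \<le> deficit E X"
proof -
  have "induced E (X \<inter> moved) = induced E X"
    using assms by (auto simp: induced_def free_graph_def)
  moreover have "card (X \<inter> moved) \<le> card X" by (intro card_mono) auto
  ultimately show ?thesis by (simp add: deficit_def)
qed

text \<open>Sets of minimal deficit containing a whole edge orbit form a lattice, so there is an
  invariant one, whose deficit is divisible by three.\<close>

lemma tight_of_orbit_deficit_le_2:
  assumes E: "free_graph E" "laman_sparse E"
    and e: "card e = 2" and X: "X \<subseteq> moved" "orb ((`) g) e \<subseteq> Pow X" "deficit E X \<le> 2"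
  obtains Y where "tight E Y" "e \<subseteq> Y"
proof -
  define \<Y> where "\<Y> = {Y. Y \<subseteq> moved \<and> orb ((`) g) e \<subseteq> Pow Y}"
  have card2: "2 \<le> card Y" if "Y \<in> \<Y>" for Y
    using that e by (intro two_le_cardI[of e]) (auto simp: \<Y>_def orb_def)
  have pos: "0 \<le> deficit E Y" if "Y \<in> \<Y>" for Y
    using card2[OF that] E(2) by (simp add: laman_sparse_iff_deficit)
  have gY: "g ` Y \<in> \<Y>" if "Y \<in> \<Y>" for Y
  proof -
    have "g ` e \<subseteq> Y" "g ` g ` e \<subseteq> Y" "e \<subseteq> Y" using that by (auto simp: \<Y>_def orb_def)
    then have "g ` g ` g ` e \<subseteq> g ` Y" "g ` e \<subseteq> g ` Y" "g ` g ` e \<subseteq> g ` Y"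
      by (metis image_g_subset_iff)+
    then show ?thesis using that by (auto simp: \<Y>_def orb_def)
  qed
  have "X \<in> \<Y>" using X by (simp add: \<Y>_def)
  define Y where "Y = arg_min_on (deficit E) \<Y>"
  have Y: "Y \<in> \<Y>" and min: "deficit E Y \<le> deficit E Z" if "Z \<in> \<Y>" for Z
    using arg_min_if_finite[of \<Y> "deficit E"] arg_min_least[of \<Y> Z "deficit E"] \<open>X \<in> \<Y>\<close> that
    by (auto simp: Y_def)
  define m where "m = deficit E Y"
  note Y = Y[OF \<open>X \<in> \<Y>\<close>]
  have lattice: "deficit E (A \<inter> B) = m"
    if "A \<in> \<Y>" "B \<in> \<Y>" "deficit E A = m" "deficit E B = m" for A B
  proof -
    have "A \<union> B \<in> \<Y>" "A \<inter> B \<in> \<Y>" using that by (auto simp: \<Y>_def)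
    from min[OF this(1)] min[OF this(2)] show ?thesis
      using deficit_submodular[of E A B] that by (simp add: m_def)
  qed
  define Z where "Z = Y \<inter> g ` Y \<inter> g ` g ` Y"
  have "deficit E (Y \<inter> g ` Y) = m"
    using Y gY[OF Y] by (intro lattice) (simp_all add: deficit_image[OF E(1)] m_def)
  moreover have "Y \<inter> g ` Y \<in> \<Y>"
    using Y gY[OF Y] by (auto simp: \<Y>_def)
  ultimately have "deficit E Z = m" "Z \<in> \<Y>"
    using gY[OF gY[OF Y]] unfolding Z_def
    by (intro lattice, simp_all add: deficit_image[OF E(1)] m_def) (auto simp: \<Y>_def)
  note Zm = this
  have "g ` Z = Z"
    by (auto simp: Z_def image_Int[OF inj_g])
  then have "3 dvd m"
    using three_dvd_deficit[OF E(1), of Z] Zm by (auto simp: \<Y>_def)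
  moreover have "0 \<le> m" "m \<le> 2"
    using pos[OF Y] min[OF \<open>X \<in> \<Y>\<close>] X(3) by (auto simp: m_def)
  ultimately have "m = 0" by presburger
  then show thesis
    using Zm card2[of Z] by (intro that[of Z]) (auto simp: tight_def \<Y>_def orb_def)
qed

lemma tight_of_two_deficit_le_1:
  assumes E: "free_graph E" "laman_sparse E"
    and e: "card e = 2" and X: "X \<subseteq> moved" "e \<subseteq> X" "g ` e \<subseteq> X" "deficit E X \<le> 1"
  obtains Y where "tight E Y" "e \<subseteq> Y"
proof (rule tight_of_orbit_deficit_le_2[OF E e, of "X \<union> g ` X"])
  have "g ` e \<subseteq> X \<inter> g ` X" using X by auto
  then have "2 \<le> card (X \<inter> g ` X)" using e by (intro two_le_cardI[of "g ` e"]) auto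
  then have "0 \<le> deficit E (X \<inter> g ` X)" using E by (simp add: laman_sparse_iff_deficit)
  then show "deficit E (X \<union> g ` X) \<le> 2"
    using deficit_submodular[of E X "g ` X"] X by (simp add: deficit_image[OF E(1)])
  show "orb ((`) g) e \<subseteq> Pow (X \<union> g ` X)"
    using X(2,3) image_mono[OF X(3), of g] by (auto simp: orb_def)
qed (use X in auto)

text \<open>If a violating set \<open>X\<close> contains j of the new edges, then its deficit in
  \<open>E\<close> is at most j - 1. For j = 1 the set is tight itself, for j = 2 and j = 3 the two
  preceding lemmas apply. The tight set found may contain another edge of the orbit and is then
  rotated to \<open>e\<close>.\<close>

lemma orbit_blocked:
  assumes E: "free_graph E" "laman_sparse E"
    and e: "e \<subseteq> moved" "card e = 2" and not: "\<not> laman_sparse (E \<union> orb ((`) g) e)"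
  obtains X where "tight E X" "e \<subseteq> X"
proof -
  define N where "N = orb ((`) g) e"
  have free: "free_graph (E \<union> N)"
    using E e by (auto simp: free_graph_def N_def orb_def)
  obtain X0 where X0: "2 \<le> card X0" "deficit (E \<union> N) X0 < 0"
    using not by (auto simp: laman_sparse_iff_deficit N_def not_le)
  define X where "X = X0 \<inter> moved"
  have X: "X \<subseteq> moved" "deficit (E \<union> N) X < 0"
    using deficit_Int_moved[OF free, of X0] X0(2) by (auto simp: X_def)
  have le: "deficit E X < int (card (induced N X))"
  proof -
    have "card (induced (E \<union> N) X) \<le> card (induced E X) + card (induced N X)"
      by (rule order_trans[OF card_mono card_Un_le]) (auto simp: induced_def)
    then show ?thesis using X(2) by (simp add: deficit_def)
  qed
  have ind: "induced N X \<subseteq> N" by (auto simp: induced_def)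
  have N: "f \<subseteq> moved" "card f = 2" "N = {f, g ` f, g ` g ` f}" if "f \<in> N" for f
  proof -
    have "f = e \<or> f = g ` e \<or> f = g ` g ` e" using that by (simp add: N_def orb_def)
    then show "f \<subseteq> moved" "card f = 2" "N = {f, g ` f, g ` g ` f}"
      using e by (elim disjE; simp only: N_def orb_def image_g_moved_iff card_image_g image_g3; blast)+
  qed
  have c: "2 \<le> card X"
  proof -
    have "induced (E \<union> N) X0 \<noteq> {}"
      using X0 by (auto simp: deficit_def)
    then obtain f where "f \<in> E \<union> N" "f \<subseteq> X0" by (auto simp: induced_def)
    then have "f \<subseteq> X" "card f = 2" using free by (auto simp: X_def free_graph_def)
    then show ?thesis by (rule two_le_cardI)
  qed
  then have "0 \<le> deficit E X" using E by (simp add: laman_sparse_iff_deficit)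
  with le have "induced N X \<noteq> {}" by auto
  then obtain f where f: "f \<in> N" "f \<subseteq> X" by (auto simp: induced_def)
  have "\<exists>f\<in>N. \<exists>Y. tight E Y \<and> f \<subseteq> Y"
  proof (cases "g ` f \<subseteq> X \<or> g ` g ` f \<subseteq> X")
    case False
    then have "induced N X = {f}"
      unfolding induced_def N(3)[OF f(1)] using f(2) by blast
    then have "tight E X" using le c \<open>0 \<le> deficit E X\<close> by (simp add: tight_def)
    then show ?thesis using f by blast
  next
    case True
    \<comment> \<open>Two edges of an orbit of length three are consecutive under \<open>g\<close>
      in one of the two orders.\<close>
    then obtain h where h: "h \<in> N" "h \<subseteq> X" "g ` h \<subseteq> X"
    proof (cases "g ` f \<subseteq> X")
      case False
      then have "g ` g ` f \<subseteq> X" "g ` g ` f \<in> N" using True N(3)[OF f(1)] by blast+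
      then show ?thesis using f(2) by (intro that[of "g ` g ` f"]) (simp_all only: image_g3)
    qed (use f in blast)
    show ?thesis
    proof (cases "g ` g ` h \<subseteq> X")
      case False
      then have "induced N X \<subseteq> {h, g ` h}"
        unfolding induced_def N(3)[OF h(1)] by blast
      then have "card (induced N X) \<le> card {h, g ` h}" by (intro card_mono) auto
      also have "\<dots> \<le> 2" by (simp add: card_insert_if)
      finally have "deficit E X \<le> 1" using le by linarith
      from tight_of_two_deficit_le_1[OF E N(2)[OF h(1)] X(1) h(2,3) this]
      show ?thesis using h(1) by metis
    next
      case True
      have "card (induced N X) \<le> card {h, g ` h, g ` g ` h}"
        using ind N(3)[OF h(1)] by (intro card_mono) auto
      also have "\<dots> \<le> 3" by (simp add: card_insert_if)
      finally have "deficit E X \<le> 2" using le by linarith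
      moreover have "orb ((`) g) h \<subseteq> Pow X"
        using h True by (simp add: orb_def)
      ultimately show ?thesis
        using tight_of_orbit_deficit_le_2[OF E N(2)[OF h(1)] X(1)] h(1) by metis
    qed
  qed
  then obtain f Y where fY: "f \<in> N" "tight E Y" "f \<subseteq> Y" by blast
  have "e \<in> N" by (simp add: N_def orb_def)
  then consider "e = f" | "e = g ` f" | "e = g ` g ` f" using N(3)[OF fY(1)] by blast
  then show thesis
  proof cases
    case 1
    then show ?thesis using that fY by metis
  next
    case 2
    then show ?thesis using that[of "g ` Y"] fY tight_image[OF E(1)] by simp
  next
    case 3
    then show ?thesis using that[of "g ` g ` Y"] fY tight_image[OF E(1)] by simp
  qed
qed

end

text \<open>Some pair of neighbours of a vertex of degree three is not contained in a tight set of the rest: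
  three tight sets, one for each pair, would be nearly disjoint, and their union with the vertex
  would span too many edges.\<close>

lemma one_reduction_pair:
  fixes E :: "'v::finite set set"
  assumes E: "laman_sparse E" "\<forall>e\<in>E. card e = 2" and F: "F \<subseteq> E" "\<forall>e\<in>F. v \<notin> e"
    and abc: "distinct [a, b, c]" "{v, a} \<in> E" "{v, b} \<in> E" "{v, c} \<in> E"
    and 1: "tight F X" "{a, b} \<subseteq> X" and 2: "tight F Y" "{b, c} \<subseteq> Y" and 3: "tight F Z" "{a, c} \<subseteq> Z"
  shows False
proof -
  have sF: "laman_sparse F" by (rule laman_sparse_subset[OF E(1) F(1)])
  have F2: "\<forall>e\<in>F. card e = 2" using E F by blast
  have "card {v, a} = 2" "card {v, b} = 2" "card {v, c} = 2" using abc E(2) by blast+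
  then have v: "v \<notin> {a, b, c}" by auto
  \<comment> \<open>No edge of \<open>F\<close> meets \<open>v\<close>, so dropping \<open>v\<close>
    from a tight set would lower the deficit by 2, below zero.\<close>
  have notv: "v \<notin> W" if "tight F W" "{x, y} \<subseteq> W" "x \<noteq> y" "{x, y} \<subseteq> {a, b, c}" for W x y
  proof
    assume vW: "v \<in> W"
    have "induced F (W - {v}) = induced F W" using F(2) by (auto simp: induced_def)
    moreover have "int (card W) = int (card (W - {v})) + 1"
      using card.remove[OF finite vW] by linarith
    moreover have "2 \<le> card (W - {v})"
      using that v by (intro two_le_cardI[of "{x, y}"]) auto
    moreover have "0 \<le> deficit F (W - {v})"
      using sF \<open>2 \<le> card (W - {v})\<close> by (simp only: laman_sparse_iff_deficit)
    ultimately show False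
      using that(1) unfolding tight_def deficit_def by presburger
  qed
  \<comment> \<open>Adding \<open>v\<close> with its three edges changes the deficit by 2 - 3, so a
    tight set containing all three neighbours would become a violation in \<open>E\<close>.\<close>
  have no3: False if W: "tight F W" "{a, b, c} \<subseteq> W" for W
  proof -
    have vW: "v \<notin> W" using notv[OF W(1), of a b] W(2) abc(1) by simp
    have "induced F W \<union> {{v, a}, {v, b}, {v, c}} \<subseteq> induced E (insert v W)"
      using F abc W by (auto simp: induced_def)
    then have "card (induced F W \<union> {{v, a}, {v, b}, {v, c}}) \<le> card (induced E (insert v W))"
      by (intro card_mono) auto
    moreover have "card (induced F W \<union> {{v, a}, {v, b}, {v, c}})
        = card (induced F W) + card {{v, a}, {v, b}, {v, c}}"
      using F by (intro card_Un_disjoint) (auto simp: induced_def)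
    moreover have "card {{v, a}, {v, b}, {v, c}} = 3"
      using abc(1) by (auto simp: card_insert_if doubleton_eq_iff)
    moreover have "card (insert v W) = Suc (card W)" using vW by simp
    moreover have "0 \<le> deficit E (insert v W)"
      using E(1) W vW by (auto simp: laman_sparse_iff_deficit tight_def)
    ultimately show False using W(1) by (simp add: deficit_def tight_def)
  qed
  \<comment> \<open>With two common vertices the union would be tight and contain all three
    neighbours.\<close>
  have single: "A \<inter> B = {x}" if AB: "tight F A" "tight F B" "x \<in> A \<inter> B" "{a, b, c} \<subseteq> A \<union> B" for A B x
  proof (rule ccontr)
    assume "A \<inter> B \<noteq> {x}"
    then obtain y where "y \<in> A \<inter> B" "y \<noteq> x" using AB(3) by blast
    then have "2 \<le> card (A \<inter> B)" using AB(3) by (intro two_le_cardI[of "{x, y}"]) auto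
    then have "tight F (A \<union> B)" using tight_Un[OF sF AB(1,2)] by simp
    then show False using no3[of "A \<union> B"] AB(4) by simp
  qed
  have XY: "X \<inter> Y = {b}"
    by (rule single[OF 1(1) 2(1)]) (use 1 2 in auto)
  have XZ: "X \<inter> Z = {a}"
    by (rule single[OF 1(1) 3(1)]) (use 1 3 in auto)
  have YZ: "Y \<inter> Z = {c}"
    by (rule single[OF 2(1) 3(1)]) (use 2 3 in auto)
  have XY_def: "deficit F (X \<union> Y) \<le> 1"
    using deficit_submodular[of F X Y] 1(1) 2(1) by (simp add: XY deficit_singleton[OF F2] tight_def)
  have "2 \<le> card (X \<union> Y)" "2 \<le> card (X \<union> Y \<union> Z)"
    using 1(2) abc(1) by (auto intro!: two_le_cardI[of "{a, b}"])
  then have pos: "0 \<le> deficit F (X \<union> Y)" "0 \<le> deficit F (X \<union> Y \<union> Z)"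
    using sF by (simp_all only: laman_sparse_iff_deficit)
  have "(X \<union> Y) \<inter> Z = {a, c}" using XZ YZ by blast
  moreover have "card {a, c} = 2" using abc(1) by simp
  ultimately have sub: "deficit F (X \<union> Y \<union> Z) + (if {a, c} \<in> F then 0 else 1) \<le> deficit F (X \<union> Y)"
    using deficit_submodular[of F "X \<union> Y" Z] deficit_edge[OF F2, of "{a, c}"] 3(1)
    by (simp add: tight_def)
  \<comment> \<open>If \<open>a\<close> and \<open>c\<close> are adjacent in \<open>F\<close>, their
    edge crosses between \<open>X\<close> and \<open>Y\<close>, so the union of these two is already
    tight. Otherwise the intersection {a, c} with \<open>Z\<close> has deficit 1, which brings the
    union of all three sets down to deficit 0.\<close>
  show False
  proof (cases "{a, c} \<in> F")
    case True
    have "c \<notin> X" "a \<notin> Y" using XY XZ YZ 1(2) 2(2) 3(2) abc(1) by auto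
    then have "deficit F (X \<union> Y) + deficit F (X \<inter> Y) < deficit F X + deficit F Y"
      using True 1(2) 2(2) by (intro deficit_submodular_crossing[of "{a, c}"]) auto
    then have "tight F (X \<union> Y)"
      using 1(1) 2(1) pos \<open>2 \<le> card (X \<union> Y)\<close> by (simp add: XY deficit_singleton[OF F2] tight_def)
    then show False using no3[of "X \<union> Y"] 1(2) 2(2) by simp
  next
    case False
    then have "tight F (X \<union> Y \<union> Z)"
      using sub pos XY_def \<open>2 \<le> card (X \<union> Y \<union> Z)\<close> by (simp add: tight_def)
    then show False using no3[of "X \<union> Y \<union> Z"] 1(2) 2(2) by simp
  qed
qed

section \<open>Equilibrium stresses\<close>

text \<open>A vector in the left kernel of the rigidity matrix, written as a symmetric function on
  ordered pairs so that equilibrium is a sum over all vertices and rotation is a reindexing. With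
  complex positions the rotation is a multiplication.\<close>

definition stress :: "'v set set \<Rightarrow> ('v::finite \<Rightarrow> complex) \<Rightarrow> ('v \<Rightarrow> 'v \<Rightarrow> real) \<Rightarrow> bool" where
  "stress E q w \<longleftrightarrow> (\<forall>x y. w x y = w y x) \<and> (\<forall>x y. {x, y} \<notin> E \<longrightarrow> w x y = 0) \<and>
     (\<forall>x. (\<Sum>y\<in>UNIV. w x y *\<^sub>R (q x - q y)) = 0)"

definition stress_free :: "'v set set \<Rightarrow> ('v::finite \<Rightarrow> complex) \<Rightarrow> bool" where
  "stress_free E q \<longleftrightarrow> (\<forall>w. stress E q w \<longrightarrow> (\<forall>x y. w x y = 0))"

text \<open>Up to sign the expression is twice the area of the triangle: no three points of
  \<open>M\<close> are collinear.\<close>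

definition general_position :: "'v set \<Rightarrow> ('v \<Rightarrow> complex) \<Rightarrow> bool" where
  "general_position M q \<longleftrightarrow> (\<forall>x\<in>M. \<forall>y\<in>M. \<forall>z\<in>M. x \<noteq> y \<longrightarrow> y \<noteq> z \<longrightarrow> x \<noteq> z \<longrightarrow>
     Im ((q y - q x) * cnj (q z - q x)) \<noteq> 0)"

lemma stressD:
  assumes "stress E q w"
  shows "w x y = w y x" "{x, y} \<notin> E \<Longrightarrow> w x y = 0" "(\<Sum>y\<in>UNIV. w x y *\<^sub>R (q x - q y)) = 0"
proof -
  note w = assms[unfolded stress_def]
  show "w x y = w y x" by (rule w[THEN conjunct1, THEN spec, THEN spec])
  show "{x, y} \<notin> E \<Longrightarrow> w x y = 0" by (rule w[THEN conjunct2, THEN conjunct1, rule_format])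
  show "(\<Sum>y\<in>UNIV. w x y *\<^sub>R (q x - q y)) = 0" by (rule w[THEN conjunct2, THEN conjunct2, THEN spec])
qed

text \<open>Normalized candidates for stresses form a compact set \<open>K\<close>, on which the
  total unbalanced force \<open>\<Phi> q\<close> has a positive minimum m. Moving the points by t
  times \<open>r\<close> changes this force by at most |t| times the maximum M of
  \<open>\<Phi> r\<close>.\<close>

lemma stress_free_perturb:
  assumes "stress_free E q"
  obtains \<epsilon> where "0 < \<epsilon>" "\<And>t. \<bar>t\<bar> < \<epsilon> \<Longrightarrow> stress_free E (\<lambda>x. q x + t *\<^sub>R r x)"
proof -
  define \<Phi> :: "('a \<Rightarrow> complex) \<Rightarrow> real^'a^'a \<Rightarrow> real" where
    "\<Phi> p w = (\<Sum>x\<in>UNIV. norm (\<Sum>y\<in>UNIV. w $ x $ y *\<^sub>R (p x - p y)))" for p w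
  define K :: "(real^'a^'a) set" where
    "K = {w. \<forall>x y. w $ x $ y = w $ y $ x} \<inter> {w. \<forall>x y. {x, y} \<notin> E \<longrightarrow> w $ x $ y = 0} \<inter> sphere 0 1"
  have stress_K: "\<exists>w\<in>K. \<Phi> p w = 0" if "\<not> stress_free E p" for p
  proof -
    obtain w x0 y0 where w: "stress E p w" "w x0 y0 \<noteq> 0"
      using \<open>\<not> stress_free E p\<close> by (auto simp: stress_free_def)
    define u :: "real^'a^'a" where "u = (\<chi> x y. w x y)"
    have "u \<noteq> 0" using w(2) by (auto simp: u_def vec_eq_iff)
    have "(\<Sum>y\<in>UNIV. (inverse (norm u) *\<^sub>R u) $ x $ y *\<^sub>R (p x - p y)) = 0" for x
    proof -
      have "(\<Sum>y\<in>UNIV. (inverse (norm u) *\<^sub>R u) $ x $ y *\<^sub>R (p x - p y))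
          = inverse (norm u) *\<^sub>R (\<Sum>y\<in>UNIV. w x y *\<^sub>R (p x - p y))"
        by (simp add: u_def scaleR_sum_right)
      also have "\<dots> = 0" using w(1) unfolding stress_def by (metis scaleR_zero_right)
      finally show ?thesis .
    qed
    moreover have "inverse (norm u) *\<^sub>R u \<in> K"
      using w(1) \<open>u \<noteq> 0\<close> by (simp add: K_def stress_def u_def)
    ultimately show ?thesis unfolding \<Phi>_def by (intro bexI[of _ "inverse (norm u) *\<^sub>R u"]) auto
  qed
  have cont: "continuous_on K (\<Phi> p)" for p
    unfolding \<Phi>_def by (intro continuous_intros)
  have "closed {w :: real^'a^'a. \<forall>x y. w $ x $ y = w $ y $ x}"
    by (intro closed_Collect_all closed_Collect_eq continuous_intros)
  moreover have "closed {w :: real^'a^'a. \<forall>x y. {x, y} \<notin> E \<longrightarrow> w $ x $ y = 0}"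
    by (intro closed_Collect_all closed_Collect_imp open_Collect_const closed_Collect_eq continuous_intros)
  ultimately have "compact K"
    unfolding K_def by (intro closed_Int_compact closed_Int) auto
  show thesis
  proof (cases "K = {}")
    case True
    then show thesis using stress_K that[of 1] by fastforce
  next
    case False
    obtain w0 where w0: "w0 \<in> K" "\<And>w. w \<in> K \<Longrightarrow> \<Phi> q w0 \<le> \<Phi> q w"
      using continuous_attains_inf[OF \<open>compact K\<close> False cont] by blast
    obtain w1 where w1: "w1 \<in> K" "\<And>w. w \<in> K \<Longrightarrow> \<Phi> r w \<le> \<Phi> r w1"
      using continuous_attains_sup[OF \<open>compact K\<close> False cont] by blast
    define m M where "m = \<Phi> q w0" and "M = \<Phi> r w1"
    have "M \<ge> 0" by (simp add: M_def \<Phi>_def sum_nonneg)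
    have "m \<noteq> 0"
    proof
      assume "m = 0"
      then have "\<forall>x. (\<Sum>y\<in>UNIV. w0 $ x $ y *\<^sub>R (q x - q y)) = 0"
        by (simp add: m_def \<Phi>_def sum_nonneg_eq_0_iff)
      then have "stress E q (\<lambda>x y. w0 $ x $ y)"
        using w0(1) by (simp add: stress_def K_def)
      from assms[unfolded stress_free_def, rule_format, OF this]
      have "w0 = 0" by (simp add: vec_eq_iff)
      then show False using w0(1) by (simp add: K_def)
    qed
    moreover have "m \<ge> 0" by (simp add: m_def \<Phi>_def sum_nonneg)
    ultimately have "m > 0" by simp
    show thesis
    proof (rule that)
      \<comment> \<open>The summand 1 covers the case M = 0.\<close>
      show "0 < m / (M + 1)" using \<open>m > 0\<close> \<open>M \<ge> 0\<close> by simp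
      fix t :: real assume t: "\<bar>t\<bar> < m / (M + 1)"
      show "stress_free E (\<lambda>x. q x + t *\<^sub>R r x)"
      proof (rule ccontr)
        assume "\<not> stress_free E (\<lambda>x. q x + t *\<^sub>R r x)"
        then obtain w where w: "w \<in> K" "\<Phi> (\<lambda>x. q x + t *\<^sub>R r x) w = 0" using stress_K by blast
        have eq: "(\<Sum>y\<in>UNIV. w $ x $ y *\<^sub>R (q x + t *\<^sub>R r x - (q y + t *\<^sub>R r y)))
            = (\<Sum>y\<in>UNIV. w $ x $ y *\<^sub>R (q x - q y)) + t *\<^sub>R (\<Sum>y\<in>UNIV. w $ x $ y *\<^sub>R (r x - r y))" for x
          by (simp add: scaleR_sum_right sum.distrib[symmetric] algebra_simps)
        have "\<Phi> q w \<le> \<bar>t\<bar> * \<Phi> r w"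
          unfolding \<Phi>_def sum_distrib_left
        proof (rule sum_mono)
          fix x
          have "(\<Sum>y\<in>UNIV. w $ x $ y *\<^sub>R (q x - q y)) + t *\<^sub>R (\<Sum>y\<in>UNIV. w $ x $ y *\<^sub>R (r x - r y)) = 0"
            using w(2) unfolding eq[symmetric] by (simp add: \<Phi>_def sum_nonneg_eq_0_iff)
          then have "(\<Sum>y\<in>UNIV. w $ x $ y *\<^sub>R (q x - q y))
              = - (t *\<^sub>R (\<Sum>y\<in>UNIV. w $ x $ y *\<^sub>R (r x - r y)))"
            by (rule eq_neg_iff_add_eq_0[THEN iffD2])
          then show "norm (\<Sum>y\<in>UNIV. w $ x $ y *\<^sub>R (q x - q y))
              \<le> \<bar>t\<bar> * norm (\<Sum>y\<in>UNIV. w $ x $ y *\<^sub>R (r x - r y))" by simp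
        qed
        then have "m \<le> \<bar>t\<bar> * M"
          using w0(2)[OF w(1)] w1(2)[OF w(1)] mult_left_mono[of "\<Phi> r w" M "\<bar>t\<bar>"]
          by (simp add: m_def M_def)
        also have "\<dots> \<le> \<bar>t\<bar> * (M + 1)" by (simp add: mult_left_mono)
        also have "\<dots> < m" using t \<open>M \<ge> 0\<close> by (simp add: pos_less_divide_eq)
        finally show False by simp
      qed
    qed
  qed
qed

lemma stress_free_subset:
  assumes "stress_free F q" "E \<subseteq> F"
  shows "stress_free E q"
proof -
  have "stress F q w" if "stress E q w" for w
    using that subsetD[OF assms(2)] unfolding stress_def by metis
  then show ?thesis using assms(1) by (simp add: stress_free_def)
qed

lemma stress_free_cong:
  assumes "stress_free E q" "\<And>e x. e \<in> E \<Longrightarrow> x \<in> e \<Longrightarrow> q' x = q x"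
  shows "stress_free E q'"
proof -
  have "stress E q w" if w: "stress E q' w" for w
  proof -
    have "w x y *\<^sub>R (q x - q y) = w x y *\<^sub>R (q' x - q' y)" for x y
      using w assms(2)[of "{x, y}"] by (cases "{x, y} \<in> E") (auto simp: stress_def)
    then have "(\<Sum>y\<in>UNIV. w x y *\<^sub>R (q x - q y)) = (\<Sum>y\<in>UNIV. w x y *\<^sub>R (q' x - q' y))" for x
      by (rule sum.cong[OF refl])
    with w show ?thesis unfolding stress_def by metis
  qed
  then show ?thesis using assms(1) by (simp add: stress_free_def)
qed

section \<open>Points in the complex plane\<close>

lemma noncollinear_unit_circle:
  fixes a b c :: complex
  assumes "norm a = 1" "norm b = 1" "norm c = 1" "a \<noteq> b" "b \<noteq> c" "a \<noteq> c"
  shows "Im ((b - a) * cnj (c - a)) \<noteq> 0"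
proof
  assume "Im ((b - a) * cnj (c - a)) = 0"
  moreover have "cnj z = z" if "Im z = 0" for z
    using that by (simp add: complex_eq_iff)
  ultimately have "cnj ((b - a) * cnj (c - a)) = (b - a) * cnj (c - a)" by blast
  then have eq: "(cnj b - cnj a) * (c - a) = (b - a) * (cnj c - cnj a)" by simp
  have unit: "z * cnj z = 1" if "norm z = 1" for z :: complex
    using that complex_norm_square[of z] by simp
  \<comment> \<open>On the unit circle conjugation is inversion. Multiplying \<open>eq\<close> by a
    b c therefore removes the conjugates and leaves c (a - b)(c - a) = b (a - b)(c - a), which
    forces two of the points to coincide.\<close>
  have "c * ((a - b) * (c - a)) = (b * cnj b) * a * c * (c - a) - (a * cnj a) * b * c * (c - a)"
    by (simp add: unit assms algebra_simps)
  also have "\<dots> = a * b * c * ((cnj b - cnj a) * (c - a))" by (simp add: algebra_simps)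
  also have "\<dots> = (c * cnj c) * a * b * (b - a) - (a * cnj a) * b * c * (b - a)"
    unfolding eq by (simp add: algebra_simps)
  also have "\<dots> = b * ((a - b) * (c - a))" by (simp add: unit assms algebra_simps)
  finally show False using assms by simp
qed

text \<open>Cramer's rule: \<open>Im (p * cnj s)\<close> is, up to sign, the determinant of the two
  real equations.\<close>

lemma real_combination_zero:
  fixes p s :: complex
  assumes "a *\<^sub>R p + b *\<^sub>R s = 0" "Im (p * cnj s) \<noteq> 0"
  shows "a = 0 \<and> b = 0"
proof -
  have "a * Re p + b * Re s = 0" "a * Im p + b * Im s = 0"
    using assms(1) by (auto simp: complex_eq_iff)
  moreover have "a * (Im p * Re s - Re p * Im s) = Re s * (a * Im p + b * Im s) - Im s * (a * Re p + b * Re s)"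
    "b * (Im p * Re s - Re p * Im s) = Im p * (a * Re p + b * Re s) - Re p * (a * Im p + b * Im s)"
    by (simp_all add: algebra_simps)
  ultimately show ?thesis using assms(2) by auto
qed

lemma infinite_unit_circle: "infinite (sphere (0::complex) 1)"
proof -
  have "connected (sphere (0::complex) 1)"
    by (intro connected_sphere) simp
  moreover have "1 \<in> sphere (0::complex) 1" "- 1 \<in> sphere (0::complex) 1" by auto
  moreover have "(1::complex) \<noteq> - 1" by simp
  ultimately show ?thesis
    using connected_finite_iff_sing by (metis empty_iff singletonD)
qed

text \<open>A pair (a, b) encodes the line through a in direction b. Points are sought on the
  parabola (t, t^2), which every line meets at most twice.\<close>

lemma exists_avoiding_lines:
  fixes A :: "(complex \<times> complex) set"
  assumes "finite A" "\<forall>(a, b)\<in>A. b \<noteq> 0"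
  obtains z where "\<forall>(a, b)\<in>A. Im ((z - a) * cnj b) \<noteq> 0"
proof -
  define P where "P = (\<lambda>(a, b). [: - Im (a * cnj b), - Im b, Re b :])"
  define B where "B = (\<Union>ab\<in>A. {t. poly (P ab) t = 0})"
  have "finite B"
    using assms unfolding B_def P_def
    by (intro finite_UN_I poly_roots_finite) (auto simp: complex_eq_iff)
  then obtain t :: real where t: "t \<notin> B" using ex_new_if_finite infinite_UNIV_char_0 by blast
  have "Im ((Complex t (t\<^sup>2) - a) * cnj b) = poly (P (a, b)) t" for a b
    by (simp add: P_def power2_eq_square algebra_simps)
  then have "\<forall>(a, b)\<in>A. Im ((Complex t (t\<^sup>2) - a) * cnj b) \<noteq> 0"
    using t by (auto simp: B_def)
  then show thesis by (rule that)
qed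

section \<open>Symmetric placements\<close>

text \<open>Either primitive cube root of unity is allowed, because a faithful representation may
  send 1 to the rotation or to its inverse.\<close>

locale c3_symmetry = order_three g for g :: "'v::finite \<Rightarrow> 'v" +
  fixes \<omega> :: complex
  assumes cube: "\<omega> ^ 3 = 1" and neq_1: "\<omega> \<noteq> 1"
begin

definition symmetric :: "('v \<Rightarrow> complex) \<Rightarrow> bool" where
  "symmetric q \<longleftrightarrow> (\<forall>x. q (g x) = \<omega> * q x)"

lemma cube': "\<omega> * (\<omega> * (\<omega> * z)) = z"
  using cube by (simp add: power3_eq_cube mult.assoc[symmetric])

lemma omega_nonzero: "\<omega> \<noteq> 0"
  using cube by auto

lemma omega_sum: "1 + \<omega> + \<omega>\<^sup>2 = 0"
proof -
  have "(\<omega> - 1) * (1 + \<omega> + \<omega>\<^sup>2) = 0"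
    using cube by (simp add: algebra_simps power2_eq_square power3_eq_cube)
  then show ?thesis using neq_1 by simp
qed

lemma omega_square: "\<omega> * \<omega> = - 1 - \<omega>"
  using omega_sum by (simp add: power2_eq_square algebra_simps add_eq_0_iff)

lemma norm_omega: "norm \<omega> = 1"
proof -
  have "norm \<omega> ^ 3 = 1" using cube by (metis norm_one norm_power)
  then show ?thesis using power_eq_imp_eq_base[of "norm \<omega>" 3 1] by simp
qed

lemma cnj_omega: "cnj \<omega> = - 1 - \<omega>"
proof -
  have "\<omega> * cnj \<omega> = of_real ((norm \<omega>)\<^sup>2)" by (rule complex_norm_square[symmetric])
  also have "\<dots> = 1" by (simp only: norm_omega one_power2 of_real_1)
  also have "1 = \<omega> * (\<omega> * \<omega>)" using cube'[of 1] by simp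
  finally have "cnj \<omega> = \<omega> * \<omega>" by (rule mult_left_cancel[OF omega_nonzero, THEN iffD1])
  then show ?thesis by (simp only: omega_square)
qed

text \<open>The real part is -1/2, so a real \<open>\<omega>\<close> would have norm 1/2.\<close>

lemma Im_omega: "Im \<omega> \<noteq> 0"
proof
  assume "Im \<omega> = 0"
  moreover have "Re \<omega> = - 1 - Re \<omega>" using arg_cong[OF cnj_omega, of Re] by simp
  ultimately show False using norm_omega cmod_eq_Re[of \<omega>] by simp
qed

text \<open>Distinct points of the unit circle are never collinear in threes, so an injective
  symmetric placement on it suffices. Each orbit receives its own point of the circle, and its three
  vertices receive the cube roots of that point; cubing recovers the orbit.\<close>

lemma exists_symmetric_general_position: "\<exists>q. symmetric q \<and> general_position moved q"
proof -
  obtain T :: "complex set" where T: "T \<subseteq> sphere 0 1" "finite T" "card T = CARD('v set)"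
    using infinite_arbitrarily_large[OF infinite_unit_circle] by blast
  then obtain f :: "'v set \<Rightarrow> complex" where f: "bij_betw f UNIV T"
    using finite_same_card_bij by (metis finite)
  have "\<forall>U. \<exists>z. z ^ 3 = f U" using exists_complex_root[of 3] by (metis zero_neq_numeral)
  then obtain c where c: "\<And>U. c U ^ 3 = f U" by metis
  have nc: "norm (c U) = 1" for U
  proof -
    have "f U \<in> T" using f by (auto simp: bij_betw_def)
    then have "norm (c U) ^ 3 = 1" using T(1) by (auto simp flip: c norm_power)
    then show ?thesis using power_eq_imp_eq_base[of "norm (c U)" 3 1] by simp
  qed
  define r where "r U = (SOME y :: 'v. y \<in> U)" for U
  have r: "r (orb g x) \<in> orb g x" for x
    unfolding r_def some_in_eq by (simp add: orb_def)
  define k where "k x = (let y = r (orb g x) in if x = y then 1 else if x = g y then \<omega> else \<omega> * \<omega>)" for x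
  \<comment> \<open>A fixed vertex can only sit at 0, the fixed point of the rotation.\<close>
  define q where "q x = (if x \<in> moved then k x * c (orb g x) else 0)" for x
  have kg: "k (g x) = \<omega> * k x" if "x \<in> moved" for x
    using r[of x] moved_neq[OF that] cube'[of 1]
    by (elim orb_cases) (auto simp: k_def orb_g Let_def g3)
  have sym: "symmetric q"
    using kg by (auto simp: symmetric_def q_def orb_g moved_def)
  have nq: "norm (q x) = 1" if "x \<in> moved" for x
    using that by (auto simp: q_def norm_mult nc k_def Let_def norm_omega)
  have inj: "x = y" if "q x = q y" "x \<in> moved" "y \<in> moved" for x y
  proof -
    have "k z ^ 3 = 1" for z
      using cube by (auto simp: k_def Let_def power_mult_distrib)
    then have "q x ^ 3 = f (orb g x)" "q y ^ 3 = f (orb g y)"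
      using that(2,3) by (simp_all add: q_def power_mult_distrib c)
    then have "f (orb g x) = f (orb g y)" using that(1) by simp
    then have "orb g x = orb g y" using f by (auto simp: bij_betw_def dest: injD)
    then have "y \<in> orb g x" by (auto simp: orb_def)
    then show ?thesis
    proof (cases rule: orb_cases)
      case 2
      then have "q y = \<omega> * q x" using sym by (simp add: symmetric_def)
      then show ?thesis using that(1) nq[OF that(2)] neq_1 by auto
    next
      case 3
      then have "q y = \<omega> * (\<omega> * q x)" using sym by (simp add: symmetric_def)
      then have "q x = \<omega> * (\<omega> * q x)" using that(1) by simp
      then have "\<omega> * q x = \<omega> * (\<omega> * (\<omega> * q x))" by (rule arg_cong)
      then have "\<omega> * q x = q x" by (simp only: cube')
      then show ?thesis using nq[OF that(2)] neq_1 by auto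
    qed auto
  qed
  have "general_position moved q"
    unfolding general_position_def
  proof (intro ballI impI)
    fix x y z assume "x \<in> moved" "y \<in> moved" "z \<in> moved" "x \<noteq> y" "y \<noteq> z" "x \<noteq> z"
    then show "Im ((q y - q x) * cnj (q z - q x)) \<noteq> 0"
      by (intro noncollinear_unit_circle nq) (auto dest: inj)
  qed
  with sym show ?thesis by blast
qed

text \<open>Along q + t r the area of each triple is a quadratic polynomial in t whose leading
  coefficient is the area in \<open>r\<close>, hence nonzero. Only finitely many t are bad, while
  all sufficiently small t keep the placement free of stresses.\<close>

lemma general_position_perturb:
  assumes "symmetric q" "stress_free E q"
  obtains q' where "symmetric q'" "stress_free E q'" "general_position moved q'"
proof -
  obtain r where r: "symmetric r" "general_position moved r"
    using exists_symmetric_general_position by blast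
  obtain \<epsilon> where \<epsilon>: "0 < \<epsilon>" "\<And>t. \<bar>t\<bar> < \<epsilon> \<Longrightarrow> stress_free E (\<lambda>x. q x + t *\<^sub>R r x)"
    using stress_free_perturb[OF assms(2)] by metis
  define P where "P = (\<lambda>(x, y, z). let a = q y - q x; b = r y - r x; c = q z - q x; d = r z - r x in
      [: Im (a * cnj c), Im (a * cnj d + b * cnj c), Im (b * cnj d) :])"
  define A where "A = {(x, y, z). x \<in> moved \<and> y \<in> moved \<and> z \<in> moved \<and> x \<noteq> y \<and> y \<noteq> z \<and> x \<noteq> z}"
  define B where "B = (\<Union>xyz\<in>A. {t. poly (P xyz) t = 0})"
  have "finite B"
    unfolding B_def
  proof (intro finite_UN_I poly_roots_finite)
    fix xyz assume "xyz \<in> A"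
    then obtain x y z where xyz: "xyz = (x, y, z)"
      and "x \<in> moved" "y \<in> moved" "z \<in> moved" "x \<noteq> y" "y \<noteq> z" "x \<noteq> z"
      by (auto simp: A_def)
    then have "Im ((r y - r x) * cnj (r z - r x)) \<noteq> 0"
      using r(2) by (simp only: general_position_def simp_thms)
    then show "P xyz \<noteq> 0"
      by (simp only: xyz P_def Let_def prod.case pCons_eq_0_iff simp_thms)
  qed simp
  moreover have "infinite {0<..<\<epsilon>}" using \<epsilon>(1) by simp
  ultimately obtain t where t: "0 < t" "t < \<epsilon>" "t \<notin> B"
    by (metis finite_subset greaterThanLessThan_iff subsetI)
  define q' where "q' x = q x + t *\<^sub>R r x" for x
  have "symmetric q'"
    using assms(1) r(1) by (simp add: symmetric_def q'_def algebra_simps)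
  moreover have "stress_free E q'"
    using \<epsilon>(2)[of t] t by (simp add: q'_def[abs_def])
  moreover have "general_position moved q'"
    unfolding general_position_def
  proof (intro ballI impI)
    fix x y z assume "x \<in> moved" "y \<in> moved" "z \<in> moved" "x \<noteq> y" "y \<noteq> z" "x \<noteq> z"
    then have "poly (P (x, y, z)) t \<noteq> 0" using t(3) by (auto simp: A_def B_def)
    moreover have "poly (P (x, y, z)) t = Im ((q' y - q' x) * cnj (q' z - q' x))"
      by (simp add: P_def Let_def q'_def algebra_simps)
    ultimately show "Im ((q' y - q' x) * cnj (q' z - q' x)) \<noteq> 0" by simp
  qed
  ultimately show thesis by (rule that)
qed

text \<open>The orbit of \<open>x\<close> supplies a third point, with which coinciding points would
  span a degenerate triangle.\<close>

lemma general_position_neq: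
  assumes "general_position moved q" "x \<in> moved" "y \<in> moved" "x \<noteq> y"
  shows "q x \<noteq> q y"
proof -
  obtain z where "z \<in> moved" "z \<noteq> x" "z \<noteq> y"
    using assms(2,4) moved_neq[OF assms(2)] moved_neq[of "g x"] by (metis g_moved_iff)
  then have "Im ((q y - q x) * cnj (q z - q x)) \<noteq> 0"
    using assms by (simp add: general_position_def)
  then show ?thesis by auto
qed

section \<open>Rotating stresses and deleting a vertex orbit\<close>

lemma stress_rotate:
  assumes "symmetric q" "free_graph E" "stress E q w"
  shows "stress E q (\<lambda>x y. w (g x) (g y))"
  unfolding stress_def
proof (intro conjI allI impI)
  fix x y show "w (g x) (g y) = w (g y) (g x)" by (rule stressD(1)[OF assms(3)])
next
  fix x y assume "{x, y} \<notin> E"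
  then have "{g x, g y} \<notin> E" using free_graph_image_iff[OF assms(2), of "{x, y}"] by simp
  then show "w (g x) (g y) = 0" by (rule stressD(2)[OF assms(3)])
next
  fix x
  have "\<omega> * (\<Sum>y\<in>UNIV. w (g x) (g y) *\<^sub>R (q x - q y)) = (\<Sum>y\<in>UNIV. w (g x) (g y) *\<^sub>R (q (g x) - q (g y)))"
    using assms(1) by (simp add: symmetric_def sum_distrib_left algebra_simps)
  also have "\<dots> = (\<Sum>y\<in>UNIV. w (g x) y *\<^sub>R (q (g x) - q y))"
    by (rule sum.reindex_bij_betw[OF bij_g])
  also have "\<dots> = 0" by (rule stressD(3)[OF assms(3)])
  finally show "(\<Sum>y\<in>UNIV. w (g x) (g y) *\<^sub>R (q x - q y)) = 0" using omega_nonzero by simp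
qed

definition avoiding :: "'v set set \<Rightarrow> 'v \<Rightarrow> 'v set set" where
  "avoiding E v = {e \<in> E. e \<inter> orb g v = {}}"

lemma free_graph_avoiding:
  assumes "free_graph E"
  shows "free_graph (avoiding E v)"
proof -
  have "g ` e \<inter> orb g v = {}" if "e \<inter> orb g v = {}" for e
  proof -
    have "x \<in> orb g v" if "g x \<in> orb g v" for x
      using that g3 by (metis orb_eq orb_g orb_def insertI1)
    then show ?thesis using that by auto
  qed
  then show ?thesis using assms by (auto simp: free_graph_def avoiding_def)
qed

text \<open>Checking the one vertex \<open>v\<close> is enough: the values of a stress at
  \<open>g v\<close> and \<open>g (g v)\<close> are the values at \<open>v\<close> of its rotations,
  which are stresses as well.\<close>

lemma stress_free_of_avoiding:
  assumes q: "symmetric q" and E: "free_graph E" and free: "stress_free (avoiding E v) q"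
    and zero: "\<And>w y. stress E q w \<Longrightarrow> w v y = 0"
  shows "stress_free E q"
  unfolding stress_free_def
proof (intro allI impI)
  fix w x y assume w: "stress E q w"
  have w1: "stress E q (\<lambda>x y. w (g x) (g y))" by (rule stress_rotate[OF q E w])
  have w2: "stress E q (\<lambda>x y. w (g (g x)) (g (g y)))" by (rule stress_rotate[OF q E w1])
  have "w v y = 0 \<and> w (g v) y = 0 \<and> w (g (g v)) y = 0" for y
    using zero[OF w, of y] zero[OF w1, of "g (g y)"] zero[OF w2, of "g y"] by (simp add: g3)
  then have z: "w x y = 0" if "x \<in> orb g v" for x y using that by (auto simp: orb_def)
  note sym = stressD(1)[OF w]
  have "stress (avoiding E v) q w"
    unfolding stress_def
  proof (intro conjI allI impI)
    fix x y assume "{x, y} \<notin> avoiding E v"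
    then consider "{x, y} \<notin> E" | "x \<in> orb g v" | "y \<in> orb g v" by (auto simp: avoiding_def)
    then show "w x y = 0"
    proof cases
      case 1
      then show ?thesis by (rule stressD(2)[OF w])
    next
      case 2
      then show ?thesis by (rule z)
    next
      case 3
      then show ?thesis unfolding sym[of x y] by (rule z)
    qed
  qed (rule sym, rule stressD(3)[OF w])
  then show "w x y = 0" using free by (simp add: stress_free_def)
qed

end

section \<open>Henneberg extensions\<close>

context c3_symmetry begin

definition place :: "('v \<Rightarrow> complex) \<Rightarrow> 'v \<Rightarrow> complex \<Rightarrow> 'v \<Rightarrow> complex" where
  "place q v z = q(v := z, g v := \<omega> * z, g (g v) := \<omega> * (\<omega> * z))"

definition nbrs :: "'v set set \<Rightarrow> 'v \<Rightarrow> 'v set" where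
  "nbrs E v = {y. {v, y} \<in> E}"

lemma place_orb:
  assumes "v \<in> moved"
  shows "place q v z v = z" "place q v z (g v) = \<omega> * z" "place q v z (g (g v)) = \<omega> * (\<omega> * z)"
  using moved_neq[OF assms] by (simp_all add: place_def)

lemma place_other: "x \<notin> orb g v \<Longrightarrow> place q v z x = q x"
  by (simp add: place_def orb_def)

lemma symmetric_place:
  assumes "symmetric q" "v \<in> moved"
  shows "symmetric (place q v z)"
  unfolding symmetric_def
proof
  fix x
  show "place q v z (g x) = \<omega> * place q v z x"
  proof (cases "x \<in> orb g v")
    case True
    then show ?thesis
      by (cases rule: orb_cases) (simp_all only: place_orb[OF assms(2)] g3 cube')
  next
    case False
    then show ?thesis
      using assms(1) by (simp add: place_other g_orb_iff symmetric_def)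
  qed
qed

lemma nbrsD:
  assumes "free_graph E" "y \<in> nbrs E v"
  shows "{v, y} \<in> E" "y \<in> moved" "y \<noteq> v" "g y \<in> nbrs E (g v)"
proof -
  show e: "{v, y} \<in> E" using assms(2) by (simp add: nbrs_def)
  then have "{v, y} \<subseteq> moved" "card {v, y} = 2" "g ` {v, y} \<in> E"
    using assms(1) unfolding free_graph_def by blast+
  then show "y \<in> moved" "y \<noteq> v" "g y \<in> nbrs E (g v)" by (auto simp: nbrs_def)
qed

lemma stress_nbrs:
  assumes "stress E q w"
  shows "(\<Sum>y\<in>nbrs E v. w v y *\<^sub>R (q v - q y)) = 0" "y \<notin> nbrs E v \<Longrightarrow> w v y = 0"
proof -
  have z: "w v y = 0" if "y \<notin> nbrs E v" for y
    using that by (intro stressD(2)[OF assms]) (simp add: nbrs_def)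
  have "(\<Sum>y\<in>nbrs E v. w v y *\<^sub>R (q v - q y)) = (\<Sum>y\<in>UNIV. w v y *\<^sub>R (q v - q y))"
    by (intro sum.mono_neutral_left) (auto simp: z)
  then show "(\<Sum>y\<in>nbrs E v. w v y *\<^sub>R (q v - q y)) = 0" by (simp only: stressD(3)[OF assms])
  show "y \<notin> nbrs E v \<Longrightarrow> w v y = 0" by (rule z)
qed

lemma stress_free_place:
  assumes "free_graph E" "symmetric q" "v \<in> moved" "stress_free (avoiding E v) q"
    and "\<And>w y. stress E (place q v z) w \<Longrightarrow> w v y = 0"
  shows "stress_free E (place q v z)"
proof (rule stress_free_of_avoiding[OF symmetric_place[OF assms(2,3)] assms(1)])
  show "stress_free (avoiding E v) (place q v z)"
    using assms(4) by (rule stress_free_cong) (auto simp: avoiding_def intro: place_other)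
qed (rule assms(5))

text \<open>The new point is put off all lines through two placed points. Its edges, at most two,
  then have independent directions, and equilibrium at the point kills their stress.\<close>

lemma zero_extension:
  assumes E: "free_graph E" and q: "symmetric q" "general_position moved q"
    and v: "v \<in> moved" and free: "stress_free (avoiding E v) q"
    and nb: "card (nbrs E v) \<le> 2" "nbrs E v \<inter> orb g v = {}"
  shows "\<exists>q'. symmetric q' \<and> stress_free E q'"
proof -
  \<comment> \<open>The lines in direction 1 serve only to keep z away from each placed point, also
    when there is just one neighbour.\<close>
  define A where "A = (\<lambda>(x, y). (q x, q y - q x)) ` {(x, y). x \<in> moved \<and> y \<in> moved \<and> x \<noteq> y}
    \<union> (\<lambda>x. (q x, 1)) ` moved"
  have "\<forall>(a, b)\<in>A. b \<noteq> 0"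
    using general_position_neq[OF q(2)] by (fastforce simp: A_def)
  then obtain z where z: "\<forall>(a, b)\<in>A. Im ((z - a) * cnj b) \<noteq> 0"
    using exists_avoiding_lines[of A] by (auto simp: A_def)
  have zz: "Im ((z - a) * cnj b) \<noteq> 0" if "(a, b) \<in> A" for a b
    using bspec[OF z that] unfolding prod.case .
  have z1: "z \<noteq> q x" if "x \<in> moved" for x
    using zz[of "q x" 1] that by (auto simp: A_def)
  have z2: "Im ((z - q x) * cnj (z - q y)) \<noteq> 0" if "x \<in> moved" "y \<in> moved" "x \<noteq> y" for x y
  proof -
    have "(q x, q y - q x) \<in> A" using that by (auto simp: A_def)
    then have "Im ((z - q x) * cnj (q y - q x)) \<noteq> 0" by (rule zz)
    moreover have "Im ((z - q x) * cnj (z - q y)) = - Im ((z - q x) * cnj (q y - q x))"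
      by (simp add: algebra_simps)
    ultimately show ?thesis by simp
  qed
  have "stress_free E (place q v z)"
  proof (rule stress_free_place[OF E q(1) v free])
    fix w y assume w: "stress E (place q v z) w"
    have pl: "place q v z x = q x" if "x \<in> nbrs E v" for x
      using nb(2) that by (intro place_other) blast
    have "(\<Sum>y\<in>nbrs E v. w v y *\<^sub>R (z - q y)) = (\<Sum>y\<in>nbrs E v. w v y *\<^sub>R (place q v z v - place q v z y))"
      by (intro sum.cong refl) (simp add: pl place_orb[OF v])
    then have sum0: "(\<Sum>y\<in>nbrs E v. w v y *\<^sub>R (z - q y)) = 0"
      by (simp only: stress_nbrs[OF w])
    have "card (nbrs E v) = 0 \<or> card (nbrs E v) = 1 \<or> card (nbrs E v) = 2" using nb(1) by linarith
    then consider "nbrs E v = {}" | a where "nbrs E v = {a}" | a b where "nbrs E v = {a, b}" "a \<noteq> b"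
      by (auto simp: card_1_singleton_iff card_2_iff)
    then show "w v y = 0"
    proof cases
      case 1
      then show ?thesis using stress_nbrs(2)[OF w] by auto
    next
      case (2 a)
      then have "w v a = 0" using sum0 z1 nbrsD(2)[OF E, of a v] by simp
      then show ?thesis using stress_nbrs(2)[OF w, of y v] 2 by (cases "y = a") auto
    next
      case (3 a b)
      then have "w v a *\<^sub>R (z - q a) + w v b *\<^sub>R (z - q b) = 0" using sum0 by simp
      moreover have "a \<in> moved" "b \<in> moved" using 3 nbrsD(2)[OF E, of _ v] by auto
      ultimately have "w v a = 0 \<and> w v b = 0"
        using real_combination_zero z2 3(2) by blast
      then show ?thesis using stress_nbrs(2)[OF w, of y v] 3 by (cases "y = a"; cases "y = b") auto
    qed
  qed
  then show ?thesis using symmetric_place[OF q(1) v] by blast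
qed

text \<open>The three equations are the equilibrium conditions at the corners of an equilateral
  triangle with one pendant edge at each corner, rotated to the same corner.\<close>

lemma triangle_stress_zero:
  fixes a0 a1 a2 l0 l1 l2 :: real
  assumes e0: "a0 *\<^sub>R (z - \<omega> * z) + a2 *\<^sub>R (z - \<omega> * (\<omega> * z)) + l0 *\<^sub>R (z - s) = 0"
    and e1: "a1 *\<^sub>R (z - \<omega> * z) + a0 *\<^sub>R (z - \<omega> * (\<omega> * z)) + l1 *\<^sub>R (z - s) = 0"
    and e2: "a2 *\<^sub>R (z - \<omega> * z) + a1 *\<^sub>R (z - \<omega> * (\<omega> * z)) + l2 *\<^sub>R (z - s) = 0"
    and s: "Im (z * cnj s) \<noteq> 0"
  shows "a0 = 0" "a2 = 0" "l0 = 0"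
proof -
  have z: "z \<noteq> 0" "z \<noteq> s" using s by auto
  have oo: "\<omega> * (\<omega> * x) = - x - \<omega> * x" for x
  proof -
    have "\<omega> * (\<omega> * x) = (\<omega> * \<omega>) * x" by (simp only: mult.assoc)
    then show ?thesis unfolding omega_square by (simp add: left_diff_distrib)
  qed
  \<comment> \<open>Adding the equations as they stand uses (1 - \<omega>) + (1 - \<omega>^2) = 3.
    Since z and z - s are independent over the reals, the sum of the pendant stresses
    vanishes.\<close>
  have "(3 * (a0 + a1 + a2)) *\<^sub>R z + (l0 + l1 + l2) *\<^sub>R (z - s)
      = (a0 *\<^sub>R (z - \<omega> * z) + a2 *\<^sub>R (z - \<omega> * (\<omega> * z)) + l0 *\<^sub>R (z - s))
      + (a1 *\<^sub>R (z - \<omega> * z) + a0 *\<^sub>R (z - \<omega> * (\<omega> * z)) + l1 *\<^sub>R (z - s))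
      + (a2 *\<^sub>R (z - \<omega> * z) + a1 *\<^sub>R (z - \<omega> * (\<omega> * z)) + l2 *\<^sub>R (z - s))"
    unfolding oo by (simp add: scaleR_conv_of_real algebra_simps)
  then have "(3 * (a0 + a1 + a2)) *\<^sub>R z + (l0 + l1 + l2) *\<^sub>R (z - s) = 0"
    by (simp only: e0 e1 e2 add_0)
  moreover have "Im (z * cnj (z - s)) \<noteq> 0"
    using s by (simp add: algebra_simps)
  ultimately have L: "l0 + l1 + l2 = 0"
    using real_combination_zero by blast
  \<comment> \<open>The weights 1, \<omega>, \<omega>^2 turn the equations back to their own
    corners. Their sum is the total force, in which the forces along the triangle cancel in
    pairs.\<close>
  have "(of_real l0 + \<omega> * of_real l1 + \<omega> * \<omega> * of_real l2) * (z - s)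
      = (a0 *\<^sub>R (z - \<omega> * z) + a2 *\<^sub>R (z - \<omega> * (\<omega> * z)) + l0 *\<^sub>R (z - s))
      + \<omega> * (a1 *\<^sub>R (z - \<omega> * z) + a0 *\<^sub>R (z - \<omega> * (\<omega> * z)) + l1 *\<^sub>R (z - s))
      + \<omega> * (\<omega> * (a2 *\<^sub>R (z - \<omega> * z) + a1 *\<^sub>R (z - \<omega> * (\<omega> * z)) + l2 *\<^sub>R (z - s)))"
    by (simp add: scaleR_conv_of_real algebra_simps oo omega_square)
  then have "of_real l0 + \<omega> * of_real l1 + \<omega> * \<omega> * of_real l2 = 0"
    using z(2) by (simp only: e0 e1 e2 mult_zero_right add_0) simp
  then have "of_real (l0 - l2) + \<omega> * of_real (l1 - l2) = 0"
    unfolding omega_square by (simp add: algebra_simps)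
  then have "Re (of_real (l0 - l2) + \<omega> * of_real (l1 - l2)) = 0"
    "Im (of_real (l0 - l2) + \<omega> * of_real (l1 - l2)) = 0" by simp_all
  then have "l0 = l2" "l1 = l2" using Im_omega by auto
  with L show l0: "l0 = 0" by simp
  have "(1 - \<omega>) * z * (of_real a0 + of_real a2 * (1 + \<omega>))
      = a0 *\<^sub>R (z - \<omega> * z) + a2 *\<^sub>R (z - \<omega> * (\<omega> * z))"
    by (simp add: scaleR_conv_of_real algebra_simps)
  then have "of_real a0 + of_real a2 * (1 + \<omega>) = 0"
    using e0 l0 z(1) neq_1 by simp
  then have "Re (of_real a0 + of_real a2 * (1 + \<omega>)) = 0" "Im (of_real a0 + of_real a2 * (1 + \<omega>)) = 0"
    by simp_all
  then show "a2 = 0" "a0 = 0" using Im_omega by auto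
qed

text \<open>Rotating a stress to the corner \<open>v\<close> expresses the equilibrium at all three
  corners by the same directions. The new point only has to be off the line through 0 and the outer
  neighbour.\<close>

lemma triangle_extension:
  assumes E: "free_graph E" and q: "symmetric q"
    and v: "v \<in> moved" and free: "stress_free (avoiding E v) q"
    and nb: "nbrs E v - orb g v \<subseteq> {u}" "u \<in> nbrs E v \<Longrightarrow> q u \<noteq> 0"
  shows "\<exists>q'. symmetric q' \<and> stress_free E q'"
proof -
  define N where "N = nbrs E v - orb g v"
  \<comment> \<open>Without an outer neighbour the pendant stress \<open>l\<close> is 0, and 1
    stands in as a nonzero placeholder.\<close>
  define s where "s = (if u \<in> N then q u else 1)"
  have "s \<noteq> 0" using nb(2) by (auto simp: s_def N_def)
  \<comment> \<open>A quarter turn of \<open>s\<close>, for which the expression is |s|^2.\<close>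
  obtain z where z: "Im (z * cnj s) \<noteq> 0"
  proof
    show "Im (\<i> * s * cnj s) \<noteq> 0"
      using \<open>s \<noteq> 0\<close> by (auto simp: complex_eq_iff sum_squares_eq_zero_iff)
  qed
  define q' where "q' = place q v z"
  have sym: "symmetric q'" using symmetric_place[OF q v] by (simp add: q'_def)
  define l where "l w = (if u \<in> N then w v u else 0)" for w :: "'v \<Rightarrow> 'v \<Rightarrow> real"
  have eq: "w v (g v) *\<^sub>R (z - \<omega> * z) + w v (g (g v)) *\<^sub>R (z - \<omega> * (\<omega> * z)) + l w *\<^sub>R (z - s) = 0"
    if w: "stress E q' w" for w
  proof -
    have "(\<Sum>y\<in>UNIV. w v y *\<^sub>R (q' v - q' y)) = (\<Sum>y\<in>{g v, g (g v)} \<union> N. w v y *\<^sub>R (q' v - q' y))"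
    proof (rule sum.mono_neutral_right)
      show "\<forall>y\<in>UNIV - ({g v, g (g v)} \<union> N). w v y *\<^sub>R (q' v - q' y) = 0"
      proof
        fix y assume "y \<in> UNIV - ({g v, g (g v)} \<union> N)"
        then have "y = v \<or> y \<notin> nbrs E v" by (auto simp: orb_def N_def)
        then show "w v y *\<^sub>R (q' v - q' y) = 0" using stress_nbrs(2)[OF w] by auto
      qed
    qed auto
    also have "\<dots> = (\<Sum>y\<in>{g v, g (g v)}. w v y *\<^sub>R (q' v - q' y)) + (\<Sum>y\<in>N. w v y *\<^sub>R (q' v - q' y))"
      by (intro sum.union_disjoint) (auto simp: N_def orb_def)
    also have "(\<Sum>y\<in>N. w v y *\<^sub>R (q' v - q' y)) = l w *\<^sub>R (z - s)"
    proof (cases "u \<in> N")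
      case True
      then have "N = {u}" "u \<notin> orb g v" using nb(1) by (auto simp: N_def)
      then show ?thesis by (simp add: l_def s_def q'_def place_orb[OF v] place_other)
    next
      case False
      then have "N = {}" using nb(1) by (auto simp: N_def)
      then show ?thesis by (simp add: l_def)
    qed
    finally show ?thesis
      using stressD(3)[OF w, of v] moved_neq[OF v] by (simp add: q'_def place_orb[OF v])
  qed
  have "stress_free E q'"
    unfolding q'_def
  proof (rule stress_free_place[OF E q v free], fold q'_def)
    fix w y assume w: "stress E q' w"
    note w1 = stress_rotate[OF sym E w]
    note w2 = stress_rotate[OF sym E w1]
    note s = stressD(1)[OF w]
    have e0: "w v (g v) *\<^sub>R (z - \<omega> * z) + w v (g (g v)) *\<^sub>R (z - \<omega> * (\<omega> * z)) + l w *\<^sub>R (z - s) = 0"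
      by (rule eq[OF w])
    have e1: "w (g v) (g (g v)) *\<^sub>R (z - \<omega> * z) + w v (g v) *\<^sub>R (z - \<omega> * (\<omega> * z))
        + l (\<lambda>x y. w (g x) (g y)) *\<^sub>R (z - s) = 0"
      using eq[OF w1] unfolding g3 s[of "g v" v] .
    have e2: "w v (g (g v)) *\<^sub>R (z - \<omega> * z) + w (g v) (g (g v)) *\<^sub>R (z - \<omega> * (\<omega> * z))
        + l (\<lambda>x y. w (g (g x)) (g (g y))) *\<^sub>R (z - s) = 0"
      using eq[OF w2] unfolding g3 s[of "g (g v)" v] s[of "g (g v)" "g v"] .
    note triangle_stress_zero[OF e0 e1 e2 z]
    moreover have "w v v = 0" using nbrsD(3)[OF E, of v v] by (intro stress_nbrs(2)[OF w]) blast
    ultimately show "w v y = 0"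
      using stress_nbrs(2)[OF w, of y v] nb(1)
      by (cases "y \<in> nbrs E v") (auto simp: orb_def l_def N_def split: if_splits)
  qed
  then show ?thesis using sym by blast
qed

text \<open>The new vertex is placed in the middle of the removed edge, and a stress is pushed back to that
  edge.\<close>

lemma one_extension:
  assumes E: "free_graph E" and q: "symmetric q" and v: "v \<in> moved"
    and nb: "nbrs E v = {a, b, c}" "distinct [a, b, c]" "{a, b, c} \<inter> orb g v = {}" "{a, b} \<notin> E"
    and free: "stress_free (avoiding E v \<union> orb ((`) g) {a, b}) q"
    and gen: "Im ((q b - q a) * cnj (q c - q a)) \<noteq> 0"
  shows "stress_free E (place q v ((q a + q b) / 2))"
proof -
  define z where "z = (q a + q b) / 2"
  define q' where "q' = place q v z"
  have sym: "symmetric q'" using symmetric_place[OF q v] by (simp add: q'_def)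
  have pl: "q' x = q x" if "x \<notin> orb g v" for x
    using that by (simp add: q'_def place_other)
  have qz: "q' v = z" by (simp add: q'_def place_orb[OF v])
  have out: "a \<notin> orb g v" "b \<notin> orb g v" "c \<notin> orb g v" using nb(3) by auto
  \<comment> \<open>The edges to \<open>a\<close> and \<open>b\<close> are opposite and equally
    long, and the edge to \<open>c\<close> leaves their line. Equilibrium thus balances the first
    two against each other and leaves nothing on the third.\<close>
  have mid: "w v a = w v b \<and> w v c = 0" if w: "stress E q' w" for w
  proof -
    have "w v a *\<^sub>R (z - q a) + w v b *\<^sub>R (z - q b) + w v c *\<^sub>R (z - q c) = 0"
      using stress_nbrs(1)[OF w, of v] nb(2) by (simp add: nb(1) pl out qz add.assoc)
    moreover have "((w v a - w v b) / 2) *\<^sub>R (q b - q a) + w v c *\<^sub>R (z - q c)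
        = w v a *\<^sub>R (z - q a) + w v b *\<^sub>R (z - q b) + w v c *\<^sub>R (z - q c)"
      by (simp add: z_def scaleR_conv_of_real field_simps)
    ultimately have "((w v a - w v b) / 2) *\<^sub>R (q b - q a) + w v c *\<^sub>R (z - q c) = 0" by simp
    moreover have "Im ((q b - q a) * cnj (z - q c)) = - Im ((q b - q a) * cnj (q c - q a))"
      by (simp add: z_def field_simps)
    then have "Im ((q b - q a) * cnj (z - q c)) \<noteq> 0" using gen by simp
    ultimately have "(w v a - w v b) / 2 = 0 \<and> w v c = 0" by (rule real_combination_zero)
    then show ?thesis by simp
  qed
  have "stress_free E q'"
    unfolding q'_def
  proof (rule stress_free_place[OF E q v], fold q'_def)
    show "stress_free (avoiding E v) q" using free by (rule stress_free_subset) auto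
    fix s y assume s: "stress E q' s"
    note s1 = stress_rotate[OF sym E s]
    note s2 = stress_rotate[OF sym E s1]
    note ssym = stressD(1)[OF s]
    \<comment> \<open>Records that \<open>C\<close> sits in the middle of \<open>A\<close> and
      \<open>B\<close> and carries the same stress on the two halves and none elsewhere.\<close>
    define K where "K C A B \<longleftrightarrow> A \<noteq> B \<and> A \<notin> orb g v \<and> B \<notin> orb g v \<and> q' C = (q A + q B) / 2 \<and>
      s C A = s C B \<and> (\<forall>y. y \<noteq> A \<longrightarrow> y \<noteq> B \<longrightarrow> s C y = 0)" for C A B
    have sv: "w v y = 0" if "stress E q' w" "y \<noteq> a" "y \<noteq> b" for w y
      using mid[OF that(1)] stress_nbrs(2)[OF that(1), of y v] that nb(1) by auto
    have K0: "K v a b"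
      unfolding K_def using mid[OF s] sv[OF s] out nb(2) by (auto simp: qz z_def)
    have K1: "K (g v) (g a) (g b)"
      unfolding K_def
    proof (intro conjI allI impI)
      show "q' (g v) = (q (g a) + q (g b)) / 2"
        using q by (simp add: q'_def place_orb[OF v] symmetric_def z_def algebra_simps)
      show "s (g v) (g a) = s (g v) (g b)" using mid[OF s1] by simp
      fix y assume "y \<noteq> g a" "y \<noteq> g b"
      then have "g (g y) \<noteq> a" "g (g y) \<noteq> b" using g3 by metis+
      from sv[OF s1 this] show "s (g v) y = 0" by (simp add: g3)
    qed (use nb(2) out in \<open>auto simp: g_orb_iff g3\<close>)
    have K2: "K (g (g v)) (g (g a)) (g (g b))"
      unfolding K_def
    proof (intro conjI allI impI)
      show "q' (g (g v)) = (q (g (g a)) + q (g (g b))) / 2"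
        using q by (simp add: q'_def place_orb[OF v] symmetric_def z_def algebra_simps)
      show "s (g (g v)) (g (g a)) = s (g (g v)) (g (g b))" using mid[OF s2] by simp
      fix y assume "y \<noteq> g (g a)" "y \<noteq> g (g b)"
      then have "g y \<noteq> a" "g y \<noteq> b" by (auto simp: g3)
      from sv[OF s2 this] show "s (g (g v)) y = 0" by (simp add: g3)
    qed (use nb(2) out in \<open>auto simp: g_orb_iff g3\<close>)
    \<comment> \<open>The whole edge is twice as long as each half, so half the coefficient exerts
      the same force on \<open>A\<close> and \<open>B\<close>.\<close>
    define h where "h C A B x y = (if {x, y} = {A, B} then s C A / 2 else 0)" for C A B x y
    have hsum: "(\<Sum>y\<in>UNIV. h C A B x y *\<^sub>R (q x - q y)) = s x C *\<^sub>R (q x - q' C)" if "K C A B" for C A B x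
    proof -
      have k: "A \<noteq> B" "q' C = (q A + q B) / 2" "s C A = s C B" and k0: "\<And>y. y \<noteq> A \<Longrightarrow> y \<noteq> B \<Longrightarrow> s C y = 0"
        using that by (simp_all add: K_def)
      consider "x = A" | "x = B" | "x \<noteq> A" "x \<noteq> B" by blast
      then show ?thesis
      proof cases
        case 1
        have "h C A B A y *\<^sub>R (q A - q y) = (if y = B then (s C A / 2) *\<^sub>R (q A - q B) else 0)" for y
          using k(1) by (auto simp: h_def doubleton_eq_iff)
        then show ?thesis
          unfolding 1 ssym[of A C] k(2) by (simp add: scaleR_conv_of_real field_simps)
      next
        case 2
        have "h C A B B y *\<^sub>R (q B - q y) = (if y = A then (s C A / 2) *\<^sub>R (q B - q A) else 0)" for y
          using k(1) by (auto simp: h_def doubleton_eq_iff)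
        then show ?thesis
          unfolding 2 ssym[of B C] k(2) k(3)[symmetric] by (simp add: scaleR_conv_of_real field_simps)
      next
        case 3
        have "h C A B x y = 0" for y
          using 3 by (auto simp: h_def doubleton_eq_iff)
        then show ?thesis
          unfolding ssym[of x C] using k0[OF 3] by simp
      qed
    qed
    define r where "r x y = (if x \<in> orb g v \<or> y \<in> orb g v then 0 else s x y)" for x y
    \<comment> \<open>\<open>r\<close> forgets the orbit of \<open>v\<close>; the three terms
      \<open>h\<close> supply the forces it exerted on the other vertices.\<close>
    define w where "w x y = r x y + h v a b x y + h (g v) (g a) (g b) x y
      + h (g (g v)) (g (g a)) (g (g b)) x y" for x y
    have "stress (avoiding E v \<union> orb ((`) g) {a, b}) q w"
      unfolding stress_def
    proof (intro conjI allI impI)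
      fix x y
      have "h C A B x y = h C A B y x" for C A B by (simp add: h_def insert_commute)
      moreover have "r x y = r y x" using ssym[of x y] by (auto simp: r_def)
      ultimately show "w x y = w y x" by (simp add: w_def)
    next
      fix x y assume xy: "{x, y} \<notin> avoiding E v \<union> orb ((`) g) {a, b}"
      then have "r x y = 0"
        using stressD(2)[OF s, of x y] by (auto simp: r_def avoiding_def)
      moreover have "{x, y} \<noteq> {a, b}" "{x, y} \<noteq> {g a, g b}" "{x, y} \<noteq> {g (g a), g (g b)}"
        using xy by (auto simp: orb_def)
      ultimately show "w x y = 0" by (simp add: w_def h_def)
    next
      fix x
      show "(\<Sum>y\<in>UNIV. w x y *\<^sub>R (q x - q y)) = 0"
      proof (cases "x \<in> orb g v")
        case True
        have "h C A B x y = 0" if "K C A B" for C A B y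
          using True that by (auto simp: h_def K_def doubleton_eq_iff)
        then have "w x y = 0" for y using True K0 K1 K2 by (simp add: w_def r_def)
        then show ?thesis by simp
      next
        case False
        have "(\<Sum>y\<in>UNIV. w x y *\<^sub>R (q x - q y)) = (\<Sum>y\<in>UNIV. r x y *\<^sub>R (q x - q y))
            + (s x v *\<^sub>R (q x - q' v) + s x (g v) *\<^sub>R (q x - q' (g v))
              + s x (g (g v)) *\<^sub>R (q x - q' (g (g v))))"
          unfolding hsum[OF K0, symmetric] hsum[OF K1, symmetric] hsum[OF K2, symmetric]
          by (simp add: w_def scaleR_add_left sum.distrib add.assoc)
        also have "s x v *\<^sub>R (q x - q' v) + s x (g v) *\<^sub>R (q x - q' (g v))
              + s x (g (g v)) *\<^sub>R (q x - q' (g (g v))) = (\<Sum>y\<in>orb g v. s x y *\<^sub>R (q x - q' y))"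
          using moved_neq[OF v] by (simp add: orb_def add.assoc)
        also have "\<dots> = (\<Sum>y\<in>UNIV. if y \<in> orb g v then s x y *\<^sub>R (q x - q' y) else 0)"
          using sum.inter_restrict[of UNIV "\<lambda>y. s x y *\<^sub>R (q x - q' y)" "orb g v"] by simp
        also have "(\<Sum>y\<in>UNIV. r x y *\<^sub>R (q x - q y)) + \<dots> = (\<Sum>y\<in>UNIV. s x y *\<^sub>R (q' x - q' y))"
          unfolding sum.distrib[symmetric] using False
          by (intro sum.cong refl) (auto simp: r_def pl)
        finally show ?thesis by (simp only: stressD(3)[OF s])
      qed
    qed
    \<comment> \<open>At the pair ab only one term survives: ab is no edge of \<open>E\<close>, and
      its two rotations are different pairs. So \<open>w a b\<close> is half of
      \<open>s v a\<close>.\<close>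
    from free[unfolded stress_free_def, rule_format, OF this] have "w a b = 0" by simp
    moreover have "r a b = 0" using stressD(2)[OF s nb(4)] by (simp add: r_def)
    moreover have "{a, b} \<subseteq> moved" using nbrsD(2)[OF E, of _ v] nb(1) by auto
    then have e1: "g ` {a, b} \<noteq> {a, b}" using nb(2) by (intro image_g_edge_neq) simp_all
    have "g ` g ` {a, b} \<noteq> {a, b}"
    proof
      assume "g ` g ` {a, b} = {a, b}"
      then have "g ` g ` g ` {a, b} = g ` {a, b}" by (rule arg_cong)
      then show False using e1 unfolding image_g3 by metis
    qed
    with e1 have "h (g v) (g a) (g b) a b = 0" "h (g (g v)) (g (g a)) (g (g b)) a b = 0"
      by (auto simp: h_def)
    ultimately have "s v a = 0" by (simp add: w_def h_def)
    moreover have "s v b = s v a" using mid[OF s] by simp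
    ultimately show "s v y = 0" using sv[OF s, of y] by metis
  qed
  then show ?thesis unfolding q'_def z_def .
qed

text \<open>With n covered vertices the degrees add up to 2|E|, at most 4n - 6, so the average
  degree is below four.\<close>

lemma exists_low_degree:
  assumes "free_graph E" "laman_sparse E" "E \<noteq> {}"
  obtains v where "v \<in> \<Union>E" "card (nbrs E v) \<le> 3"
proof -
  have deg: "card (nbrs E v) = card {e \<in> E. v \<in> e}" for v
  proof -
    have "{e \<in> E. v \<in> e} = (\<lambda>y. {v, y}) ` nbrs E v"
    proof (intro equalityI subsetI)
      fix e assume e: "e \<in> {e \<in> E. v \<in> e}"
      then have "card e = 2" using assms(1) by (auto simp: free_graph_def)
      then obtain y where "e = {v, y}" using e by (auto simp: card_2_iff)
      then show "e \<in> (\<lambda>y. {v, y}) ` nbrs E v" using e by (auto simp: nbrs_def)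
    qed (auto simp: nbrs_def)
    moreover have "inj_on (\<lambda>y. {v, y}) (nbrs E v)"
      by (auto simp: inj_on_def doubleton_eq_iff)
    ultimately show ?thesis by (simp add: card_image)
  qed
  have "\<exists>v\<in>\<Union>E. card (nbrs E v) \<le> 3"
  proof (rule ccontr)
    assume "\<not> ?thesis"
    then have "\<And>v. v \<in> \<Union>E \<Longrightarrow> 4 \<le> card (nbrs E v)" by force
    then have "card (\<Union>E) * 4 \<le> (\<Sum>v\<in>\<Union>E. card (nbrs E v))"
      using sum_bounded_below[of "\<Union>E" 4 "\<lambda>v. card (nbrs E v)"] by simp
    also have "\<dots> = (\<Sum>v\<in>\<Union>E. \<Sum>e\<in>E. if v \<in> e then 1 else 0)"
      by (intro sum.cong refl) (simp add: deg sum.If_cases Collect_conj_eq)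
    also have "\<dots> = (\<Sum>e\<in>E. \<Sum>v\<in>\<Union>E. if v \<in> e then 1 else 0)" by (rule sum.swap)
    also have "\<dots> = (\<Sum>e\<in>E. 2)"
    proof (intro sum.cong refl)
      fix e assume e: "e \<in> E"
      then have "\<Union>E \<inter> e = e" by blast
      then show "(\<Sum>v\<in>\<Union>E. if v \<in> e then 1 else 0) = (2::nat)"
        using e assms(1) by (simp add: sum.If_cases free_graph_def)
    qed
    also have "\<dots> = 2 * card E" by simp
    finally have "2 * card (\<Union>E) \<le> card E" by simp
    moreover obtain e where "e \<in> E" using assms(3) by blast
    then have "2 \<le> card (\<Union>E)"
      using assms(1) by (intro two_le_cardI[of e]) (auto simp: free_graph_def)
    then have "card (induced E (\<Union>E)) + 3 \<le> 2 * card (\<Union>E)"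
      using assms(2) unfolding laman_sparse_def by blast
    moreover have "induced E (\<Union>E) = E" by (auto simp: induced_def)
    ultimately show False by simp
  qed
  then show thesis using that by blast
qed

text \<open>General position belongs to the induction hypothesis, because the moves require it of
  the old placement. A move may destroy it, and the final perturbation restores it.\<close>

theorem exists_symmetric_stress_free:
  assumes "free_graph E" "laman_sparse E"
  shows "\<exists>q. symmetric q \<and> general_position moved q \<and> stress_free E q"
  using assms
proof (induction "card (\<Union>E)" arbitrary: E rule: less_induct)
  case (less E)
  note E = less.prems
  have "\<exists>q. symmetric q \<and> stress_free E q"
  proof (cases "E = {}")
    case True
    then have "stress_free E (\<lambda>_. 0)" by (simp add: stress_free_def stress_def)
    then show ?thesis by (intro exI[of _ "\<lambda>_. 0"]) (simp add: symmetric_def)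
  next
    case False
    obtain v where v: "v \<in> \<Union>E" "card (nbrs E v) \<le> 3"
      by (rule exists_low_degree[OF E False])
    have vm: "v \<in> moved" using v(1) E(1) by (auto simp: free_graph_def)
    define F where "F = avoiding E v"
    have F: "free_graph F" "F \<subseteq> E" "laman_sparse F"
      using free_graph_avoiding[OF E(1)] laman_sparse_subset[OF E(2)] by (auto simp: F_def avoiding_def)
    have F_un: "\<Union>F \<subseteq> \<Union>E - orb g v" by (auto simp: F_def avoiding_def)
    have IH: "\<exists>q. symmetric q \<and> general_position moved q \<and> stress_free D q"
      if "free_graph D" "laman_sparse D" "\<Union>D \<subseteq> \<Union>E - orb g v" for D
    proof (rule less.hyps[OF _ that(1,2)])
      show "card (\<Union>D) < card (\<Union>E)"
      proof (rule psubset_card_mono)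
        show "\<Union>D \<subset> \<Union>E" using that(3) v(1) orb_self[of v] by blast
      qed simp
    qed
    obtain q where q: "symmetric q" "general_position moved q" "stress_free F q"
      using IH[OF F(1,3) F_un] by blast
    show ?thesis
    proof (cases "nbrs E v \<inter> orb g v = {}")
      case inter: False
      \<comment> \<open>One neighbour of \<open>v\<close> in its own orbit entails the other by
        rotation, so the orbit spans a triangle and \<open>v\<close> has at most one further
        neighbour.\<close>
      have "{v, g v} \<in> E" if "{v, g (g v)} \<in> E"
        using free_graph_image_iff[OF E(1), of "{v, g (g v)}"] that by (simp add: g3 insert_commute)
      moreover have "{v, g (g v)} \<in> E" if "{v, g v} \<in> E"
        using free_graph_image_iff[OF E(1), of "{v, g v}"]
          free_graph_image_iff[OF E(1), of "{g v, g (g v)}"] that by (simp add: g3 insert_commute)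
      moreover have "v \<notin> nbrs E v" using nbrsD(3)[OF E(1)] by blast
      ultimately have "{g v, g (g v)} \<subseteq> nbrs E v"
        using inter by (auto simp: orb_def nbrs_def)
      moreover have "card {g v, g (g v)} = 2" using moved_neq[OF vm] moved_neq[of "g v"] vm by simp
      ultimately have "card (nbrs E v - {g v, g (g v)}) \<le> 1"
        using v(2) by (simp add: card_Diff_subset)
      then have "\<exists>u. nbrs E v - {g v, g (g v)} \<subseteq> {u}"
        by (simp add: card_le_Suc0_iff_eq) blast
      then have "\<exists>u. nbrs E v - orb g v \<subseteq> {u}" by (auto simp: orb_def)
      then obtain u where u: "nbrs E v - orb g v \<subseteq> {u}" by blast
      \<comment> \<open>At 0 the vertex \<open>u\<close> would coincide with its own
        rotation.\<close>
      have "q u \<noteq> 0" if "u \<in> nbrs E v"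
      proof -
        have um: "u \<in> moved" by (rule nbrsD(2)[OF E(1) that])
        have "q u \<noteq> q (g u)"
          using um moved_neq[OF um] by (intro general_position_neq[OF q(2)]) auto
        then show ?thesis using q(1) by (auto simp: symmetric_def)
      qed
      then show ?thesis
        using triangle_extension[OF E(1) q(1) vm q(3)[unfolded F_def] u] by blast
    next
      case disj: True
      show ?thesis
      proof (cases "card (nbrs E v) \<le> 2")
        case True
        then show ?thesis
          using zero_extension[OF E(1) q(1,2) vm q(3)[unfolded F_def] True disj] by blast
      next
        case False
        then have "card (nbrs E v) = 3" using v(2) by simp
        then obtain a b c where abc: "nbrs E v = {a, b, c}" "distinct [a, b, c]"
          by (auto simp: card_3_iff)
        have edges: "{v, a} \<in> E" "{v, b} \<in> E" "{v, c} \<in> E" using abc(1) by (auto simp: nbrs_def)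
        have "\<forall>e\<in>E. card e = 2" "\<forall>e\<in>F. v \<notin> e"
          using E(1) orb_self[of v] by (auto simp: free_graph_def F_def avoiding_def)
        note red = one_reduction_pair[OF E(2) this(1) F(2) this(2) abc(2) edges]
        \<comment> \<open>Renames the neighbours so that it is the pair ab that no tight set of
          \<open>F\<close> contains.\<close>
        obtain a b c where abc: "nbrs E v = {a, b, c}" "distinct [a, b, c]"
          and ab: "\<nexists>X. tight F X \<and> {a, b} \<subseteq> X"
        proof (cases "\<exists>X. tight F X \<and> {a, b} \<subseteq> X")
          case False
          then show ?thesis using that abc by blast
        next
          case 1: True
          show ?thesis
          proof (cases "\<exists>X. tight F X \<and> {b, c} \<subseteq> X")
            case False
            then show ?thesis using that[of b c a] abc by auto
          next
            case True
            then have "\<nexists>X. tight F X \<and> {a, c} \<subseteq> X" using red 1 by blast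
            then show ?thesis using that[of a c b] abc by auto
          qed
        qed
        have m: "a \<in> moved" "b \<in> moved" "c \<in> moved"
          using nbrsD(2)[OF E(1), of _ v] abc(1) by auto
        have abE: "{a, b} \<notin> E"
        proof
          assume "{a, b} \<in> E"
          then have "{a, b} \<in> F" using disj abc(1) by (auto simp: F_def avoiding_def)
          moreover have "\<forall>e\<in>F. card e = 2" using F(1) by (simp add: free_graph_def)
          moreover have "card {a, b} = 2" using abc(2) by simp
          ultimately have "tight F {a, b}" by (simp add: tight_def deficit_edge)
          then show False using ab by blast
        qed
        \<comment> \<open>Edges are added to \<open>F\<close>, but only between vertices that
          \<open>E\<close> already covers, and the orbit of \<open>v\<close> is gone. Hence the
          induction runs over covered vertices.\<close>
        define D where "D = F \<union> orb ((`) g) {a, b}"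
        have D: "free_graph D"
          using F(1) m abc(2) by (auto simp: D_def free_graph_def orb_def g3 insert_commute)
        have "laman_sparse D"
          using orbit_blocked[OF F(1,3), of "{a, b}"] ab m abc(2) unfolding D_def by auto
        moreover have "\<Union>D \<subseteq> \<Union>E - orb g v"
        proof -
          have "g x \<in> \<Union>E - orb g v" if "x \<in> \<Union>E - orb g v" for x
            using that E(1) by (auto simp: g_orb_iff free_graph_def)
          moreover have "a \<in> \<Union>E - orb g v" "b \<in> \<Union>E - orb g v"
            using edges disj abc(1) by (auto simp: nbrs_def)
          ultimately show ?thesis using F_un unfolding D_def orb_def by auto
        qed
        ultimately obtain q where q: "symmetric q" "general_position moved q" "stress_free D q"
          using IH[OF D] by blast
        have "Im ((q b - q a) * cnj (q c - q a)) \<noteq> 0"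
          using q(2) m abc(2) by (simp only: general_position_def distinct.simps) auto
        then show ?thesis
          using one_extension[OF E(1) q(1) vm abc _ abE] q disj symmetric_place[OF q(1) vm] abc(1)
          by (auto simp: D_def F_def)
      qed
    qed
  qed
  then show ?case using general_position_perturb by blast
qed

end

section \<open>The rank of the rigidity matrix\<close>

text \<open>Stated for a family because independence of the image set alone would not notice two
  equal rows.\<close>

lemma independent_image_of_family:
  fixes f :: "'i \<Rightarrow> 'b::euclidean_space"
  assumes "finite I" "\<And>c. (\<Sum>i\<in>I. c i *\<^sub>R f i) = 0 \<Longrightarrow> \<forall>i\<in>I. c i = 0"
  shows "inj_on f I" "independent (f ` I)"
proof -
  show inj: "inj_on f I"
  proof (rule inj_onI, rule ccontr)
    fix i j assume ij: "i \<in> I" "j \<in> I" "f i = f j" "i \<noteq> j"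
    define c :: "'i \<Rightarrow> real" where "c k = (if k = i then 1 else 0) - (if k = j then 1 else 0)" for k
    have "(\<Sum>k\<in>I. c k *\<^sub>R f k) = (\<Sum>k\<in>I. (if k = i then f i else 0) - (if k = j then f j else 0))"
      by (intro sum.cong refl) (auto simp: c_def)
    also have "\<dots> = 0" using ij assms(1) by (simp add: sum_subtractf)
    finally have "c i = 0" using assms(2) ij(1) by blast
    then show False using ij(4) by (simp add: c_def)
  qed
  show "independent (f ` I)"
  proof
    assume "dependent (f ` I)"
    then obtain u where u: "\<exists>v\<in>f ` I. u v \<noteq> 0" "(\<Sum>v\<in>f ` I. u v *\<^sub>R v) = 0"
      using assms(1) by (auto simp: dependent_finite)
    have "(\<Sum>i\<in>I. u (f i) *\<^sub>R f i) = 0"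
      using u(2) by (simp add: sum.reindex[OF inj])
    then show False using assms(2)[of "\<lambda>i. u (f i)"] u(1) by blast
  qed
qed

definition vec2 :: "complex \<Rightarrow> real^2" where
  "vec2 z = vector [Re z, Im z]"

lemma vec2_nth [simp]: "vec2 z $ 1 = Re z" "vec2 z $ 2 = Im z"
  by (simp_all add: vec2_def)

lemma vec2_eq_iff: "vec2 z = vec2 w \<longleftrightarrow> z = w"
  by (auto simp: vec_eq_iff forall_2 complex_eq_iff)

lemma row_rigidity_matrix:
  assumes "{x, y} \<in> E" "x \<noteq> y"
  shows "rigidity_matrix E p $ {x, y} $ (v, k)
    = (if v = x then (p x - p y) $ k else 0) + (if v = y then (p y - p x) $ k else 0)"
proof -
  have "{x, y} - {x} = {y}" "{x, y} - {y} = {x}" using assms(2) by auto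
  then show ?thesis using assms by (auto simp: rigidity_matrix_def)
qed

text \<open>A vanishing combination of the rows of \<open>F\<close>, read as weights on the edges,
  is a stress: the column of a vertex and a coordinate is that coordinate of the equilibrium
  condition at the vertex.\<close>

lemma card_le_rank_rigidity_matrix:
  assumes "stress_free F q" "F \<subseteq> E" "\<forall>e\<in>F. card e = 2"
  shows "card F \<le> rank (rigidity_matrix E (\<lambda>v. vec2 (q v)))"
proof -
  define R where "R = rigidity_matrix E (\<lambda>v. vec2 (q v))"
  have "\<forall>e\<in>F. c e = 0" if c: "(\<Sum>e\<in>F. c e *\<^sub>R R $ e) = 0" for c
  proof -
    define w where "w x y = (if {x, y} \<in> F then c {x, y} else 0)" for x y
    have "(\<Sum>y\<in>UNIV. w x y *\<^sub>R (vec2 (q x) - vec2 (q y)) $ k) = 0" for x k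
    proof -
      define N where "N = {y. {x, y} \<in> F}"
      have xy: "x \<noteq> y" if "y \<in> N" for y
      proof
        assume "x = y"
        then have "card {x} = 2" using that assms(3) by (auto simp: N_def)
        then show False by simp
      qed
      have "0 = (\<Sum>e\<in>F. c e *\<^sub>R R $ e) $ (x, k)" using c by simp
      also have "\<dots> = (\<Sum>e\<in>F. c e * R $ e $ (x, k))" by simp
      also have "\<dots> = (\<Sum>e\<in>(\<lambda>y. {x, y}) ` N. c e * R $ e $ (x, k))"
      proof (rule sum.mono_neutral_right)
        show "\<forall>e\<in>F - (\<lambda>y. {x, y}) ` N. c e * R $ e $ (x, k) = 0"
        proof
          fix e assume e: "e \<in> F - (\<lambda>y. {x, y}) ` N"
          have "x \<notin> e"
          proof
            assume "x \<in> e"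
            then obtain y where "e = {x, y}" using e assms(3) by (fastforce simp: card_2_iff)
            then show False using e by (auto simp: N_def)
          qed
          then show "c e * R $ e $ (x, k) = 0" by (simp add: R_def rigidity_matrix_def)
        qed
      qed (auto simp: N_def)
      also have "\<dots> = (\<Sum>y\<in>N. c {x, y} * R $ {x, y} $ (x, k))"
        by (subst sum.reindex) (auto simp: inj_on_def doubleton_eq_iff)
      also have "\<dots> = (\<Sum>y\<in>N. w x y *\<^sub>R (vec2 (q x) - vec2 (q y)) $ k)"
      proof (rule sum.cong[OF refl])
        fix y assume y: "y \<in> N"
        then have "{x, y} \<in> E" using assms(2) by (auto simp: N_def)
        then show "c {x, y} * R $ {x, y} $ (x, k) = w x y *\<^sub>R (vec2 (q x) - vec2 (q y)) $ k"
          using xy[OF y] y by (simp add: R_def row_rigidity_matrix w_def N_def)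
      qed
      also have "\<dots> = (\<Sum>y\<in>UNIV. w x y *\<^sub>R (vec2 (q x) - vec2 (q y)) $ k)"
        by (rule sum.mono_neutral_left) (auto simp: w_def N_def)
      finally show ?thesis by simp
    qed
    from this[of _ 1] this[of _ 2] have "(\<Sum>y\<in>UNIV. w x y *\<^sub>R (q x - q y)) = 0" for x
      by (simp add: complex_eq_iff)
    moreover have "w x y = w y x" for x y by (simp add: w_def insert_commute)
    ultimately have "stress F q w" unfolding stress_def by (simp add: w_def)
    then have "w x y = 0" for x y using assms(1) by (simp add: stress_free_def)
    show ?thesis
    proof
      fix e assume e: "e \<in> F"
      then obtain x y where "e = {x, y}" using assms(3) by (fastforce simp: card_2_iff)
      then show "c e = 0" using e \<open>w x y = 0\<close> by (simp add: w_def)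
    qed
  qed
  note ind = independent_image_of_family[of F "\<lambda>e. R $ e", OF finite this]
  have "card F = card ((\<lambda>e. R $ e) ` F)" by (rule card_image[OF ind(1), symmetric])
  also have "\<dots> \<le> dim (rows R)"
    using ind(2) by (intro independent_card_le_dim) (auto simp: rows_def row_def vec_nth_inverse)
  finally show ?thesis by (simp add: R_def row_rank_def)
qed

lemma dim_supported_on:
  "dim {u :: real^('v::finite \<times> 2). \<forall>c. c \<notin> X \<times> UNIV \<longrightarrow> u $ c = 0} = 2 * card X"
  using dim_substandard_cart[where 'a=real and d="X \<times> (UNIV :: 2 set)"]
  by (simp add: dim_vec_eq card_cartesian_product)

text \<open>The rows supported on a set of vertices are orthogonal to the two translations and the
  rotation of these vertices.\<close>

lemma sparse_of_independent_rows:
  fixes B E :: "'v::finite set set"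
  assumes E: "\<forall>e\<in>E. card e = 2" and p: "framework E p" and B: "B \<subseteq> E"
    and ind: "inj_on (\<lambda>e. rigidity_matrix E p $ e) B" "independent ((\<lambda>e. rigidity_matrix E p $ e) ` B)"
  shows "laman_sparse B"
  unfolding laman_sparse_def
proof (intro allI impI)
  fix X :: "'v set" assume X: "2 \<le> card X"
  show "card (induced B X) + 3 \<le> 2 * card X"
  proof (cases "induced B X = {}")
    case True
    then show ?thesis using X by simp
  next
    case False
    then obtain e where e: "e \<in> B" "e \<subseteq> X" by (auto simp: induced_def)
    then have "card e = 2" using B E by blast
    then obtain a b where "e = {a, b}" by (auto simp: card_2_iff)
    with e have ab: "{a, b} \<in> B" "a \<in> X" "b \<in> X" by auto
    have pab: "p a \<noteq> p b" using p subsetD[OF B ab(1)] unfolding framework_def by blast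
    define U where "U = {u :: real^('v \<times> 2). \<forall>c. c \<notin> X \<times> UNIV \<longrightarrow> u $ c = 0}"
    \<comment> \<open>The velocity field on \<open>X\<close> that combines the translation by
      (\<alpha>, \<beta>) with \<gamma> times the infinitesimal rotation (x, y) to (-y, x).\<close>
    define m :: "real \<Rightarrow> real \<Rightarrow> real \<Rightarrow> real^('v \<times> 2)" where "m \<alpha> \<beta> \<gamma> = (\<chi> c. if fst c \<in> X then
        (if snd c = 1 then \<alpha> - \<gamma> * p (fst c) $ 2 else \<beta> + \<gamma> * p (fst c) $ 1) else 0)" for \<alpha> \<beta> \<gamma>
    define T where "T = {m 1 0 0, m 0 1 0, m 0 0 1}"
    have comb: "\<alpha> *\<^sub>R m 1 0 0 + \<beta> *\<^sub>R m 0 1 0 + \<gamma> *\<^sub>R m 0 0 1 = m \<alpha> \<beta> \<gamma>" for \<alpha> \<beta> \<gamma>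
      by (auto simp: vec_eq_iff m_def)
    \<comment> \<open>A nontrivial infinitesimal rigid motion of the plane cannot vanish at two
      distinct points, here those of the adjacent \<open>a\<close> and \<open>b\<close>.\<close>
    have zero: "\<alpha> = 0 \<and> \<beta> = 0 \<and> \<gamma> = 0" if "m \<alpha> \<beta> \<gamma> = 0" for \<alpha> \<beta> \<gamma>
    proof -
      have "m \<alpha> \<beta> \<gamma> $ (v, k) = 0" for v k using that by simp
      from this[of a 1] this[of b 1] this[of a 2] this[of b 2]
      have e: "\<alpha> = \<gamma> * p a $ 2" "\<alpha> = \<gamma> * p b $ 2" "\<beta> = - \<gamma> * p a $ 1" "\<beta> = - \<gamma> * p b $ 1"
        using ab(2,3) by (simp_all add: m_def)
      have "\<gamma> = 0"
      proof (rule ccontr)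
        assume "\<gamma> \<noteq> 0"
        then have "p a = p b" using e by (simp add: vec_eq_iff forall_2)
        then show False using pab by simp
      qed
      then show ?thesis using e by simp
    qed
    define t where "t = (\<lambda>i::nat. if i = 0 then m 1 0 0 else if i = 1 then m 0 1 0 else m 0 0 1)"
    have T: "T = t ` {0, 1, 2}" by (auto simp: T_def t_def)
    have "\<forall>i\<in>{0, 1, 2}. c i = 0" if "(\<Sum>i\<in>{0, 1, 2}. c i *\<^sub>R t i) = 0" for c
    proof -
      have "m (c 0) (c 1) (c 2) = 0" using that by (simp add: t_def comb add.assoc[symmetric])
      from zero[OF this] show ?thesis by simp
    qed
    from independent_image_of_family[of "{0, 1, 2}" t, OF _ this] have "inj_on t {0, 1, 2}" "independent T"
      by (simp_all add: T)
    then have dimT: "dim (span T) = 3"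
      by (simp add: dim_span dim_eq_card_independent T card_image)
    have "subspace U" by (auto simp: U_def subspace_def)
    have TU: "span T \<subseteq> U"
      using \<open>subspace U\<close> by (intro span_minimal) (auto simp: T_def U_def m_def)
    have row: "rigidity_matrix E p $ e \<in> {u \<in> U. \<forall>x\<in>span T. orthogonal x u}" if e: "e \<in> induced B X" for e
    proof -
      have "card e = 2" "e \<in> E" using e B E by (auto simp: induced_def)
      then obtain x y where xy: "e = {x, y}" "x \<noteq> y" by (auto simp: card_2_iff)
      have inX: "x \<in> X" "y \<in> X" using e xy by (auto simp: induced_def)
      note R = row_rigidity_matrix[OF _ xy(2), of E p, folded xy(1), OF \<open>e \<in> E\<close>]
      have "rigidity_matrix E p $ e \<in> U"
        unfolding U_def using R inX by auto
      moreover have "orthogonal (m \<alpha> \<beta> \<gamma>) (rigidity_matrix E p $ e)" for \<alpha> \<beta> \<gamma>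
      proof -
        have "m \<alpha> \<beta> \<gamma> \<bullet> rigidity_matrix E p $ e
            = (\<Sum>v\<in>UNIV. \<Sum>k\<in>UNIV. m \<alpha> \<beta> \<gamma> $ (v, k) * rigidity_matrix E p $ e $ (v, k))"
          unfolding inner_vec_def UNIV_Times_UNIV[symmetric] by (simp add: sum.cartesian_product)
        also have "\<dots> = (\<Sum>v\<in>UNIV. (if v = x then \<Sum>k\<in>UNIV. m \<alpha> \<beta> \<gamma> $ (x, k) * (p x - p y) $ k else 0)
            + (if v = y then \<Sum>k\<in>UNIV. m \<alpha> \<beta> \<gamma> $ (y, k) * (p y - p x) $ k else 0))"
          using xy(2) by (intro sum.cong refl) (auto simp: R)
        also have "\<dots> = (\<Sum>k\<in>UNIV. m \<alpha> \<beta> \<gamma> $ (x, k) * (p x - p y) $ k)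
            + (\<Sum>k\<in>UNIV. m \<alpha> \<beta> \<gamma> $ (y, k) * (p y - p x) $ k)"
          by (simp add: sum.distrib)
        also have "\<dots> = 0"
          using inX by (simp add: sum_2 m_def algebra_simps)
        finally show ?thesis by (simp add: orthogonal_def)
      qed
      then have "orthogonal x (rigidity_matrix E p $ e)" if "x \<in> span T" for x
        using that by (intro orthogonal_commute[THEN iffD1, OF orthogonal_to_span[OF that]])
          (auto simp: T_def orthogonal_commute)
      ultimately show ?thesis by blast
    qed
    have "card (induced B X) = card ((\<lambda>e. rigidity_matrix E p $ e) ` induced B X)"
      using ind(1) by (intro card_image[symmetric]) (auto simp: induced_def inj_on_def)
    also have "\<dots> \<le> dim {u \<in> U. \<forall>x\<in>span T. orthogonal x u}"
      using row by (intro independent_card_le_dim independent_mono[OF ind(2)]) (auto simp: induced_def)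
    finally have "card (induced B X) + dim (span T) \<le> dim U"
      using dim_subspace_orthogonal_to_vectors[OF subspace_span \<open>subspace U\<close> TU] by simp
    moreover have "dim U = 2 * card X" unfolding U_def by (rule dim_supported_on)
    ultimately show ?thesis using dimT by linarith
  qed
qed

lemma rank_rigidity_matrix_sparse:
  fixes E :: "'v::finite set set"
  assumes E: "\<forall>e\<in>E. card e = 2" and p: "framework E p"
  obtains B where "B \<subseteq> E" "laman_sparse B" "card B = rank (rigidity_matrix E p)"
proof -
  define R where "R = rigidity_matrix E p"
  obtain T where T: "T \<subseteq> rows R" "independent T" "rows R \<subseteq> span T" "card T = dim (rows R)"
    using basis_exists by blast
  have "\<forall>t\<in>T. \<exists>e. R $ e = t"
    using T(1) by (auto simp: rows_def row_def vec_nth_inverse)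
  then obtain f where f: "\<And>t. t \<in> T \<Longrightarrow> R $ f t = t" by metis
  have inj: "inj_on f T" by (metis f inj_onI)
  have im: "(\<lambda>e. R $ e) ` f ` T = T" using f by (simp add: image_image)
  have "inj_on (\<lambda>e. R $ e) (f ` T)" using f by (auto simp: inj_on_def)
  \<comment> \<open>The padding rows of non-edges are zero and cannot occur in a basis.\<close>
  moreover have "f ` T \<subseteq> E"
  proof
    fix e assume "e \<in> f ` T"
    then have "R $ e \<in> T" using im by blast
    then have "R $ e \<noteq> 0" using T(2) dependent_zero by metis
    then show "e \<in> E" by (auto simp: R_def rigidity_matrix_def vec_eq_iff split: if_splits)
  qed
  moreover have "independent ((\<lambda>e. R $ e) ` f ` T)" using T(2) im by simp
  ultimately have "laman_sparse (f ` T)"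
    using sparse_of_independent_rows[OF E p, of "f ` T"] by (simp add: R_def)
  moreover have "card (f ` T) = rank (rigidity_matrix E p)"
    using T(4) by (simp add: card_image[OF inj] R_def row_rank_def)
  ultimately show thesis using \<open>f ` T \<subseteq> E\<close> that by blast
qed

section \<open>Potentials of balanced gain graphs\<close>

text \<open>A choice of one vertex above each vertex of \<open>F\<close> along which every arc lifts
  to an edge. Values are arbitrary integers compared modulo 3, so they can be shifted without
  reduction.\<close>

definition potential :: "('a, 'b) pre_digraph \<Rightarrow> ('b \<Rightarrow> int) \<Rightarrow> 'b set \<Rightarrow> ('a \<Rightarrow> int) \<Rightarrow> bool" where
  "potential H \<psi> F \<sigma> \<longleftrightarrow> (\<forall>a\<in>F. \<psi> a mod 3 = (\<sigma> (head H a) - \<sigma> (tail H a)) mod 3)"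

lemma bidirect_simps [simp]:
  "verts (bidirect H F) = verts H" "arcs (bidirect H F) = F \<times> UNIV"
  "tail (bidirect H F) (a, True) = tail H a" "tail (bidirect H F) (a, False) = head H a"
  "head (bidirect H F) (a, True) = head H a" "head (bidirect H F) (a, False) = tail H a"
  by (simp_all add: bidirect_def)

lemma wf_bidirect:
  assumes "\<And>a. a \<in> F \<Longrightarrow> tail H a \<in> verts H \<and> head H a \<in> verts H"
  shows "wf_digraph (bidirect H F)"
proof
  fix e assume "e \<in> arcs (bidirect H F)"
  then obtain a b where "e = (a, b)" "a \<in> F" by auto
  then show "tail (bidirect H F) e \<in> verts (bidirect H F)" "head (bidirect H F) e \<in> verts (bidirect H F)"
    using assms[of a] by (cases b; simp)+
qed

lemma cas_bidirect: "pre_digraph.cas (bidirect H F) u c v = pre_digraph.cas (bidirect H F') u c v"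
proof (induction c arbitrary: u)
  case (Cons e c)
  then show ?case by (simp add: pre_digraph.cas.simps bidirect_def)
qed (simp add: pre_digraph.cas.simps)

lemma awalk_bidirect_mono:
  assumes "pre_digraph.awalk (bidirect H F) u c v" "F \<subseteq> F'"
  shows "pre_digraph.awalk (bidirect H F') u c v"
  using assms cas_bidirect[of H F u c v F'] by (auto simp: pre_digraph.awalk_def)

lemma awalk_verts_bidirect:
  "pre_digraph.awalk_verts (bidirect H F) u c = pre_digraph.awalk_verts (bidirect H F') u c"
proof (induction c arbitrary: u)
  case (Cons e c)
  then show ?case by (simp add: pre_digraph.awalk_verts.simps bidirect_def)
qed (simp add: pre_digraph.awalk_verts.simps)

lemma gain_cycle_mono:
  assumes "gain_cycle H F c" "F \<subseteq> F'"
  shows "gain_cycle H F' c"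
proof -
  obtain u where u: "pre_digraph.awalk (bidirect H F) u c u"
    "distinct (tl (pre_digraph.awalk_verts (bidirect H F) u c))" "c \<noteq> []" "distinct (map fst c)"
    using assms(1) by (auto simp: gain_cycle_def pre_digraph.cycle_def)
  then show ?thesis
    using awalk_bidirect_mono[OF u(1) assms(2)] awalk_verts_bidirect[of H F u c F']
    unfolding gain_cycle_def pre_digraph.cycle_def by auto
qed

text \<open>Both copies of an arc have the same two ends, so a later use in either direction would
  revisit the vertex from which the arc was first left.\<close>

lemma apath_bidirect_distinct:
  assumes "wf_digraph (bidirect H F)" "pre_digraph.apath (bidirect H F) u p v"
  shows "distinct (map fst p)"
  using assms(2)
proof (induction p arbitrary: u)
  case (Cons e es)
  interpret wf_digraph "bidirect H F" by (rule assms(1))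
  have e: "tail (bidirect H F) e = u" "apath (head (bidirect H F) e) es v"
    "tail (bidirect H F) e \<notin> set (awalk_verts (head (bidirect H F) e) es)"
    using Cons.prems by (auto simp: apath_Cons_iff)
  have "fst e \<notin> fst ` set es"
  proof
    assume "fst e \<in> fst ` set es"
    then obtain e' where e': "e' \<in> set es" "fst e' = fst e" by auto
    have "awalk (head (bidirect H F) e) es v" using e(2) by (simp only: apath_def)
    then have "tail (bidirect H F) e' \<in> set (awalk_verts (head (bidirect H F) e) es)"
      "head (bidirect H F) e' \<in> set (awalk_verts (head (bidirect H F) e) es)"
      using awalk_verts_arc1[OF e'(1)] awalk_verts_arc2[OF _ e'(1)] by blast+
    moreover have "tail (bidirect H F) e \<in> {tail (bidirect H F) e', head (bidirect H F) e'}"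
      using e'(2) by (cases e; cases e'; cases "snd e"; cases "snd e'") auto
    ultimately show False using e(3) by auto
  qed
  then show ?case using Cons.IH[OF e(2)] by auto
qed simp

text \<open>The three computations with potentials: traversing an arc forwards, traversing it
  backwards, and recovering the gain of an arc that closes a cycle.\<close>

lemma mod_3_shift:
  fixes p h t v w :: int
  shows "p mod 3 = (h - t) mod 3 \<Longrightarrow> (p + (v - h) mod 3) mod 3 = (v - t) mod 3"
    and "p mod 3 = (h - t) mod 3 \<Longrightarrow> ((- p) mod 3 + (v - t) mod 3) mod 3 = (v - h) mod 3"
    and "(p + w) mod 3 = 0 \<Longrightarrow> w = (t - h) mod 3 \<Longrightarrow> p mod 3 = (h - t) mod 3"
proof -
  assume p: "p mod 3 = (h - t) mod 3"
  have "(p + (v - h) mod 3) mod 3 = (p mod 3 + (v - h)) mod 3" by (simp only: mod_simps)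
  also have "\<dots> = ((h - t) + (v - h)) mod 3" unfolding p by (simp only: mod_simps)
  finally show "(p + (v - h) mod 3) mod 3 = (v - t) mod 3" by simp
next
  assume p: "p mod 3 = (h - t) mod 3"
  have "((- p) mod 3 + (v - t) mod 3) mod 3 = ((v - t) - p mod 3) mod 3"
    by (simp only: mod_simps) (simp add: algebra_simps)
  also have "\<dots> = ((v - t) - (h - t)) mod 3" unfolding p by (simp only: mod_simps)
  finally show "((- p) mod 3 + (v - t) mod 3) mod 3 = (v - h) mod 3" by simp
next
  assume p: "(p + w) mod 3 = 0" and w: "w = (t - h) mod 3"
  have "p mod 3 = ((p + w) mod 3 - w) mod 3" by (simp add: mod_simps)
  also have "\<dots> = (0 - (t - h)) mod 3" unfolding p unfolding w by (simp only: mod_simps)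
  finally show "p mod 3 = (h - t) mod 3" by simp
qed

text \<open>The potential differences along the walk telescope.\<close>

lemma walk_gain_potential:
  assumes wf: "wf_digraph (bidirect H F)" and \<sigma>: "potential H \<psi> F \<sigma>"
    and \<psi>: "\<And>a. a \<in> F \<Longrightarrow> \<psi> a \<in> carrier (integer_mod_group 3)"
    and w: "pre_digraph.awalk (bidirect H F) u c v"
  shows "walk_gain (integer_mod_group 3) \<psi> c = (\<sigma> v - \<sigma> u) mod 3"
  using w
proof (induction c arbitrary: u)
  case Nil
  interpret wf_digraph "bidirect H F" by (rule wf)
  show ?case using Nil by (simp add: walk_gain_def awalk_Nil_iff)
next
  case (Cons e c)
  interpret wf_digraph "bidirect H F" by (rule wf)
  obtain a d where e: "e = (a, d)" by fastforce
  have a: "a \<in> F" and u: "tail (bidirect H F) e = u" and c: "awalk (head (bidirect H F) e) c v"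
    using Cons.prems by (auto simp: awalk_Cons_iff e)
  have IH: "walk_gain (integer_mod_group 3) \<psi> c = (\<sigma> v - \<sigma> (head (bidirect H F) e)) mod 3"
    by (rule Cons.IH[OF c])
  have p: "\<psi> a mod 3 = (\<sigma> (head H a) - \<sigma> (tail H a)) mod 3"
    using \<sigma> a by (auto simp: potential_def)
  have step: "walk_gain (integer_mod_group 3) \<psi> (e # c)
      = ((if d then \<psi> a else (- \<psi> a) mod 3) + walk_gain (integer_mod_group 3) \<psi> c) mod 3"
    using \<psi>[OF a] by (simp add: walk_gain_def e)
  show ?case
  proof (cases d)
    case True
    then have "tail H a = u" using u by (simp add: e)
    then show ?thesis unfolding step IH using True mod_3_shift(1)[OF p] by (simp add: e)
  next
    case False
    then have "head H a = u" using u by (simp add: e)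
    then show ?thesis unfolding step IH using False mod_3_shift(2)[OF p] by (simp add: e)
  qed
qed

lemma balanced_of_potential:
  assumes wf: "wf_digraph (bidirect H F)" and \<sigma>: "potential H \<psi> F \<sigma>"
    and \<psi>: "\<And>a. a \<in> F \<Longrightarrow> \<psi> a \<in> carrier (integer_mod_group 3)"
  shows "balanced (integer_mod_group 3) H \<psi> F"
  unfolding balanced_def
proof (intro allI impI)
  fix c assume "gain_cycle H F c"
  then obtain u where "pre_digraph.awalk (bidirect H F) u c u"
    by (auto simp: gain_cycle_def pre_digraph.cycle_def)
  from walk_gain_potential[OF wf \<sigma> \<psi> this]
  show "walk_gain (integer_mod_group 3) \<psi> c = \<one>\<^bsub>integer_mod_group 3\<^esub>" by simp
qed

text \<open>Arcs are added one by one: an arc joining two components allows one of them to be shifted, and an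
  arc inside a component closes a cycle.\<close>

lemma potential_of_balanced:
  assumes "finite F" "\<And>a. a \<in> F \<Longrightarrow> tail H a \<in> verts H \<and> head H a \<in> verts H"
    and "\<And>a. a \<in> F \<Longrightarrow> \<psi> a \<in> carrier (integer_mod_group 3)"
    and "balanced (integer_mod_group 3) H \<psi> F"
  shows "\<exists>\<sigma>. potential H \<psi> F \<sigma>"
  using assms
proof (induction F rule: finite_induct)
  case empty
  then show ?case by (simp add: potential_def)
next
  case (insert a F)
  have "balanced (integer_mod_group 3) H \<psi> F"
    using insert.prems(3) gain_cycle_mono[of H F _ "insert a F"] by (auto simp: balanced_def)
  then obtain \<sigma> where \<sigma>: "potential H \<psi> F \<sigma>"
    using insert.IH insert.prems by auto
  have wf: "wf_digraph (bidirect H F)" and wf': "wf_digraph (bidirect H (insert a F))"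
    using insert.prems(1) by (intro wf_bidirect; auto)+
  interpret wf_digraph "bidirect H F" by (rule wf)
  have av: "tail H a \<in> verts H" "head H a \<in> verts H" using insert.prems(1) by auto
  show ?case
  proof (cases "\<exists>p. awalk (head H a) p (tail H a)")
    case True
    then obtain p where p: "apath (head H a) p (tail H a)" using apath_awalk_to_apath by blast
    then have pw: "awalk (head H a) p (tail H a)" by (simp add: apath_def)
    have pF: "fst ` set p \<subseteq> F" using pw by (auto simp: awalk_def)
    define c where "c = (a, True) # p"
    have cw: "pre_digraph.awalk (bidirect H (insert a F)) (tail H a) c (tail H a)"
    proof -
      interpret B: wf_digraph "bidirect H (insert a F)" by (rule wf')
      show ?thesis
        using awalk_bidirect_mono[OF pw, of "insert a F"] by (auto simp: c_def B.awalk_Cons_iff)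
    qed
    moreover have "distinct (tl (pre_digraph.awalk_verts (bidirect H (insert a F)) (tail H a) c))"
      using p awalk_verts_bidirect[of H "insert a F" "head H a" p F]
      by (simp add: c_def pre_digraph.awalk_verts.simps apath_def)
    moreover have "distinct (map fst c)"
      using apath_bidirect_distinct[OF wf p] pF insert.hyps(2) by (auto simp: c_def)
    ultimately have "gain_cycle H (insert a F) c"
      unfolding gain_cycle_def pre_digraph.cycle_def by (auto simp: c_def)
    then have "walk_gain (integer_mod_group 3) \<psi> c = 0"
      using insert.prems(3) by (auto simp: balanced_def)
    then have "(\<psi> a + walk_gain (integer_mod_group 3) \<psi> p) mod 3 = 0"
      by (simp add: c_def walk_gain_def)
    moreover have "walk_gain (integer_mod_group 3) \<psi> p = (\<sigma> (tail H a) - \<sigma> (head H a)) mod 3"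
      using insert.prems(2) by (intro walk_gain_potential[OF wf \<sigma> _ pw]) auto
    ultimately have "\<psi> a mod 3 = (\<sigma> (head H a) - \<sigma> (tail H a)) mod 3" by (rule mod_3_shift(3))
    then show ?thesis using \<sigma> by (intro exI[of _ \<sigma>]) (auto simp: potential_def)
  next
    case False
    define C where "C = {w. \<exists>p. awalk (head H a) p w}"
    \<comment> \<open>The amount by which the component \<open>C\<close> of the head has to move for
      the new arc to fit.\<close>
    define \<delta> where "\<delta> = \<psi> a + \<sigma> (tail H a) - \<sigma> (head H a)"
    define \<sigma>' where "\<sigma>' w = \<sigma> w + (if w \<in> C then \<delta> else 0)" for w
    have step: "head (bidirect H F) e \<in> C" if e: "e \<in> F \<times> UNIV" "tail (bidirect H F) e \<in> C" for e
    proof -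
      obtain p where "awalk (head H a) p (tail (bidirect H F) e)" using e(2) by (auto simp: C_def)
      moreover have "awalk (tail (bidirect H F) e) [e] (head (bidirect H F) e)"
        using e(1) by (intro arc_implies_awalk) auto
      ultimately have "awalk (head H a) (p @ [e]) (head (bidirect H F) e)" by (rule awalk_appendI)
      then show ?thesis unfolding C_def by blast
    qed
    \<comment> \<open>Arcs can be walked in both directions, so \<open>C\<close> contains both ends
      of an arc of \<open>F\<close> or neither, and the shift preserves all old differences.\<close>
    have "tail H b \<in> C \<longleftrightarrow> head H b \<in> C" if "b \<in> F" for b
      using step[of "(b, True)"] step[of "(b, False)"] that by auto
    then have "potential H \<psi> F \<sigma>'"
      using \<sigma> by (auto simp: potential_def \<sigma>'_def)
    moreover have "head H a \<in> C" using av by (auto simp: C_def awalk_Nil_iff intro!: exI[of _ "[]"])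
    moreover have "tail H a \<notin> C" using False by (simp add: C_def)
    ultimately have "potential H \<psi> (insert a F) \<sigma>'"
      by (auto simp: potential_def \<sigma>'_def \<delta>_def)
    then show ?thesis by blast
  qed
qed

section \<open>The covering graph of a gain graph\<close>

context order_three begin

lemma card_orb:
  assumes "x \<in> moved"
  shows "card (orb g x) = 3"
proof -
  have "g (g x) \<noteq> g x" "g (g x) \<noteq> x" "g x \<noteq> x" using moved_neq[OF assms] by simp_all
  then show ?thesis unfolding orb_def by (metis card_3_iff)
qed

text \<open>The action of the integers through their residues: sums of exponents and negative
  exponents need no normalization.\<close>

definition act :: "int \<Rightarrow> 'v \<Rightarrow> 'v" where
  "act k x = (g ^^ nat (k mod 3)) x"

lemma mod_3_cases:
  fixes k :: int
  obtains "k mod 3 = 0" | "k mod 3 = 1" | "k mod 3 = 2"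
proof -
  have "k mod 3 = 0 \<or> k mod 3 = 1 \<or> k mod 3 = 2" by presburger
  then show thesis by (elim disjE) (fact that)+
qed

lemma act_values:
  "k mod 3 = 0 \<Longrightarrow> act k x = x" "k mod 3 = 1 \<Longrightarrow> act k x = g x" "k mod 3 = 2 \<Longrightarrow> act k x = g (g x)"
  by (simp_all add: act_def numeral_2_eq_2)

lemma act_cong: "k mod 3 = l mod 3 \<Longrightarrow> act k x = act l x"
  by (simp add: act_def)

lemma act_orb: "act k x \<in> orb g x"
  by (cases k rule: mod_3_cases) (simp_all add: act_values orb_def)

lemma orb_act:
  assumes "y \<in> orb g x" obtains k where "y = act k x"
proof -
  have "y = act 0 x \<or> y = act 1 x \<or> y = act 2 x"
    using assms by (simp add: act_values orb_def)
  then show thesis using that by blast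
qed

lemma act_eq_iff:
  assumes "x \<in> moved"
  shows "act k x = act l x \<longleftrightarrow> k mod 3 = l mod 3"
proof
  assume "act k x = act l x"
  then show "k mod 3 = l mod 3"
    using moved_neq[OF assms]
    by (cases k rule: mod_3_cases; cases l rule: mod_3_cases) (simp_all add: act_values)
qed (rule act_cong)

end

text \<open>The quotient gain graph in terms of \<open>act\<close>: the group operation becomes
  addition of integers, and an arc is the range over all integer shifts rather than over three
  residues.\<close>

locale gain_quotient = order_three g for g :: "'v::finite \<Rightarrow> 'v" +
  fixes E :: "'v set set" and H :: "('v set, 'v set set) pre_digraph" and \<psi> :: "'v set set \<Rightarrow> int"
    and rep :: "'v set \<Rightarrow> 'v"
  assumes free_E: "free_graph E"
    and verts_H: "verts H = orb g ` moved"
    and arcs_H: "arcs H = orb ((`) g) ` E"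
    and rep: "U \<in> verts H \<Longrightarrow> rep U \<in> U"
    and ends: "a \<in> arcs H \<Longrightarrow> tail H a \<in> verts H \<and> head H a \<in> verts H"
    and gain: "a \<in> arcs H \<Longrightarrow> \<psi> a \<in> carrier (integer_mod_group 3)"
    and arc: "a \<in> arcs H \<Longrightarrow> a = range (\<lambda>k. {act k (rep (tail H a)), act (k + \<psi> a) (rep (head H a))})"
begin

interpretation edges: order_three "(`) g"
  by unfold_locales (rule image_g3)

lemma verts_orb:
  assumes "U \<in> verts H" "x \<in> U"
  shows "U = orb g x" "x \<in> moved"
proof -
  obtain y where "y \<in> moved" "U = orb g y" using assms(1) by (auto simp: verts_H)
  then show "U = orb g x" using assms(2) by (simp add: mem_orb_iff)
  have "x = y \<or> x = g y \<or> x = g (g y)" using assms(2) \<open>U = orb g y\<close> by (simp add: orb_def)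
  then show "x \<in> moved" using \<open>y \<in> moved\<close> by auto
qed

lemma arcs_orb:
  assumes "a \<in> arcs H" "e \<in> a"
  shows "a = orb ((`) g) e" "e \<in> E" "card e = 2" "e \<subseteq> moved"
proof -
  obtain f where f: "f \<in> E" "a = orb ((`) g) f" using assms(1) by (auto simp: arcs_H)
  then show "a = orb ((`) g) e" using assms(2) by (simp add: edges.mem_orb_iff)
  show "e \<in> E" using f assms(2) free_E by (auto simp: orb_def free_graph_def)
  then show "card e = 2" "e \<subseteq> moved" using free_E by (auto simp: free_graph_def)
qed

lemma card_arc:
  assumes "a \<in> arcs H"
  shows "card a = 3"
proof -
  obtain f where f: "f \<in> E" "a = orb ((`) g) f" using assms(1) by (auto simp: arcs_H)
  then have "g ` f \<noteq> f" using free_E image_g_edge_neq by (auto simp: free_graph_def)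
  then show ?thesis unfolding f(2) by (intro edges.card_orb) (simp add: edges.moved_def)
qed

lemma card_Union_arcs:
  assumes "S \<subseteq> arcs H"
  shows "card (\<Union>S) = 3 * card S"
proof -
  have "disjnt a b" if "a \<in> S" "b \<in> S" "a \<noteq> b" for a b
    using arcs_orb(1)[of a] arcs_orb(1)[of b] that subsetD[OF assms] unfolding disjnt_iff by metis
  then have "card (\<Union>S) = (\<Sum>a\<in>S. card a)"
    by (intro card_Union_disjoint) (auto simp: pairwise_def)
  also have "\<dots> = (\<Sum>a\<in>S. 3)" using card_arc assms by (intro sum.cong) auto
  finally show ?thesis by simp
qed

lemma card_Union_verts:
  assumes "W \<subseteq> verts H"
  shows "card (\<Union>W) = 3 * card W"
proof -
  have "disjnt a b" if "a \<in> W" "b \<in> W" "a \<noteq> b" for a b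
    using verts_orb(1)[of a] verts_orb(1)[of b] that subsetD[OF assms] unfolding disjnt_iff by metis
  then have "card (\<Union>W) = (\<Sum>a\<in>W. card a)"
    by (intro card_Union_disjoint) (auto simp: pairwise_def)
  also have "\<dots> = (\<Sum>a\<in>W. 3)"
    using assms by (intro sum.cong) (auto simp: verts_H card_orb)
  finally show ?thesis by simp
qed

lemma free_Union:
  assumes "S \<subseteq> arcs H"
  shows "free_graph (\<Union>S)" "\<Union>S \<subseteq> E"
proof -
  show "free_graph (\<Union>S)"
    unfolding free_graph_def
  proof
    fix e assume "e \<in> \<Union>S"
    then obtain a where a: "a \<in> S" "e \<in> a" by blast
    then have "a \<in> arcs H" using assms by blast
    note o = arcs_orb[OF this a(2)]
    have "g ` e \<in> a" by (subst o(1)) (simp add: orb_def)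
    then show "g ` e \<in> \<Union>S \<and> e \<subseteq> moved \<and> card e = 2" using a(1) o(3,4) by blast
  qed
  show "\<Union>S \<subseteq> E"
  proof
    fix e assume "e \<in> \<Union>S"
    then obtain a where "a \<in> arcs H" "e \<in> a" using assms by blast
    then show "e \<in> E" by (rule arcs_orb(2))
  qed
qed

lemma rep_moved:
  assumes "U \<in> verts H"
  shows "rep U \<in> moved" "act k (rep U) \<in> U"
proof -
  note o = verts_orb[OF assms rep[OF assms]]
  show "rep U \<in> moved" by (rule o(2))
  show "act k (rep U) \<in> U" by (subst o(1)) (rule act_orb)
qed

lemma endpoints_verts: "F \<subseteq> arcs H \<Longrightarrow> endpoints H F \<subseteq> verts H"
  using ends by (auto simp: endpoints_def)

lemma arc_edgeE:
  assumes "a \<in> arcs H" "e \<in> a"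
  obtains k where "e = {act k (rep (tail H a)), act (k + \<psi> a) (rep (head H a))}"
  using subsetD[OF equalityD1[OF arc[OF assms(1)]] assms(2)] by (elim rangeE)

lemma arc_edgeI:
  assumes "a \<in> arcs H"
  shows "{act k (rep (tail H a)), act (k + \<psi> a) (rep (head H a))} \<in> a"
  by (rule subsetD[OF equalityD2[OF arc[OF assms]]], rule range_eqI[where x = k], rule refl)

text \<open>For the count 2|V(F)| - 1 the whole preimage of \<open>F\<close> is used, with three
  times as many vertices and edges. For balanced \<open>F\<close> a single lifted copy is used, with
  the same numbers of vertices and edges as below.\<close>

lemma gain_sparse_of_laman:
  assumes S: "S \<subseteq> arcs H" and sparse: "laman_sparse (\<Union>S)"
  shows "gain_sparse231 (integer_mod_group 3) H \<psi> S"
  unfolding gain_sparse231_def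
proof (intro allI impI conjI)
  fix F assume F: "F \<subseteq> S" "F \<noteq> {}"
  define W where "W = endpoints H F"
  have Fa: "F \<subseteq> arcs H" using F(1) S by blast
  have W: "W \<subseteq> verts H" unfolding W_def by (rule endpoints_verts[OF Fa])
  have tW: "tail H a \<in> W" "head H a \<in> W" if "a \<in> F" for a
    using that by (auto simp: W_def endpoints_def)
  have "W \<noteq> {}" using F(2) tW by blast
  have "e \<subseteq> \<Union>W" if e: "e \<in> a" "a \<in> F" for e a
  proof -
    have a: "a \<in> arcs H" using e Fa by blast
    obtain k where "e = {act k (rep (tail H a)), act (k + \<psi> a) (rep (head H a))}"
      by (rule arc_edgeE[OF a e(1)])
    moreover have "act k (rep (tail H a)) \<in> tail H a" "act (k + \<psi> a) (rep (head H a)) \<in> head H a"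
      using ends[OF a] by (simp_all add: rep_moved(2))
    ultimately show ?thesis using tW[OF e(2)] by blast
  qed
  then have "card (\<Union>F) \<le> card (induced (\<Union>S) (\<Union>W))"
    using F(1) by (intro card_mono) (auto simp: induced_def)
  moreover have "card W \<ge> 1" using \<open>W \<noteq> {}\<close> by (simp add: Suc_leI card_gt_0_iff)
  moreover have "2 \<le> card (\<Union>W) \<Longrightarrow> card (induced (\<Union>S) (\<Union>W)) + 3 \<le> 2 * card (\<Union>W)"
    using sparse unfolding laman_sparse_def by blast
  ultimately show "int (card F) \<le> 2 * int (card (endpoints H F)) - 1"
    unfolding card_Union_arcs[OF Fa] card_Union_verts[OF W] W_def[symmetric] by linarith
  assume bal: "balanced (integer_mod_group 3) H \<psi> F"
  have "\<exists>\<sigma>. potential H \<psi> F \<sigma>"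
  proof (rule potential_of_balanced[OF finite _ _ bal])
    fix a assume "a \<in> F"
    then have a: "a \<in> arcs H" using Fa by blast
    show "tail H a \<in> verts H \<and> head H a \<in> verts H" by (rule ends[OF a])
    show "\<psi> a \<in> carrier (integer_mod_group 3)" by (rule gain[OF a])
  qed
  then obtain \<sigma> where \<sigma>: "potential H \<psi> F \<sigma>" by blast
  \<comment> \<open>The potential picks one vertex from every orbit; each arc of \<open>F\<close>
    has an edge between the picked vertices.\<close>
  define s where "s U = act (\<sigma> U) (rep U)" for U
  have sU: "s U \<in> U" if "U \<in> W" for U     using rep_moved(2)[OF subsetD[OF W that]] by (simp only: s_def)
  have "inj_on s W"
  proof (rule inj_onI)
    fix U U' assume U: "U \<in> W" "U' \<in> W" "s U = s U'"
    have "U = orb g (s U)" "U' = orb g (s U')"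
      using U verts_orb(1)[OF subsetD[OF W] sU] by blast+
    then show "U = U'" using U(3) by metis
  qed
  then have cX: "card (s ` W) = card W" by (rule card_image)
  define f where "f a = {s (tail H a), s (head H a)}" for a
  have fa: "f a \<in> a" if "a \<in> F" for a
  proof -
    have a: "a \<in> arcs H" using that Fa by blast
    have "\<psi> a mod 3 = (\<sigma> (head H a) - \<sigma> (tail H a)) mod 3" using \<sigma> that by (auto simp: potential_def)
    then have "(\<sigma> (tail H a) + \<psi> a) mod 3 = \<sigma> (head H a) mod 3"
      by (metis add.commute diff_add_cancel mod_add_left_eq)
    then have "f a = {act (\<sigma> (tail H a)) (rep (tail H a)), act (\<sigma> (tail H a) + \<psi> a) (rep (head H a))}"
      unfolding f_def s_def by (simp add: act_cong[of "\<sigma> (tail H a) + \<psi> a" "\<sigma> (head H a)"])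
    then show ?thesis by (simp only: arc_edgeI[OF a])
  qed
  have "inj_on f F"
  proof (rule inj_onI)
    fix a b assume ab: "a \<in> F" "b \<in> F" "f a = f b"
    have "a = orb ((`) g) (f a)" "b = orb ((`) g) (f b)"
      using ab arcs_orb(1)[OF subsetD[OF Fa] fa] by blast+
    then show "a = b" using ab(3) by metis
  qed
  then have "card F = card (f ` F)" by (rule card_image[symmetric])
  also have "\<dots> \<le> card (induced (\<Union>S) (s ` W))"
  proof (rule card_mono)
    show "f ` F \<subseteq> induced (\<Union>S) (s ` W)"
    proof
      fix e assume "e \<in> f ` F"
      then obtain a where a: "a \<in> F" "e = f a" by blast
      then have "e \<in> \<Union>S" using fa F(1) by blast
      moreover have "e \<subseteq> s ` W" using tW[OF a(1)] by (auto simp: a(2) f_def)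
      ultimately show "e \<in> induced (\<Union>S) (s ` W)" by (simp add: induced_def)
    qed
  qed simp
  finally have "card F \<le> card (induced (\<Union>S) (s ` W))" .
  \<comment> \<open>A lifted edge has two distinct ends among the picked vertices. In particular a
    loop is never balanced here.\<close>
  moreover have "2 \<le> card (s ` W)"
  proof -
    obtain a where a: "a \<in> F" using F(2) by blast
    have "card (f a) = 2" by (rule arcs_orb(3)[OF subsetD[OF Fa a] fa[OF a]])
    moreover have "f a \<subseteq> s ` W" using tW[OF a] by (auto simp: f_def)
    ultimately show ?thesis by (intro two_le_cardI)
  qed
  then have "card (induced (\<Union>S) (s ` W)) + 3 \<le> 2 * card (s ` W)"
    using sparse unfolding laman_sparse_def by blast
  ultimately show "int (card F) \<le> 2 * int (card (endpoints H F)) - 3"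
    unfolding W_def[symmetric] cX by linarith
qed

lemma laman_of_gain_sparse:
  assumes S: "S \<subseteq> arcs H" and gs: "gain_sparse231 (integer_mod_group 3) H \<psi> S"
  shows "laman_sparse (\<Union>S)"
proof (rule ccontr)
  assume not: "\<not> laman_sparse (\<Union>S)"
  define D where "D = \<Union>S"
  have D: "free_graph D" unfolding D_def by (rule free_Union(1)[OF S])
  define \<X> where "\<X> = {X. X \<subseteq> moved \<and> 2 \<le> card X \<and> deficit D X < 0}"
  have "\<X> \<noteq> {}"
  proof -
    obtain X where X: "2 \<le> card X" "deficit D X < 0"
      using not by (auto simp: laman_sparse_iff_deficit D_def not_le)
    then have "induced D X \<noteq> {}" by (auto simp: deficit_def)
    then obtain e where e: "e \<in> D" "e \<subseteq> X" by (auto simp: induced_def)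
    then have "card e = 2" "e \<subseteq> X \<inter> moved" using D by (auto simp: free_graph_def)
    then have "2 \<le> card (X \<inter> moved)" by (intro two_le_cardI)
    then have "X \<inter> moved \<in> \<X>"
      using X(2) deficit_Int_moved[OF D, of X] by (simp add: \<X>_def)
    then show ?thesis by blast
  qed
  \<comment> \<open>minimizing \<open>f\<close> means minimal deficit first and maximal size second\<close>
  define f where "f X = deficit D X * (int CARD('v) + 1) - int (card X)" for X
  define X where "X = arg_min_on f \<X>"
  have X: "X \<in> \<X>" unfolding X_def by (rule arg_min_if_finite(1)[OF finite \<open>\<X> \<noteq> {}\<close>])
  have min: "f X \<le> f Y" if "Y \<in> \<X>" for Y
    unfolding X_def by (rule arg_min_least[OF finite \<open>\<X> \<noteq> {}\<close> that])
  \<comment> \<open>One unit of deficit outweighs any difference in size, as sizes do not exceed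
    \<open>CARD('v)\<close>.\<close>
  have low: "deficit D X \<le> deficit D Y" if "Y \<in> \<X>" for Y
  proof (rule ccontr)
    assume "\<not> deficit D X \<le> deficit D Y"
    then have "(deficit D Y + 1) * (int CARD('v) + 1) \<le> deficit D X * (int CARD('v) + 1)"
      by (intro mult_right_mono) auto
    moreover have "int (card X) \<le> int CARD('v)" by (simp add: card_mono)
    ultimately show False using min[OF that] by (simp add: f_def algebra_simps)
  qed
  have big: "card Y \<le> card X" if "Y \<in> \<X>" "deficit D Y \<le> deficit D X" for Y
    using min[OF that(1)] low[OF that(1)] that(2) by (simp add: f_def)
  have Xm: "X \<subseteq> moved" "2 \<le> card X" "deficit D X < 0" using X by (simp_all add: \<X>_def)
  then have many: "2 * int (card X) - 3 < int (card (induced D X))" by (simp add: deficit_def)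
  define F where "F = {a \<in> S. \<exists>e\<in>a. e \<subseteq> X}"
  have FS: "F \<subseteq> S" by (auto simp: F_def)
  then have Fa: "F \<subseteq> arcs H" using S by blast
  have "F \<noteq> {}"
  proof -
    have "induced D X \<noteq> {}" using many Xm(2) by auto
    then show ?thesis by (auto simp: F_def D_def induced_def)
  qed
  define W where "W = endpoints H F"
  have W: "W \<subseteq> verts H" unfolding W_def by (rule endpoints_verts[OF Fa])
  show False
  proof (cases "X \<inter> g ` X = {}")
    case False
    have "deficit D (X \<union> g ` X) \<le> deficit D X"
    proof -
      have sub: "deficit D (X \<union> g ` X) + deficit D (X \<inter> g ` X) \<le> 2 * deficit D X"
        using deficit_submodular[of D X "g ` X"] by (simp add: deficit_image[OF D])
      \<comment> \<open>A one-point intersection escapes the minimality of \<open>X\<close>, which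
        concerns sets of two or more vertices. Its deficit -1 still suffices: the union has at most
        2d + 1, which is at most d for a negative integer d.\<close>
      consider "card (X \<inter> g ` X) = 1" | "X \<inter> g ` X \<in> \<X>" | "0 \<le> deficit D (X \<inter> g ` X)"
      proof (cases "2 \<le> card (X \<inter> g ` X)")
        case True
        then show ?thesis using that(2,3) Xm(1) by (force simp: \<X>_def)
      next
        case c: False
        have "card (X \<inter> g ` X) \<noteq> 0" using False by simp
        then show ?thesis using c that(1) by linarith
      qed
      then show ?thesis
      proof cases
        case 1
        then obtain x where "X \<inter> g ` X = {x}" by (auto simp: card_1_singleton_iff)
        then have "deficit D (X \<inter> g ` X) = - 1"
          using D by (simp add: deficit_singleton free_graph_def)
        then show ?thesis using sub Xm(3) by linarith
      next
        case 2
        then show ?thesis using sub low[OF 2] by linarith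
      next
        case 3
        then show ?thesis using sub Xm(3) by linarith
      qed
    qed
    moreover have "2 \<le> card (X \<union> g ` X)" using Xm(2) card_mono[of "X \<union> g ` X" X] by simp
    ultimately have "card (X \<union> g ` X) \<le> card X"
      using Xm by (intro big) (simp_all add: \<X>_def)
    then have "X = X \<union> g ` X" by (intro card_seteq) auto
    then have gX: "g ` X \<subseteq> X" by blast
    then have inX: "act k x \<in> X" if "x \<in> X" for k x
      using that act_orb[of k x] by (auto simp: orb_def)
    have all: "e \<subseteq> X" if a: "a \<in> F" and e: "e \<in> a" for a e
    proof -
      obtain h where h: "h \<in> a" "h \<subseteq> X" using a by (auto simp: F_def)
      have "a = orb ((`) g) h" by (rule arcs_orb(1)[OF subsetD[OF Fa a] h(1)])
      then have "e = h \<or> e = g ` h \<or> e = g ` g ` h" using e by (simp add: orb_def)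
      then show ?thesis using h(2) gX by blast
    qed
    \<comment> \<open>\<open>X\<close> is now a union of orbits, so it spans 3|F| edges and has at
      least 3|W| vertices. Dividing the violated count by three contradicts the unbalanced
      bound.\<close>
    have "induced D X = \<Union>F"
      using all FS by (auto simp: induced_def D_def F_def)
    then have "card (induced D X) = 3 * card F" by (simp only: card_Union_arcs[OF Fa])
    moreover have "\<Union>W \<subseteq> X"
    proof
      fix x assume "x \<in> \<Union>W"
      then obtain a where a: "a \<in> F" "x \<in> tail H a \<or> x \<in> head H a" by (auto simp: W_def endpoints_def)
      have aH: "a \<in> arcs H" using a(1) Fa by blast
      have pt: "act k (rep (tail H a)) \<in> X" "act (k + \<psi> a) (rep (head H a)) \<in> X" for k
        using all[OF a(1) arc_edgeI[OF aH, of k]] by simp_all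
      have ex: "\<exists>k. x = act k (rep U)" if "U \<in> verts H" "x \<in> U" for U
        using verts_orb(1)[OF that(1) rep[OF that(1)]] that(2) by (metis orb_act)
      from a(2) show "x \<in> X"
      proof
        assume "x \<in> tail H a"
        then obtain k where "x = act k (rep (tail H a))" using ex ends[OF aH] by blast
        then show ?thesis using pt(1) by simp
      next
        assume "x \<in> head H a"
        then obtain k where "x = act k (rep (head H a))" using ex ends[OF aH] by blast
        then show ?thesis using pt(2)[of "k - \<psi> a"] by simp
      qed
    qed
    then have "3 * card W \<le> card X"
      using card_mono[of X "\<Union>W"] by (simp add: card_Union_verts[OF W])
    moreover have "int (card F) \<le> 2 * int (card W) - 1"
      using gs FS \<open>F \<noteq> {}\<close> unfolding gain_sparse231_def W_def by blast
    ultimately show False using many by linarith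
  next
    case True
    have gnot: "g x \<notin> X" if "x \<in> X" for x using that True by blast
    \<comment> \<open>In the disjoint case \<open>X\<close> meets every vertex orbit at most once,
      so it can serve as a lifted copy.\<close>
    have uniq: "x = y" if "x \<in> X" "y \<in> X" "orb g x = orb g y" for x y
    proof -
      have "y \<in> orb g x" using that(3) by (simp add: mem_orb_iff)
      then have "y = x \<or> y = g x \<or> x = g y" by (auto simp: orb_def g3)
      then show ?thesis using gnot that(1,2) by blast
    qed
    have orb_act_eq: "orb g (act k x) = orb g x" for k x
      using act_orb[of k x] by (simp add: mem_orb_iff)
    have "card (induced D X) \<le> card F"
    proof -
      have "inj_on (orb ((`) g)) (induced D X)"
      proof (rule inj_onI)
        fix e h assume e: "e \<in> induced D X" and h: "h \<in> induced D X" and eq: "orb ((`) g) e = orb ((`) g) h"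
        have eX: "e \<subseteq> X" "h \<subseteq> X" "e \<noteq> {}" "h \<noteq> {}"
          using e h D by (auto simp: induced_def free_graph_def)
        have "h \<in> orb ((`) g) e" using eq by (simp add: edges.mem_orb_iff)
        then have "h = e \<or> h = g ` e \<or> h = g ` g ` e" by (simp add: orb_def)
        then consider "h = e" | "h = g ` e" | "e = g ` h" by (metis image_g3)
        then show "e = h" using eX gnot by cases blast+
      qed
      then have "card (induced D X) = card (orb ((`) g) ` induced D X)" by (rule card_image[symmetric])
      also have "\<dots> \<le> card F"
      proof (rule card_mono)
        show "orb ((`) g) ` induced D X \<subseteq> F"
        proof
          fix b assume "b \<in> orb ((`) g) ` induced D X"
          then obtain e a where e: "b = orb ((`) g) e" "e \<subseteq> X" "a \<in> S" "e \<in> a"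
            by (auto simp: induced_def D_def)
          then have "b = a" using arcs_orb(1)[OF subsetD[OF S e(3)] e(4)] by simp
          then show "b \<in> F" using e by (auto simp: F_def)
        qed
      qed simp
      finally show ?thesis .
    qed
    \<comment> \<open>The exponent, determined modulo 3, that moves the representative into
      \<open>X\<close>; it is arbitrary on orbits that miss \<open>X\<close>.\<close>
    define \<sigma> where "\<sigma> U = (SOME k. act k (rep U) \<in> X)" for U
    have \<sigma>: "\<sigma> U mod 3 = k mod 3" if "U \<in> verts H" "act k (rep U) \<in> X" for U k
    proof -
      have "act (\<sigma> U) (rep U) \<in> X" unfolding \<sigma>_def using that(2) by (rule someI)
      then have "act (\<sigma> U) (rep U) = act k (rep U)"
        using that(2) by (rule uniq) (simp only: orb_act_eq)
      then show ?thesis using act_eq_iff rep_moved(1)[OF that(1)] by blast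
    qed
    have edge: "\<exists>k. act k (rep (tail H a)) \<in> X \<and> act (k + \<psi> a) (rep (head H a)) \<in> X" if aF: "a \<in> F" for a
    proof -
      obtain e where e: "e \<in> a" "e \<subseteq> X" using aF by (auto simp: F_def)
      obtain k where "e = {act k (rep (tail H a)), act (k + \<psi> a) (rep (head H a))}"
        by (rule arc_edgeE[OF subsetD[OF Fa aF] e(1)])
      then show ?thesis using e(2) by blast
    qed
    have "potential H \<psi> F \<sigma>"
      unfolding potential_def
    proof
      fix a assume a: "a \<in> F"
      then have aH: "a \<in> arcs H" using Fa by blast
      obtain k where k: "act k (rep (tail H a)) \<in> X" "act (k + \<psi> a) (rep (head H a)) \<in> X"
        using edge[OF a] by blast
      have "\<sigma> (tail H a) mod 3 = k mod 3" "\<sigma> (head H a) mod 3 = (k + \<psi> a) mod 3"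
        using \<sigma> k ends[OF aH] by blast+
      then have "(\<sigma> (head H a) - \<sigma> (tail H a)) mod 3 = ((k + \<psi> a) - k) mod 3" by (rule mod_diff_cong[rotated])
      then show "\<psi> a mod 3 = (\<sigma> (head H a) - \<sigma> (tail H a)) mod 3" by simp
    qed
    then have "balanced (integer_mod_group 3) H \<psi> F"
    proof (rule balanced_of_potential[rotated])
      show "wf_digraph (bidirect H F)" by (rule wf_bidirect) (use ends Fa in blast)
      show "\<psi> a \<in> carrier (integer_mod_group 3)" if "a \<in> F" for a by (rule gain[OF subsetD[OF Fa that]])
    qed
    then have "int (card F) \<le> 2 * int (card W) - 3"
      using gs FS \<open>F \<noteq> {}\<close> unfolding gain_sparse231_def W_def by blast
    moreover have "W \<subseteq> orb g ` X"
    proof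
      fix U assume U: "U \<in> W"
      then obtain a where a: "a \<in> F" "U = tail H a \<or> U = head H a" by (auto simp: W_def endpoints_def)
      then obtain k where "act k (rep U) \<in> X" using edge[OF a(1)] by blast
      moreover have "U = orb g (act k (rep U))" for k
        using W U by (intro verts_orb(1) rep_moved(2)) auto
      ultimately show "U \<in> orb g ` X" by blast
    qed
    then have "card W \<le> card X"
      by (meson card_image_le card_mono finite order_trans)
    ultimately show False using many \<open>card (induced D X) \<le> card F\<close> by linarith
  qed
qed

end

section \<open>The cyclic group of order three\<close>

definition complex_matrix :: "complex \<Rightarrow> real^2^2" where
  "complex_matrix z = vector [vector [Re z, - Im z], vector [Im z, Re z]]"

lemma complex_matrix_nth:
  "complex_matrix z $ 1 $ 1 = Re z" "complex_matrix z $ 1 $ 2 = - Im z"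
  "complex_matrix z $ 2 $ 1 = Im z" "complex_matrix z $ 2 $ 2 = Re z"
  by (simp_all add: complex_matrix_def)

lemma complex_matrix_mult: "complex_matrix z ** complex_matrix w = complex_matrix (z * w)"
  by (simp add: vec_eq_iff forall_2 matrix_matrix_mult_def sum_2 complex_matrix_nth algebra_simps)

lemma complex_matrix_one: "complex_matrix 1 = mat 1"
  by (simp add: vec_eq_iff forall_2 mat_def complex_matrix_nth)

lemma complex_matrix_vec2: "complex_matrix z *v vec2 w = vec2 (z * w)"
  by (simp add: vec_eq_iff forall_2 matrix_vector_mult_def sum_2 complex_matrix_nth algebra_simps)

lemma complex_matrix_inject: "complex_matrix z = complex_matrix w \<longleftrightarrow> z = w"
proof
  assume "complex_matrix z = complex_matrix w"
  then have "complex_matrix z $ 1 $ 1 = complex_matrix w $ 1 $ 1" "complex_matrix z $ 2 $ 1 = complex_matrix w $ 2 $ 1"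
    by simp_all
  then show "z = w" by (simp add: complex_matrix_nth complex_eq_iff)
qed simp

lemma rotation2_eq: "rotation2 \<alpha> = complex_matrix (cis \<alpha>)"
  by (simp add: rotation2_def complex_matrix_def)

lemma orthogonal_group2_simps:
  "mult orthogonal_group2 = (**)" "one orthogonal_group2 = mat 1"
  by (simp_all add: orthogonal_group2_def)

lemma carrier_C3_group:
  assumes "A \<in> carrier C3_group"
  shows "\<exists>z. norm z = 1 \<and> A = complex_matrix z"
proof -
  have "A \<in> generate orthogonal_group2 (carrier orthogonal_group2 \<inter> {rotation2 (2 * pi / 3)})"
    using assms by (simp add: C3_group_def carrier_subgroup_generated)
  then show ?thesis
  proof (induction rule: generate.induct)
    case one
    then show ?case
      by (intro exI[of _ 1]) (simp add: complex_matrix_one orthogonal_group2_def)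
  next
    case (incl h)
    then show ?case by (auto simp: rotation2_eq intro!: exI[of _ "cis (2 * pi / 3)"])
  next
    case (inv h)
    define z where "z = cis (2 * pi / 3)"
    have h: "h = complex_matrix z" "h \<in> carrier orthogonal_group2" using inv by (auto simp: rotation2_eq z_def)
    have zz: "cnj z * z = 1" "z * cnj z = 1" by (simp_all add: z_def cis_cnj cis_mult)
    have 1: "complex_matrix (cnj z) ** h = mat 1" "h ** complex_matrix (cnj z) = mat 1"
      by (simp_all only: h complex_matrix_mult zz complex_matrix_one)
    have "transpose (complex_matrix (cnj z)) = h"
      by (simp add: h vec_eq_iff forall_2 transpose_def complex_matrix_nth)
    then have "complex_matrix (cnj z) \<in> carrier orthogonal_group2"
      using 1 by (simp add: orthogonal_group2_def orthogonal_matrix_def)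
    \<comment> \<open>The inverse is a definite description over the carrier, so the conjugate
      matrix must be shown orthogonal and unique.\<close>
    then have "inv\<^bsub>orthogonal_group2\<^esub> h = complex_matrix (cnj z)"
      unfolding m_inv_def orthogonal_group2_simps
    proof (intro the_equality conjI 1)
      fix y assume y: "y \<in> carrier orthogonal_group2 \<and> h ** y = mat 1 \<and> y ** h = mat 1"
      have "y = (complex_matrix (cnj z) ** h) ** y" by (simp only: 1 matrix_mul_lid)
      also have "\<dots> = complex_matrix (cnj z)"
        using y by (simp only: matrix_mul_assoc[symmetric] matrix_mul_rid)
      finally show "y = complex_matrix (cnj z)" .
    qed
    then show ?case by (intro exI[of _ "cnj z"]) (simp add: z_def)
  next
    case (eng h1 h2)
    then obtain z w where "norm z = 1" "norm w = 1" "h1 = complex_matrix z" "h2 = complex_matrix w" by blast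
    then show ?case
      by (intro exI[of _ "z * w"]) (simp add: norm_mult complex_matrix_mult orthogonal_group2_def)
  qed
qed

text \<open>The cube of \<omega> is 1 because 1 + 2 is 0 modulo 3, and injectivity keeps \<omega>
  away from the image of 0.\<close>

lemma faithful_representation_C3:
  assumes hom: "\<tau> \<in> hom (integer_mod_group 3) C3_group"
    and inj: "inj_on \<tau> (carrier (integer_mod_group 3))"
  obtains \<omega> where "\<omega> ^ 3 = 1" "\<omega> \<noteq> 1"
    "\<tau> 0 = complex_matrix 1" "\<tau> 1 = complex_matrix \<omega>" "\<tau> 2 = complex_matrix (\<omega> * \<omega>)"
proof -
  have car: "{0, 1, 2} \<subseteq> carrier (integer_mod_group 3)" by (auto simp: carrier_integer_mod_group)
  have mult: "\<tau> ((x + y) mod 3) = \<tau> x ** \<tau> y" if "x \<in> {0, 1, 2}" "y \<in> {0, 1, 2}" for x y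
    using hom_mult[OF hom, of x y] that car by (auto simp: C3_group_def orthogonal_group2_def)
  obtain a where a: "norm a = 1" "\<tau> 0 = complex_matrix a"
    using carrier_C3_group hom_in_carrier[OF hom, of 0] car by blast
  obtain \<omega> where w: "norm \<omega> = 1" "\<tau> 1 = complex_matrix \<omega>"
    using carrier_C3_group hom_in_carrier[OF hom, of 1] car by blast
  have "a * a = a" using mult[of 0 0] by (simp add: a complex_matrix_mult complex_matrix_inject)
  \<comment> \<open>The other idempotent, 0, does not have norm 1.\<close>
  then have "a = 1" using a(1) by auto
  have t2: "\<tau> 2 = complex_matrix (\<omega> * \<omega>)" using mult[of 1 1] by (simp add: w complex_matrix_mult)
  have "\<tau> 0 = \<tau> 1 ** \<tau> 2" using mult[of 1 2] by simp
  then have "\<omega> ^ 3 = 1"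
    by (simp add: a \<open>a = 1\<close> w t2 complex_matrix_mult complex_matrix_inject power3_eq_cube mult.assoc)
  moreover have "\<omega> \<noteq> 1"
  proof
    assume "\<omega> = 1"
    then have "\<tau> 0 = \<tau> 1" by (simp add: a \<open>a = 1\<close> w)
    then have "(0::int) = 1" using inj car by (auto dest: inj_onD)
    then show False by simp
  qed
  ultimately show thesis using that a \<open>a = 1\<close> w t2 by simp
qed

lemma action_on_vertices:
  fixes V :: "'v set"
  assumes hom: "\<theta> \<in> hom (integer_mod_group 3) (graph_aut_group V E)" and x: "x \<in> V"
  shows "\<theta> 0 x = x" "\<theta> 1 x \<in> V" "\<theta> 2 x = \<theta> 1 (\<theta> 1 x)" "\<theta> 1 (\<theta> 1 (\<theta> 1 x)) = x"
proof -
  have bij: "\<theta> k \<in> Bij V" if "k \<in> {0, 1, 2}" for k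
    using hom_in_carrier[OF hom, of k] that by (auto simp: graph_aut_group_def carrier_integer_mod_group)
  have mult: "\<theta> ((k + l) mod 3) y = \<theta> k (\<theta> l y)" if "k \<in> {0, 1, 2}" "l \<in> {0, 1, 2}" "y \<in> V" for k l y
  proof -
    have "\<theta> ((k + l) mod 3) = compose V (\<theta> k) (\<theta> l)"
      using hom_mult[OF hom, of k l] that bij[OF that(1)] bij[OF that(2)]
      by (auto simp: graph_aut_group_def BijGroup_def carrier_integer_mod_group)
    then show ?thesis using that(3) by (simp add: compose_eq)
  qed
  have V: "\<theta> k y \<in> V" if "k \<in> {0, 1, 2}" "y \<in> V" for k y
    using bij[OF that(1)] that(2) by (auto simp: Bij_def bij_betw_def)
  have inj: "inj_on (\<theta> 0) V" using bij[of 0] by (simp add: Bij_def bij_betw_def)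
  \<comment> \<open>The image of the neutral element is idempotent and injective on
    \<open>V\<close>, hence the identity there.\<close>
  have "\<theta> 0 (\<theta> 0 x) = \<theta> 0 x" using mult[of 0 0 x] x by simp
  then show 0: "\<theta> 0 x = x" using inj_onD[OF inj] V[of 0 x] x by auto
  show "\<theta> 1 x \<in> V" using V[of 1 x] x by simp
  show 2: "\<theta> 2 x = \<theta> 1 (\<theta> 1 x)" using mult[of 1 1 x] x by simp
  show "\<theta> 1 (\<theta> 1 (\<theta> 1 x)) = x" using mult[of 1 2 x] x 0 2 by simp
qed

lemma carrier_integer_mod_group_3: "carrier (integer_mod_group 3) = {0, 1, 2}"
  by (auto simp: carrier_integer_mod_group)

lemma orbit_integer_mod_group_3: "orbit (integer_mod_group 3) \<phi> x = {\<phi> 0 x, \<phi> 1 x, \<phi> 2 x}"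
  unfolding orbit_def carrier_integer_mod_group_3 by blast

theorem theorem6p11:
  fixes V :: "'v::finite set" and E :: "'v set set"
    and \<theta> :: "int \<Rightarrow> 'v \<Rightarrow> 'v" and \<tau> :: "int \<Rightarrow> real^2^2" and p :: "'v \<Rightarrow> real^2"
    and H :: "('v set, 'v set set) pre_digraph" and \<psi> :: "'v set set \<Rightarrow> int"
  assumes "\<tau> \<in> hom (integer_mod_group 3) C3_group"
    and "inj_on \<tau> (carrier (integer_mod_group 3))"
    and "simple_graph V E"
    and "\<theta> \<in> hom (integer_mod_group 3) (graph_aut_group V E)"
    and "free_action (integer_mod_group 3) V \<theta>"
    and "symmetric_regular (integer_mod_group 3) V E \<theta> \<tau> p"
    and "quotient_gain_graph (integer_mod_group 3) V E \<theta> H \<psi>"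
  shows "rank (rigidity_matrix E p) = 3 * gain_matroid_rank231 (integer_mod_group 3) H \<psi>"
proof -
  note car = carrier_integer_mod_group_3
  obtain \<omega> where \<omega>: "\<omega> ^ 3 = 1" "\<omega> \<noteq> 1"
    and \<tau>: "\<tau> 0 = complex_matrix 1" "\<tau> 1 = complex_matrix \<omega>" "\<tau> 2 = complex_matrix (\<omega> * \<omega>)"
    using faithful_representation_C3[OF assms(1,2)] .
  note act\<theta> = action_on_vertices[OF assms(4)]
  \<comment> \<open>Extended by the identity, since \<theta> is meaningful only on \<open>V\<close>;
    freeness then makes \<open>moved\<close> equal to \<open>V\<close>.\<close>
  define g where "g x = (if x \<in> V then \<theta> 1 x else x)" for x
  have gV: "g x = \<theta> 1 x" "g x \<in> V" if "x \<in> V" for x using act\<theta>(2)[OF that] that by (simp_all add: g_def)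
  interpret c3_symmetry g \<omega>
  proof
    show "g (g (g x)) = x" for x using act\<theta>(2,4) by (simp add: g_def)
  qed (rule \<omega>)+
  have moved: "moved = V"
    using assms(5) by (auto simp: moved_def g_def free_action_def car)
  have act: "\<theta> k x = act k x" if "k \<in> {0, 1, 2}" "x \<in> V" for k x
    using that act\<theta>[OF that(2)] gV by (auto simp: act_values)
  have E: "e \<subseteq> V" "card e = 2" if "e \<in> E" for e
    using assms(3) that by (auto simp: simple_graph_def)
  have aut: "{\<theta> 1 u, \<theta> 1 v} \<in> E \<longleftrightarrow> {u, v} \<in> E" if "u \<in> V" "v \<in> V" for u v
    using hom_in_carrier[OF assms(4), of 1] that by (auto simp: graph_aut_group_def car)
  have free: "free_graph E"
    unfolding free_graph_def
  proof
    fix e assume e: "e \<in> E"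
    then obtain u v where uv: "e = {u, v}" using E(2) by (fastforce simp: card_2_iff)
    then have "u \<in> V" "v \<in> V" using E(1)[OF e] by auto
    then have "g ` e \<in> E" using aut[of u v] e uv by (simp add: gV)
    then show "g ` e \<in> E \<and> e \<subseteq> moved \<and> card e = 2" using E[OF e] moved by simp
  qed
  have orbV: "orbit (integer_mod_group 3) \<theta> x = orb g x" if "x \<in> V" for x
    using act\<theta>[OF that] gV[OF that] gV(1)[of "g x"] by (simp add: orbit_integer_mod_group_3 orb_def)
  have orbE: "orbit (integer_mod_group 3) (\<lambda>\<gamma> e. \<theta> \<gamma> ` e) e = orb ((`) g) e" if "e \<in> E" for e
  proof -
    have "\<theta> 0 ` e = (\<lambda>x. x) ` e" "\<theta> 1 ` e = g ` e" "\<theta> 2 ` e = (\<lambda>x. g (g x)) ` e"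
      using E(1)[OF that] act\<theta> gV by (intro image_cong refl; metis subsetD)+
    then show ?thesis by (simp add: orbit_integer_mod_group_3 orb_def image_image)
  qed
  note Q = assms(7)[unfolded quotient_gain_graph_def]
  have HV: "verts H = orbits (integer_mod_group 3) V \<theta>" by (rule Q[THEN conjunct1])
  have HE: "arcs H = orbits (integer_mod_group 3) E (\<lambda>\<gamma> e. \<theta> \<gamma> ` e)"
    by (rule Q[THEN conjunct2, THEN conjunct1])
  obtain rep where R: "(\<forall>U \<in> verts H. rep U \<in> U) \<and> (\<forall>a \<in> arcs H.
      tail H a \<in> verts H \<and> head H a \<in> verts H \<and> \<psi> a \<in> carrier (integer_mod_group 3) \<and>
      a = {{\<theta> \<gamma> (rep (tail H a)), \<theta> (\<gamma> \<otimes>\<^bsub>integer_mod_group 3\<^esub> \<psi> a) (rep (head H a))} | \<gamma>.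
        \<gamma> \<in> carrier (integer_mod_group 3)})"
    using Q[THEN conjunct2, THEN conjunct2] by (elim exE)
  have rep: "rep U \<in> U" if "U \<in> verts H" for U
    using R[THEN conjunct1] that by (rule bspec)
  note arcs = R[THEN conjunct2, THEN bspec]
  have verts: "verts H = orb g ` moved"
    unfolding HV orbits_def moved using orbV by auto
  have repV: "rep U \<in> V" if "U \<in> verts H" for U
    using rep[OF that] that gV by (auto simp: verts moved orb_def)
  interpret gain_quotient g E H \<psi> rep
  proof
    show "arcs H = orb ((`) g) ` E"
      unfolding HE orbits_def using orbE by auto
    fix a assume a: "a \<in> arcs H"
    show t: "tail H a \<in> verts H \<and> head H a \<in> verts H"
      using arcs[OF a] by (elim conjE, intro conjI)
    show "\<psi> a \<in> carrier (integer_mod_group 3)"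
      by (rule arcs[OF a, THEN conjunct2, THEN conjunct2, THEN conjunct1])
    have "a = (\<lambda>k. {\<theta> k (rep (tail H a)), \<theta> ((k + \<psi> a) mod 3) (rep (head H a))}) ` {0, 1, 2}"
      using arcs[OF a, THEN conjunct2, THEN conjunct2, THEN conjunct2]
      unfolding Setcompr_eq_image car mult_integer_mod_group of_nat_numeral .
    also have "\<dots> = (\<lambda>k. {act k (rep (tail H a)), act (k + \<psi> a) (rep (head H a))}) ` {0, 1, 2}"
    proof (rule image_cong[OF refl])
      fix k :: int assume k: "k \<in> {0, 1, 2}"
      have "(k + \<psi> a) mod 3 \<in> {0, 1, 2}" by (cases "k + \<psi> a" rule: mod_3_cases) simp_all
      then show "{\<theta> k (rep (tail H a)), \<theta> ((k + \<psi> a) mod 3) (rep (head H a))}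
          = {act k (rep (tail H a)), act (k + \<psi> a) (rep (head H a))}"
        using k t by (simp add: act repV act_cong[of "(k + \<psi> a) mod 3" "k + \<psi> a"])
    qed
    also have "\<dots> = range (\<lambda>k. {act k (rep (tail H a)), act (k + \<psi> a) (rep (head H a))})"
    proof (intro equalityI subsetI)
      fix e assume "e \<in> range (\<lambda>k. {act k (rep (tail H a)), act (k + \<psi> a) (rep (head H a))})"
      then obtain k where "e = {act k (rep (tail H a)), act (k + \<psi> a) (rep (head H a))}" by blast
      also have "\<dots> = {act (k mod 3) (rep (tail H a)), act (k mod 3 + \<psi> a) (rep (head H a))}"
        by (simp add: act_cong[of "k mod 3" k] act_cong[of "k mod 3 + \<psi> a" "k + \<psi> a"] mod_simps)
      finally show "e \<in> (\<lambda>k. {act k (rep (tail H a)), act (k + \<psi> a) (rep (head H a))}) ` {0, 1, 2}"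
        by (rule image_eqI) (cases k rule: mod_3_cases; simp)
    qed (rule subsetD[OF image_mono[OF subset_UNIV]])
    finally show "a = range (\<lambda>k. {act k (rep (tail H a)), act (k + \<psi> a) (rep (head H a))})" .
  qed (fact free verts rep)+
  let ?\<Gamma> = "integer_mod_group 3"
  define \<S> where "\<S> = {S. S \<subseteq> arcs H \<and> gain_sparse231 ?\<Gamma> H \<psi> S}"
  have "{card S | S. S \<subseteq> arcs H \<and> gain_sparse231 ?\<Gamma> H \<psi> S} = card ` \<S>" by (auto simp: \<S>_def)
  then have rank_eq: "gain_matroid_rank231 ?\<Gamma> H \<psi> = Max (card ` \<S>)" by (simp add: gain_matroid_rank231_def)
  have "{} \<in> \<S>" by (auto simp: \<S>_def gain_sparse231_def)
  then have "Max (card ` \<S>) \<in> card ` \<S>" by (intro Max_in) auto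
  then obtain S where S: "S \<in> \<S>" "card S = Max (card ` \<S>)" by auto
  have max: "card S' \<le> card S" if "S' \<in> \<S>" for S' using that by (simp add: S(2))
  define D where "D = \<Union>S"
  have Sarcs: "S \<subseteq> arcs H" using S(1) by (simp add: \<S>_def)
  have D: "free_graph D" "D \<subseteq> E" "laman_sparse D" "card D = 3 * card S"
    using free_Union[OF Sarcs] card_Union_arcs[OF Sarcs] laman_of_gain_sparse[OF Sarcs] S(1)
    by (simp_all add: D_def \<S>_def)
  have "card D \<le> rank (rigidity_matrix E p)"
  proof -
    obtain q where q: "symmetric q" "general_position moved q" "stress_free D q"
      using exists_symmetric_stress_free[OF D(1,3)] by blast
    have qg: "q (\<theta> 1 v) = \<omega> * q v" if "v \<in> V" for v
      using q(1) gV(1)[OF that] by (metis symmetric_def)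
    \<comment> \<open>General position keeps adjacent vertices apart, so this placement is a
      competitor in the regularity of \<open>p\<close>.\<close>
    have "symmetric_framework ?\<Gamma> V E \<theta> \<tau> (\<lambda>v. vec2 (q v))"
      unfolding symmetric_framework_def framework_def car
    proof (intro conjI allI impI ballI)
      fix u v assume uv: "{u, v} \<in> E"
      then have "u \<noteq> v" using E(2)[OF uv] by auto
      then show "vec2 (q u) \<noteq> vec2 (q v)"
        using general_position_neq[OF q(2)] E(1)[OF uv] by (simp add: vec2_eq_iff moved)
    next
      fix \<gamma> :: int and v assume "\<gamma> \<in> {0, 1, 2}" "v \<in> V"
      then show "\<tau> \<gamma> *v vec2 (q v) = vec2 (q (\<theta> \<gamma> v))"
        using act\<theta>[of v] by (auto simp: \<tau> complex_matrix_vec2 qg mult.assoc)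
    qed
    then have "rank (rigidity_matrix E (\<lambda>v. vec2 (q v))) \<le> rank (rigidity_matrix E p)"
      using assms(6) by (simp add: symmetric_regular_def)
    moreover have "\<forall>e\<in>D. card e = 2" using D(1) by (simp add: free_graph_def)
    ultimately show ?thesis
      using card_le_rank_rigidity_matrix[OF q(3) D(2)] by linarith
  qed
  moreover have "rank (rigidity_matrix E p) \<le> card D"
  proof -
    have "framework E p" using assms(6) by (simp add: symmetric_regular_def symmetric_framework_def)
    then obtain B where B: "B \<subseteq> E" "laman_sparse B" "card B = rank (rigidity_matrix E p)"
      using rank_rigidity_matrix_sparse[of E p] E(2) by blast
    have D2: "\<forall>e\<in>D. card e = 2" using D(1) by (simp add: free_graph_def)
    \<comment> \<open>An edge of \<open>D\<close> is tight as a set of two vertices. For any other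
      edge the maximality of \<open>S\<close> forbids its orbit as a new arc, and a blocked orbit
      means a blocked edge.\<close>
    have "\<exists>X. tight D X \<and> e \<subseteq> X" if e: "e \<in> E" for e
    proof (cases "e \<in> D")
      case True
      then have "tight D e" using D2 by (simp add: tight_def deficit_edge)
      then show ?thesis by blast
    next
      case False
      define a where "a = orb ((`) g) e"
      have a: "a \<in> arcs H" using e by (simp add: arcs_H a_def)
      have "e \<in> a" by (simp add: a_def orb_def)
      then have "a \<notin> S" using False by (auto simp: D_def)
      then have "card (insert a S) > card S" by (simp add: card_insert_if)
      then have "insert a S \<notin> \<S>" using max[of "insert a S"] by linarith
      then have "\<not> gain_sparse231 ?\<Gamma> H \<psi> (insert a S)" using a Sarcs by (simp add: \<S>_def)
      then have "\<not> laman_sparse (\<Union>(insert a S))"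
        using gain_sparse_of_laman[of "insert a S"] a Sarcs by blast
      then have "\<not> laman_sparse (D \<union> orb ((`) g) e)" by (simp add: D_def a_def Un_commute)
      moreover have "e \<subseteq> moved" "card e = 2" using E[OF e] moved by simp_all
      ultimately show ?thesis using orbit_blocked[OF D(1,3)] by blast
    qed
    then have "card B \<le> card D"
      using B by (intro sparse_card_le D D2) blast+
    then show ?thesis by (simp add: B(3))
  qed
  ultimately show ?thesis by (simp add: rank_eq S(2)[symmetric] D(4))
qed

end
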